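(* Let $p>2$ and let $\mathcal G$ be a regular single-knot metric graph (of some length $\ell>0$). Then there exists an action ground-state on $\mathcal G$.
   Context: A single-knot metric graph consists of $H\ge1$ half-lines, $P\ge0$ pendants (bounded edges joining the vertex $\mathbf 0$ to a terminal vertex) and $L\ge0$ loops (bounded edges with both endpoints at $\mathbf 0$), all attached at one vertex $\mathbf 0$. It is regular of length $\ell$ if each pendant has length $\ell$ and each loop has length $2\ell$. Edges are identified with intervals $[0,\ell_\kappa]$ or $[0,\infty)$ with $\mathbf 0$ at $x=0$. $H^1(\mathcal G)$ is the set of continuous functions on $\mathcal G$ that are $H^1$ on each edge. A bound-state is a nontrivial $u\in H^1(\mathcal G)$ with $\int_{\mathcal G}u'\eta'+u\eta-|u|^{p-2}u\eta=0$ for all $\eta\in H^1(\mathcal G)$. The action is $S(u)=\frac12\int_{\mathcal G}(|u'|^2+|u|^2)-\frac1p\int_{\mathcal G}|u|^p$, $\mathcal S_{\mathcal G}=\inf\{S(u):u\text{ bound-state}\}$, and an action ground-state is a bound-state attaining $\mathcal S_{\mathcal G}$. *)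

theory Defs
  imports "HOL-Analysis.Analysis"
begin

text \<open>Single-knot metric graph with H half-lines, P pendants, L loops, regular of
  length l: pendants are [0,l], loops are [0,2l], half-lines are [0,\<infinity>), and the
  vertex 0 sits at x = 0 of every edge (and also at x = 2l of every loop).
  A function on the graph is a family of functions indexed by edges.\<close>

datatype edge = Half nat | Pend nat | Loop nat

definition edges :: "nat \<Rightarrow> nat \<Rightarrow> nat \<Rightarrow> edge set" where
  "edges H P L = {Half i | i. i < H} \<union> {Pend i | i. i < P} \<union> {Loop i | i. i < L}"

fun edom :: "real \<Rightarrow> edge \<Rightarrow> real set" where
  "edom l (Half i) = {0..}"
| "edom l (Pend i) = {0..l}"
| "edom l (Loop i) = {0..2*l}"

text \<open>H^1 on an interval I = [0,b] or [0,\<infinity>) (continuous representative):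
  u is square integrable, and u(x) = u(0) + \<integral>_0^x g with g square integrable
  (g is then the weak derivative u').\<close>
definition H1_edge :: "real set \<Rightarrow> (real \<Rightarrow> real) \<Rightarrow> (real \<Rightarrow> real) \<Rightarrow> bool" where
  "H1_edge I u g \<longleftrightarrow>
     (\<forall>x\<in>I. set_integrable lborel {0..x} g \<and> u x = u 0 + (LBINT t:{0..x}. g t)) \<and>
     set_integrable lborel I (\<lambda>t. (u t)\<^sup>2) \<and> set_integrable lborel I (\<lambda>t. (g t)\<^sup>2)"

definition H1_graph :: "nat \<Rightarrow> nat \<Rightarrow> nat \<Rightarrow> real \<Rightarrow>
    (edge \<Rightarrow> real \<Rightarrow> real) \<Rightarrow> (edge \<Rightarrow> real \<Rightarrow> real) \<Rightarrow> bool" where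
  "H1_graph H P L l u du \<longleftrightarrow>
     (\<forall>e\<in>edges H P L. H1_edge (edom l e) (u e) (du e)) \<and>
     (\<exists>c. \<forall>e\<in>edges H P L. u e 0 = c) \<and>
     (\<forall>i<L. u (Loop i) (2*l) = u (Loop i) 0)"

definition graph_int :: "nat \<Rightarrow> nat \<Rightarrow> nat \<Rightarrow> real \<Rightarrow> (edge \<Rightarrow> real \<Rightarrow> real) \<Rightarrow> real" where
  "graph_int H P L l f = (\<Sum>e\<in>edges H P L. LBINT x:edom l e. f e x)"

definition bound_state :: "nat \<Rightarrow> nat \<Rightarrow> nat \<Rightarrow> real \<Rightarrow> real \<Rightarrow>
    (edge \<Rightarrow> real \<Rightarrow> real) \<Rightarrow> (edge \<Rightarrow> real \<Rightarrow> real) \<Rightarrow> bool" where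
  "bound_state H P L l p u du \<longleftrightarrow>
     H1_graph H P L l u du \<and>
     (\<exists>e\<in>edges H P L. \<exists>x\<in>edom l e. u e x \<noteq> 0) \<and>
     (\<forall>\<eta> d\<eta>. H1_graph H P L l \<eta> d\<eta> \<longrightarrow>
        graph_int H P L l (\<lambda>e x. du e x * d\<eta> e x + u e x * \<eta> e x
                              - \<bar>u e x\<bar> powr (p - 2) * u e x * \<eta> e x) = 0)"

definition action :: "nat \<Rightarrow> nat \<Rightarrow> nat \<Rightarrow> real \<Rightarrow> real \<Rightarrow>
    (edge \<Rightarrow> real \<Rightarrow> real) \<Rightarrow> (edge \<Rightarrow> real \<Rightarrow> real) \<Rightarrow> real" where
  "action H P L l p u du =
     1/2 * graph_int H P L l (\<lambda>e x. (du e x)\<^sup>2 + (u e x)\<^sup>2)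
     - 1/p * graph_int H P L l (\<lambda>e x. \<bar>u e x\<bar> powr p)"

definition action_ground_state :: "nat \<Rightarrow> nat \<Rightarrow> nat \<Rightarrow> real \<Rightarrow> real \<Rightarrow>
    (edge \<Rightarrow> real \<Rightarrow> real) \<Rightarrow> (edge \<Rightarrow> real \<Rightarrow> real) \<Rightarrow> bool" where
  "action_ground_state H P L l p u du \<longleftrightarrow>
     bound_state H P L l p u du \<and>
     (\<forall>v dv. bound_state H P L l p v dv \<longrightarrow> action H P L l p u du \<le> action H P L l p v dv)"

end

theory Submission
  imports Defs
begin

text \<open>A bound state is a classical solution of \<open>u'' = u - \<bar>u\<bar>\<^sup>p\<^sup>-\<^sup>2u\<close> on every edge, with the Neumann
  condition at the pendants and the Kirchhoff condition at the vertex, and its action is a positive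
  multiple of \<open>\<integral>\<bar>u\<bar>\<^sup>p\<close>. Along a minimising sequence the initial data at the vertex are bounded, so by
  continuous dependence a subsequence converges locally uniformly, and by Fatou's lemma the limit is a
  minimiser unless it vanishes identically.

  It cannot vanish: let c be the small value at the vertex and N = P + 2 L. The half-lines have zero
  energy, hence slope \<open>\<plusminus>c s\<close> with \<open>s\<^sup>2 = 1 - (2/p) c\<^sup>p\<^sup>-\<^sup>2\<close>, and pairing the compact edges with cosh turns the
  Kirchhoff condition into \<open>N tanh l - k s = \<theta> c\<^sup>p\<^sup>-\<^sup>2\<close> with an integer k, where \<open>\<theta>\<close> is bounded and exceeds
  \<open>N tanh l / p\<close> by a fixed amount. For small c this forces \<open>k = N tanh l\<close> and then contradicts the
  expansion of s. When N = 0 there is no compact edge, but then all bound states have the same action.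

  Regularity of the graph enters only in the existence of some bound state: one solution serves all
  pendants and, after reflection, all loops.\<close>

section \<open>Initial value problems\<close>

text \<open>The obstacle is loss of compactness: a soliton bump may run off along a half-line, so
  minimising sequences need not converge in H^1. This is harmless for the infimum, since a
  nonnegative integral can only drop in the limit, and the equation and the vertex conditions
  survive locally uniform convergence. If the limit vanishes, the sequence becomes small on the
  compact edges only; far out on the half-lines it may stay large.

  The case k = N tanh l is decided at order c^(p-2). The half-lines contribute N tanh l (1 - s),
  which is N tanh l c^(p-2) / p to first order, and the compact edges at least (N tanh l / p + N
  \<gamma>) c^(p-2). The surplus \<gamma> > 0 stems from (sinh cosh^(p-1))' = p cosh^p - (p-1)
  cosh^(p-2); without the last term both sides would agree to leading order and nothing would
  follow.\<close>

lemma has_derivative_abs_powr: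
  fixes x r :: real
  assumes "r > 1"
  shows "((\<lambda>x. \<bar>x\<bar> powr r) has_real_derivative r * (\<bar>x\<bar> powr (r - 2) * x)) (at x)"
proof -
  consider "x > 0" | "x < 0" | "x = 0" by linarith
  then show ?thesis
  proof cases
    case 1
    have "((\<lambda>x. x powr r) has_real_derivative r * x powr (r - 1)) (at x)"
      using 1 by (auto intro!: derivative_eq_intros)
    then have "((\<lambda>x. \<bar>x\<bar> powr r) has_real_derivative r * x powr (r - 1)) (at x)"
      by (rule has_field_derivative_transform_within_open[where S = "{0<..}"]) (use 1 in auto)
    moreover have "x powr (r - 1) = x powr (r - 2) * x"
      using 1 powr_add[of x "r - 2" 1] by simp
    ultimately show ?thesis using 1 by simp
  next
    case 2
    have "((\<lambda>x. (- x) powr r) has_real_derivative - (r * (- x) powr (r - 1))) (at x)"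
      using 2 by (auto intro!: derivative_eq_intros)
    then have "((\<lambda>x. \<bar>x\<bar> powr r) has_real_derivative - (r * (- x) powr (r - 1))) (at x)"
      by (rule has_field_derivative_transform_within_open[where S = "{..<0}"]) (use 2 in auto)
    moreover have "(- x) powr (r - 1) = (- x) powr (r - 2) * (- x)"
      using 2 powr_add[of "- x" "r - 2" 1] by simp
    ultimately show ?thesis using 2 by simp
  next
    case 3
    have "((\<lambda>h::real. \<bar>h\<bar> powr (r - 1)) \<longlongrightarrow> 0) (at 0)"
      by (rule tendsto_eq_intros tendsto_ident_at | use assms in force)+
    then have "((\<lambda>h::real. \<bar>h\<bar> powr r / h) \<longlongrightarrow> 0) (at 0)"
    proof (rule Lim_null_comparison[rotated])
      have "norm (\<bar>h\<bar> powr r / h) \<le> \<bar>h\<bar> powr (r - 1)" for h :: real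
        using powr_diff[of "\<bar>h\<bar>" r 1] by (cases "h = 0") (auto simp: abs_mult)
      then show "\<forall>\<^sub>F h in at 0. norm (\<bar>h\<bar> powr r / h) \<le> \<bar>h\<bar> powr (r - 1)" for h :: real
        by (intro always_eventually) auto
    qed
    then show ?thesis using 3 by (simp add: DERIV_def)
  qed
qed

lemma has_derivative_abs_powr_mult:
  fixes x r :: real
  assumes "r > 0"
  shows "((\<lambda>x. \<bar>x\<bar> powr r * x) has_real_derivative (r + 1) * \<bar>x\<bar> powr r) (at x)"
proof (cases "x = 0")
  case True
  have "((\<lambda>h::real. \<bar>h\<bar> powr r) \<longlongrightarrow> 0) (at 0)"
    by (rule tendsto_eq_intros tendsto_ident_at | use assms in force)+
  then have "((\<lambda>h::real. \<bar>h\<bar> powr r * h / h) \<longlongrightarrow> 0) (at 0)"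
    by (rule Lim_transform_eventually) (auto simp: eventually_at intro!: exI[of _ 1])
  then show ?thesis using True by (simp add: DERIV_def)
next
  case False
  then have nz: "\<bar>x\<bar> > 0" by simp
  have d: "((\<lambda>x. \<bar>x\<bar>) has_real_derivative sgn x) (at x)"
  proof (cases "x > 0")
    case True
    have "((\<lambda>x. x) has_real_derivative 1) (at x)" by (rule DERIV_ident)
    then have "((\<lambda>x. \<bar>x\<bar>) has_real_derivative 1) (at x)"
      by (rule has_field_derivative_transform_within_open[where S = "{0<..}"]) (use True in auto)
    then show ?thesis using True by simp
  next
    case neg: False
    have "((\<lambda>x. - x) has_real_derivative -1) (at x)" by (auto intro!: derivative_eq_intros)
    then have "((\<lambda>x. \<bar>x\<bar>) has_real_derivative -1) (at x)"
      by (rule has_field_derivative_transform_within_open[where S = "{..<0}"]) (use neg False in auto)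
    then show ?thesis using neg False by simp
  qed
  have "((\<lambda>y. \<bar>y\<bar> powr r * y) has_real_derivative
      (r * \<bar>x\<bar> powr (r - 1) * sgn x) * x + \<bar>x\<bar> powr r) (at x)"
    using nz by (auto intro!: derivative_eq_intros d)
  moreover have "(r * \<bar>x\<bar> powr (r - 1) * sgn x) * x = r * \<bar>x\<bar> powr r"
  proof -
    have "sgn x * x = \<bar>x\<bar>" by (simp add: abs_sgn)
    moreover have "\<bar>x\<bar> powr (r - 1) * \<bar>x\<bar> = \<bar>x\<bar> powr r" 
      using nz powr_add[of "\<bar>x\<bar>" "r - 1" 1] by simp
    ultimately show ?thesis by (metis mult.assoc)
  qed
  moreover have "r * \<bar>x\<bar> powr r + \<bar>x\<bar> powr r = (r + 1) * \<bar>x\<bar> powr r"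
    by (simp add: algebra_simps)
  ultimately show ?thesis by simp
qed

lemma abs_powr_mult_lipschitz:
  fixes a b r T :: real
  assumes "r > 0" "\<bar>a\<bar> \<le> T" "\<bar>b\<bar> \<le> T"
  shows "\<bar>\<bar>a\<bar> powr r * a - \<bar>b\<bar> powr r * b\<bar> \<le> (r + 1) * T powr r * \<bar>a - b\<bar>"
proof -
  have "norm ((\<lambda>x. \<bar>x\<bar> powr r * x) a - (\<lambda>x. \<bar>x\<bar> powr r * x) b) \<le> (r + 1) * T powr r * norm (a - b)"
  proof (rule field_differentiable_bound[of "{-T..T}"])
    show "((\<lambda>x. \<bar>x\<bar> powr r * x) has_real_derivative (r + 1) * \<bar>x\<bar> powr r) (at x within {-T..T})" for x
      using has_derivative_abs_powr_mult[OF assms(1)] by (rule has_field_derivative_at_within)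
    show "norm ((r + 1) * \<bar>x\<bar> powr r) \<le> (r + 1) * T powr r" if "x \<in> {-T..T}" for x
      using that assms by (auto simp: abs_mult intro!: mult_left_mono powr_mono2)
  qed (use assms in auto)
  then show ?thesis by simp
qed

text \<open>Derivatives are taken within the closed interval because solutions on an edge are only
  known there; the interior supplies two-sided derivatives and continuity takes care of the
  endpoints.\<close>

lemma nonneg_derivative_within_imp_mono:
  fixes f :: "real \<Rightarrow> real"
  assumes f: "\<And>x. x \<in> {a..b} \<Longrightarrow> (f has_real_derivative f' x) (at x within {a..b})"
    and nonneg: "\<And>x. x \<in> {a..b} \<Longrightarrow> f' x \<ge> 0" and "a \<le> x" "x \<le> y" "y \<le> b"
  shows "f x \<le> f y"
proof (rule DERIV_nonneg_imp_increasing_open[OF \<open>x \<le> y\<close>])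
  fix t assume "x < t" "t < y"
  then have t: "t \<in> interior {a..b}" using assms by auto
  then have "(f has_real_derivative f' t) (at t)"
    using f[of t] at_within_interior[OF t] by auto
  moreover have "f' t \<ge> 0" using t nonneg interior_subset by blast
  ultimately show "\<exists>d. (f has_real_derivative d) (at t) \<and> 0 \<le> d" by blast
next
  have "continuous_on {a..b} f" using f by (rule DERIV_continuous_on)
  then show "continuous_on {x..y} f" by (rule continuous_on_subset) (use assms in auto)
qed

lemma nonpos_derivative_within_imp_antimono:
  fixes f :: "real \<Rightarrow> real"
  assumes f: "\<And>x. x \<in> {a..b} \<Longrightarrow> (f has_real_derivative f' x) (at x within {a..b})"
    and "\<And>x. x \<in> {a..b} \<Longrightarrow> f' x \<le> 0" "a \<le> x" "x \<le> y" "y \<le> b"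
  shows "f y \<le> f x"
  using nonneg_derivative_within_imp_mono[of a b "\<lambda>x. - f x" "\<lambda>x. - f' x" x y] assms
  by (auto intro: DERIV_minus)

text \<open>Contraction for the weighted norm \<open>sup\<^sub>x e\<^sup>-\<^sup>\<lambda>\<^sup>x \<parallel>y x\<parallel>\<close> with
  \<open>\<lambda> = 2 K\<close>: this gives the solution on the whole half-line in one step.\<close>
lemma lipschitz_ode_global_solution:
  fixes F :: "'a::euclidean_space \<Rightarrow> 'a" and K :: real
  assumes K: "K > 0" and lip: "\<And>a b. norm (F a - F b) \<le> K * norm (a - b)" and F0: "F 0 = 0"
  obtains y where "y 0 = y0" "\<And>x. 0 \<le> x \<Longrightarrow> (y has_vector_derivative F (y x)) (at x within {0..})"
proof -
  define lam where "lam = 2 * K"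
  have lpos: "lam > 0" using K by (simp add: lam_def)
  have contF: "continuous_on UNIV F"
  proof (rule lipschitz_on_continuous_on)
    show "K-lipschitz_on UNIV F" using K lip by (auto simp: lipschitz_on_def dist_norm)
  qed
  \<comment> \<open>\<open>z\<close> stands for the weighted solution
    \<open>exp (- lam * x) *\<^sub>R y x\<close>, which is bounded although \<open>y\<close> may
    grow.\<close>
  define h where "h z s = F (exp (lam * s) *\<^sub>R apply_bcontfun z s)" for z :: "real \<Rightarrow>\<^sub>C 'a" and s
  have conth: "continuous_on S (h z)" for z S
    unfolding h_def by (rule continuous_on_compose2[OF contF]) (auto intro!: continuous_intros)
  \<comment> \<open>Bounded continuous functions live on the whole line, whereas the equation is
    posed for \<open>x \<ge> 0\<close>; \<open>max 0 x\<close> extends \<open>\<Psi> z\<close>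
    constantly to the left.\<close>
  define \<Psi> where "\<Psi> z x = exp (- lam * max 0 x) *\<^sub>R (y0 + integral {0..max 0 x} (h z))" for z x
  have exp_int: "((\<lambda>s. exp (lam * s)) has_integral (exp (lam * t) - 1) / lam) {0..t}" if "t \<ge> 0" for t
  proof -
    have "((\<lambda>s. exp (lam * s)) has_integral (exp (lam * t) / lam - exp (lam * 0) / lam)) {0..t}"
      by (rule fundamental_theorem_of_calculus[OF that])
        (use lpos in \<open>auto simp flip: has_real_derivative_iff_has_vector_derivative
            intro!: derivative_eq_intros\<close>)
    then show ?thesis by (simp add: diff_divide_distrib)
  qed
  \<comment> \<open>Used twice: with \<open>f = 0\<close> for the boundedness of
    \<open>\<Psi> z\<close> and with \<open>f = h z2\<close> for the contraction. The factor 1/2 is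
    \<open>K / lam\<close>.\<close>
  have diff_bound: "norm (exp (- lam * t) *\<^sub>R (integral {0..t} (\<lambda>s. h z s - f s))) \<le> B / 2"
    if t: "t \<ge> 0" and B: "\<And>s. norm (h z s - f s) \<le> K * B * exp (lam * s)"
      and c: "continuous_on {0..t} f" for z f t B
  proof -
    have B0: "B \<ge> 0"
    proof -
      have "0 \<le> K * B * exp (lam * 0)" using B[of 0] norm_ge_zero order_trans by blast
      then show ?thesis using K by (simp add: zero_le_mult_iff)
    qed
    have i: "(\<lambda>s. h z s - f s) integrable_on {0..t}"
      by (intro integrable_continuous_real continuous_intros conth c)
    have "norm (integral {0..t} (\<lambda>s. h z s - f s)) \<le> integral {0..t} (\<lambda>s. K * B * exp (lam * s))"
      by (rule integral_norm_bound_integral[OF i]) (auto intro!: integrable_continuous_real continuous_intros B)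
    also have "\<dots> = K * B * ((exp (lam * t) - 1) / lam)"
      using exp_int[OF t] by (simp add: integral_unique)
    also have "\<dots> \<le> B / 2 * exp (lam * t)" 
      using B0 K by (simp add: lam_def field_simps)
    finally have "norm (integral {0..t} (\<lambda>s. h z s - f s)) \<le> B / 2 * exp (lam * t)" .
    then have "exp (- lam * t) * norm (integral {0..t} (\<lambda>s. h z s - f s)) \<le> exp (- lam * t) * (B / 2 * exp (lam * t))"
      by (intro mult_left_mono) auto
    also have "\<dots> = B / 2" by (simp add: exp_minus)
    finally show ?thesis by simp
  qed
  have \<Psi>_mem: "\<Psi> z \<in> bcontfun" for z
  proof (rule bcontfun_normI)
    have "continuous_on {0..} (\<lambda>x. integral {0..x} (h z))"
      unfolding continuous_on_eq_continuous_within
    proof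
      fix x :: real assume x: "x \<in> {0..}"
      have "continuous_on {0..x+1} (\<lambda>x. integral {0..x} (h z))"
        by (intro indefinite_integral_continuous_1 integrable_continuous_real conth)
      then have "continuous (at x within {0..x+1}) (\<lambda>x. integral {0..x} (h z))"
        using x by (auto simp: continuous_on_eq_continuous_within)
      moreover have "at x within {0..x+1} = at x within {0..}"
        by (rule at_within_nhd[of _ "{..<x+1}"]) auto
      ultimately show "continuous (at x within {0..}) (\<lambda>x. integral {0..x} (h z))" by simp
    qed
    then have "continuous_on UNIV (\<lambda>x. integral {0..max 0 x} (h z))"
      by (rule continuous_on_compose2) (auto intro!: continuous_intros)
    then show "continuous_on UNIV (\<Psi> z)"
      unfolding \<Psi>_def by (intro continuous_intros)
    fix x
    have "norm (\<Psi> z x) \<le> exp (- lam * max 0 x) * norm y0 + norm (exp (- lam * max 0 x) *\<^sub>R (integral {0..max 0 x} (\<lambda>s. h z s - 0)))"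
      unfolding \<Psi>_def by (simp add: scaleR_add_right norm_triangle_le)
    also have "\<dots> \<le> 1 * norm y0 + norm z / 2"
    proof (intro add_mono mult_right_mono diff_bound)
      fix s
      show "norm (h z s - 0) \<le> K * norm z * exp (lam * s)"
        using lip[of "exp (lam * s) *\<^sub>R apply_bcontfun z s" 0] F0 norm_bounded[of z s] K
        by (auto simp: h_def mult_ac intro: order_trans mult_left_mono)
    qed (use lpos in auto)
    finally show "norm (\<Psi> z x) \<le> norm y0 + norm z / 2" by simp
  qed
  define \<Phi> where "\<Phi> z = Bcontfun (\<Psi> z)" for z
  have app: "apply_bcontfun (\<Phi> z) = \<Psi> z" for z
    unfolding \<Phi>_def using \<Psi>_mem by (simp add: Bcontfun_inverse)
  have "\<exists>!z. \<Phi> z = z"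
  proof (rule banach_fix_type[of "1/2"]; (intro allI)?)
    fix z1 z2
    show "dist (\<Phi> z1) (\<Phi> z2) \<le> 1/2 * dist z1 z2"
    proof (rule dist_bound)
      fix x
      have "\<Psi> z1 x - \<Psi> z2 x = exp (- lam * max 0 x) *\<^sub>R (integral {0..max 0 x} (\<lambda>s. h z1 s - h z2 s))"
        unfolding \<Psi>_def
        by (subst Henstock_Kurzweil_Integration.integral_diff)
          (auto intro!: integrable_continuous_real conth simp: scaleR_diff_right scaleR_add_right)
      moreover have "norm (exp (- lam * max 0 x) *\<^sub>R (integral {0..max 0 x} (\<lambda>s. h z1 s - h z2 s))) \<le> dist z1 z2 / 2"
      proof (rule diff_bound)
        fix s
        have "norm (h z1 s - h z2 s) \<le> K * (exp (lam * s) * dist (apply_bcontfun z1 s) (apply_bcontfun z2 s))"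
          using lip[of "exp (lam * s) *\<^sub>R apply_bcontfun z1 s" "exp (lam * s) *\<^sub>R apply_bcontfun z2 s"]
          by (simp add: h_def dist_norm flip: scaleR_diff_right)
        also have "\<dots> \<le> K * (exp (lam * s) * dist z1 z2)"
          using K by (intro mult_left_mono dist_bounded) auto
        finally show "norm (h z1 s - h z2 s) \<le> K * dist z1 z2 * exp (lam * s)" by (simp add: mult_ac)
      qed (auto intro: conth)
      ultimately show "dist (apply_bcontfun (\<Phi> z1) x) (apply_bcontfun (\<Phi> z2) x) \<le> 1/2 * dist z1 z2"
        by (simp add: app dist_norm)
    qed
  qed auto
  then obtain z where z: "\<Phi> z = z" by auto
  define y where "y x = exp (lam * x) *\<^sub>R apply_bcontfun z x" for x
  have hy: "h z = (\<lambda>x. F (y x))" by (simp add: h_def y_def fun_eq_iff)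
  have y: "y x = y0 + integral {0..x} (\<lambda>s. F (y s))" if "x \<ge> 0" for x
  proof -
    have "apply_bcontfun z x = \<Psi> z x" using app z by metis
    then show ?thesis using that unfolding y_def[of x] \<Psi>_def hy
      by (simp flip: exp_add)
  qed
  show thesis
  proof
    show "y 0 = y0" using y[of 0] by simp
    fix x :: real assume x: "x \<ge> 0"
    have "((\<lambda>x. integral {0..x} (h z)) has_vector_derivative h z x) (at x within {0..x+1})"
      by (rule integral_has_vector_derivative[OF conth]) (use x in auto)
    then have "((\<lambda>x. y0 + integral {0..x} (h z)) has_vector_derivative h z x) (at x within {0..x+1})"
      by (auto intro: derivative_eq_intros)
    then have "(y has_vector_derivative h z x) (at x within {0..x+1})"
      by (rule has_vector_derivative_transform[rotated 2]) (use x y hy in auto)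
    moreover have "at x within {0..x+1} = at x within {0..}"
      by (rule at_within_nhd[of _ "{..<x+1}"]) auto
    ultimately show "(y has_vector_derivative F (y x)) (at x within {0..})" by (simp add: hy)
  qed
qed

text \<open>With \<open>a = u - v\<close> and \<open>d = w - z\<close>, the rate
  \<open>1 + K\<close> adds up two applications of
  \<open>2 * a * d \<le> a\<^sup>2 + d\<^sup>2\<close>: one for the derivative of \<open>a\<close>,
  one for that of \<open>d\<close> through the Lipschitz bound. The weighted squared distance
  therefore decreases.\<close>

lemma gronwall_second_order:
  fixes u w v z :: "real \<Rightarrow> real" and K b x :: real and g :: "real \<Rightarrow> real"
  assumes u: "\<And>x. x \<in> {0..b} \<Longrightarrow> (u has_real_derivative w x) (at x within {0..b})"
    and w: "\<And>x. x \<in> {0..b} \<Longrightarrow> (w has_real_derivative g (u x)) (at x within {0..b})"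
    and v: "\<And>x. x \<in> {0..b} \<Longrightarrow> (v has_real_derivative z x) (at x within {0..b})"
    and z: "\<And>x. x \<in> {0..b} \<Longrightarrow> (z has_real_derivative g (v x)) (at x within {0..b})"
    and lip: "\<And>x. x \<in> {0..b} \<Longrightarrow> \<bar>g (u x) - g (v x)\<bar> \<le> K * \<bar>u x - v x\<bar>"
    and K: "K \<ge> 0" and x: "x \<in> {0..b}"
  shows "(u x - v x)\<^sup>2 + (w x - z x)\<^sup>2 \<le> exp ((1 + K) * x) * ((u 0 - v 0)\<^sup>2 + (w 0 - z 0)\<^sup>2)"
proof -
  define E where "E x = exp (- (1 + K) * x) * ((u x - v x)\<^sup>2 + (w x - z x)\<^sup>2)" for x
  define E' where "E' x = exp (- (1 + K) * x) * (2 * ((u x - v x) * (w x - z x))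
      + 2 * ((w x - z x) * (g (u x) - g (v x))) - (1 + K) * ((u x - v x)\<^sup>2 + (w x - z x)\<^sup>2))" for x
  have "(E has_real_derivative E' y) (at y within {0..b})" if "y \<in> {0..b}" for y
    unfolding E_def E'_def
    using u[OF that] w[OF that] v[OF that] z[OF that]
    by (auto intro!: derivative_eq_intros simp: algebra_simps power2_eq_square)
  moreover have "E' y \<le> 0" if "y \<in> {0..b}" for y
  proof -
    define a where "a = u y - v y"
    define d where "d = w y - z y"
    have "2 * (a * d) \<le> a\<^sup>2 + d\<^sup>2" using sum_squares_bound[of a d] by (simp add: mult_ac)
    moreover have "2 * (d * (g (u y) - g (v y))) \<le> K * (a\<^sup>2 + d\<^sup>2)"
    proof -
      have "d * (g (u y) - g (v y)) \<le> \<bar>d\<bar> * (K * \<bar>a\<bar>)"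
        using mult_left_mono[OF lip[OF that], of "\<bar>d\<bar>"] abs_ge_self[of "d * (g (u y) - g (v y))"]
        by (simp add: abs_mult a_def)
      moreover have "2 * (\<bar>d\<bar> * \<bar>a\<bar>) \<le> a\<^sup>2 + d\<^sup>2"
        using sum_squares_bound[of "\<bar>a\<bar>" "\<bar>d\<bar>"] by (simp add: mult_ac)
      moreover have "K * (2 * (\<bar>d\<bar> * \<bar>a\<bar>)) \<le> K * (a\<^sup>2 + d\<^sup>2)"
        using K calculation(2) by (intro mult_left_mono)
      moreover have "2 * (\<bar>d\<bar> * (K * \<bar>a\<bar>)) = K * (2 * (\<bar>d\<bar> * \<bar>a\<bar>))" by simp
      ultimately show ?thesis by linarith
    qed
    ultimately have le: "2 * (a * d) + 2 * (d * (g (u y) - g (v y))) - (1 + K) * (a\<^sup>2 + d\<^sup>2) \<le> 0"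
      by (simp add: algebra_simps)
    show ?thesis unfolding E'_def
      by (rule mult_nonneg_nonpos[OF exp_ge_zero le[unfolded a_def d_def]])
  qed
  ultimately have "E x \<le> E 0"
    using x by (intro nonpos_derivative_within_imp_antimono[of 0 b E E']) auto
  then have "exp ((1 + K) * x) * E x \<le> exp ((1 + K) * x) * E 0" by simp
  moreover have "exp ((1 + K) * x) * exp (- (1 + K) * x) = 1"
    by (simp add: algebra_simps flip: exp_add)
  then have "exp ((1 + K) * x) * E x = (u x - v x)\<^sup>2 + (w x - z x)\<^sup>2"
    unfolding E_def by (metis mult.assoc mult_1)
  moreover have "E 0 = (u 0 - v 0)\<^sup>2 + (w 0 - z 0)\<^sup>2" by (simp add: E_def)
  ultimately show ?thesis by metis
qed

section \<open>The stationary equation, its truncation and its energy\<close>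

locale nls =
  fixes p :: real
  assumes p_gt_2: "p > 2"
begin

definition nl :: "real \<Rightarrow> real" where "nl x = \<bar>x\<bar> powr (p - 2) * x"
text \<open>A primitive of \<open>x - nl x\<close>, so that
  \<open>(w x)\<^sup>2 / 2 - pot (u x)\<close> is the energy conserved along solutions.\<close>

definition pot :: "real \<Rightarrow> real" where "pot x = x\<^sup>2 / 2 - \<bar>x\<bar> powr p / p"
text \<open>Truncating the argument at level T makes the nonlinearity globally Lipschitz, so that initial
  value problems are solvable on the whole half-line; a solution bounded by T solves both equations.\<close>
definition clip :: "real \<Rightarrow> real \<Rightarrow> real" where "clip T x = max (- T) (min T x)"
definition tnl :: "real \<Rightarrow> real \<Rightarrow> real" where "tnl T x = clip T x - nl (clip T x)"
definition lipc :: "real \<Rightarrow> real" where "lipc T = 1 + (p - 1) * T powr (p - 2)"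

definition sol :: "real set \<Rightarrow> (real \<Rightarrow> real) \<Rightarrow> (real \<Rightarrow> real) \<Rightarrow> bool" where
  "sol I u w \<longleftrightarrow> (\<forall>x\<in>I. (u has_real_derivative w x) (at x within I) \<and>
      (w has_real_derivative u x - nl (u x)) (at x within I))"

definition tsol :: "real \<Rightarrow> real set \<Rightarrow> (real \<Rightarrow> real) \<Rightarrow> (real \<Rightarrow> real) \<Rightarrow> bool" where
  "tsol T I u w \<longleftrightarrow> (\<forall>x\<in>I. (u has_real_derivative w x) (at x within I) \<and>
      (w has_real_derivative tnl T (u x)) (at x within I))"

lemma nl_0 [simp]: "nl 0 = 0" by (simp add: nl_def)
lemma nl_1 [simp]: "nl 1 = 1" by (simp add: nl_def)
lemma nl_minus [simp]: "nl (- x) = - nl x" by (simp add: nl_def)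

lemma nl_pos: "x \<ge> 0 \<Longrightarrow> nl x = x powr (p - 1)"
  using powr_add[of x "p - 2" 1] by (cases "x = 0") (auto simp: nl_def)

lemma nl_mult: "nl x * x = \<bar>x\<bar> powr p"
proof -
  have "\<bar>x\<bar> powr p = \<bar>x\<bar> powr (p - 2) * \<bar>x\<bar> powr 2"
    using powr_add[of "\<bar>x\<bar>" "p - 2" 2] by simp
  also have "\<bar>x\<bar> powr 2 = x * x" by (cases "x = 0") (auto simp: power2_eq_square)
  finally show ?thesis by (simp add: nl_def)
qed

lemma continuous_nl [continuous_intros]:
  "continuous_on S f \<Longrightarrow> continuous_on S (\<lambda>x. nl (f x))" for f :: "real \<Rightarrow> real"
proof -
  have "continuous_on UNIV nl"
    unfolding nl_def[abs_def] using p_gt_2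
    by (intro DERIV_continuous_on[of UNIV]) (rule has_field_derivative_at_within, rule has_derivative_abs_powr_mult, simp)
  then show "continuous_on S f \<Longrightarrow> continuous_on S (\<lambda>x. nl (f x))"
    by (rule continuous_on_compose2) auto
qed

lemma pot_derivative: "(pot has_real_derivative x - nl x) (at x)"
proof -
  have "((\<lambda>x. x\<^sup>2 / 2 - \<bar>x\<bar> powr p / p) has_real_derivative
      2 * x / 2 - p * (\<bar>x\<bar> powr (p - 2) * x) / p) (at x)"
    using p_gt_2 by (intro DERIV_diff DERIV_cdivide has_derivative_abs_powr) (auto intro!: derivative_eq_intros)
  then show ?thesis using p_gt_2 by (simp add: pot_def[abs_def] nl_def)
qed

lemma clip_id: "\<bar>x\<bar> \<le> T \<Longrightarrow> clip T x = x" by (auto simp: clip_def)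

lemma tnl_id: "\<bar>x\<bar> \<le> T \<Longrightarrow> tnl T x = x - nl x" by (simp add: tnl_def clip_id)

lemma lipc_pos: "lipc T > 0" using p_gt_2 by (auto simp: lipc_def intro: add_pos_nonneg)

lemma tnl_lipschitz: 
  assumes "T \<ge> 0"
  shows "\<bar>tnl T a - tnl T b\<bar> \<le> lipc T * \<bar>a - b\<bar>"
proof -
  have c: "\<bar>clip T x\<bar> \<le> T" for x using assms by (auto simp: clip_def)
  have d: "\<bar>clip T a - clip T b\<bar> \<le> \<bar>a - b\<bar>" by (auto simp: clip_def)
  have "\<bar>nl (clip T a) - nl (clip T b)\<bar> \<le> (p - 1) * T powr (p - 2) * \<bar>clip T a - clip T b\<bar>"
    using abs_powr_mult_lipschitz[of "p - 2" "clip T a" T "clip T b"] c p_gt_2 by (simp add: nl_def)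
  then have "\<bar>tnl T a - tnl T b\<bar> \<le> lipc T * \<bar>clip T a - clip T b\<bar>"
    unfolding tnl_def lipc_def by (simp add: algebra_simps)
  also have "\<dots> \<le> lipc T * \<bar>a - b\<bar>" using lipc_pos[of T] d by (intro mult_left_mono) auto
  finally show ?thesis .
qed

lemma tsol_subset: "tsol T I u w \<Longrightarrow> J \<subseteq> I \<Longrightarrow> tsol T J u w"
  unfolding tsol_def by (meson subset_iff DERIV_subset)

lemma sol_subset: "sol I u w \<Longrightarrow> J \<subseteq> I \<Longrightarrow> sol J u w"
  unfolding sol_def by (meson subset_iff DERIV_subset)

lemma sol_imp_tsol: "sol I u w \<Longrightarrow> (\<And>x. x \<in> I \<Longrightarrow> \<bar>u x\<bar> \<le> T) \<Longrightarrow> tsol T I u w"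
  by (simp add: sol_def tsol_def tnl_id)

lemma tsol_imp_sol: "tsol T I u w \<Longrightarrow> (\<And>x. x \<in> I \<Longrightarrow> \<bar>u x\<bar> \<le> T) \<Longrightarrow> sol I u w"
  by (simp add: sol_def tsol_def tnl_id)

lemma tsol_dependence:
  assumes "tsol T I u w" "tsol T I v z" "T \<ge> 0" "{0..x} \<subseteq> I" "x \<ge> 0"
  shows "(u x - v x)\<^sup>2 + (w x - z x)\<^sup>2 \<le> exp ((1 + lipc T) * x) * ((u 0 - v 0)\<^sup>2 + (w 0 - z 0)\<^sup>2)"
  using tsol_subset[OF assms(1,4)] tsol_subset[OF assms(2,4)] assms(3,5) lipc_pos[of T]
  by (intro gronwall_second_order[where g = "tnl T" and b = x] tnl_lipschitz) (auto simp: tsol_def)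

lemma tsol_unique:
  assumes "tsol T I u w" "tsol T I v z" "T \<ge> 0" "{0..x} \<subseteq> I" "x \<ge> 0" "u 0 = v 0" "w 0 = z 0"
  shows "u x = v x" "w x = z x"
proof -
  have "(u x - v x)\<^sup>2 + (w x - z x)\<^sup>2 \<le> 0" using tsol_dependence[OF assms(1-5)] assms(6,7) by simp
  then show "u x = v x" "w x = z x" by (simp_all add: sum_power2_le_zero_iff)
qed

lemma tsol_exists:
  assumes "T \<ge> 0"
  obtains u w where "tsol T {0..} u w" "u 0 = a" "w 0 = b"
proof -
  define F where "F = (\<lambda>q::real\<times>real. (snd q, tnl T (fst q)))"
  have "norm (F a - F b) \<le> (1 + lipc T) * norm (a - b)" for a b :: "real \<times> real"
  proof -
    have "norm (F a - F b) \<le> \<bar>snd a - snd b\<bar> + \<bar>tnl T (fst a) - tnl T (fst b)\<bar>"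
      unfolding F_def norm_prod_def using sqrt_sum_squares_le_sum_abs by fastforce
    also have "\<dots> \<le> norm (a - b) + lipc T * norm (a - b)"
    proof (rule add_mono)
      show "\<bar>snd a - snd b\<bar> \<le> norm (a - b)" by (metis norm_snd_le snd_diff prod.collapse real_norm_def)
      have "\<bar>fst a - fst b\<bar> \<le> norm (a - b)" by (metis norm_fst_le fst_diff prod.collapse real_norm_def)
      then show "\<bar>tnl T (fst a) - tnl T (fst b)\<bar> \<le> lipc T * norm (a - b)"
        using tnl_lipschitz[OF assms, of "fst a" "fst b"] lipc_pos[of T]
        by (meson less_eq_real_def mult_left_mono order_trans)
    qed
    finally show ?thesis by (simp add: algebra_simps)
  qed
  moreover have "F 0 = 0" using assms by (simp add: F_def tnl_def clip_def zero_prod_def)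
  moreover have "1 + lipc T > 0" using lipc_pos[of T] by simp
  ultimately obtain y where y: "y 0 = (a, b)"
    "\<And>x. 0 \<le> x \<Longrightarrow> (y has_vector_derivative F (y x)) (at x within {0..})"
    using lipschitz_ode_global_solution[of "1 + lipc T" F "(a, b)"] by metis
  show thesis
  proof
    show "tsol T {0..} (fst \<circ> y) (snd \<circ> y)"
      unfolding tsol_def
    proof (intro ballI conjI)
      fix x :: real assume "x \<in> {0..}"
      then have *: "(y has_vector_derivative F (y x)) (at x within {0..})" using y(2) by simp
      show "(fst \<circ> y has_real_derivative (snd \<circ> y) x) (at x within {0..})"
        using bounded_linear.has_vector_derivative[OF bounded_linear_fst *]
        by (simp add: has_real_derivative_iff_has_vector_derivative F_def o_def)
      show "(snd \<circ> y has_real_derivative tnl T ((fst \<circ> y) x)) (at x within {0..})"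
        using bounded_linear.has_vector_derivative[OF bounded_linear_snd *]
        by (simp add: has_real_derivative_iff_has_vector_derivative F_def o_def)
    qed
  qed (use y in auto)
qed

lemma tsol_reflect:
  assumes "tsol T I u w" and "\<And>x. x \<in> J \<Longrightarrow> b - x \<in> I"
  shows "tsol T J (\<lambda>x. u (b - x)) (\<lambda>x. - w (b - x))"
  unfolding tsol_def
proof (intro ballI conjI)
  fix x assume x: "x \<in> J"
  have sub: "(\<lambda>x. b - x) ` J \<subseteq> I" using assms(2) by auto
  have u: "(u has_real_derivative w (b - x)) (at (b - x) within (\<lambda>x. b - x) ` J)"
    and w: "(w has_real_derivative tnl T (u (b - x))) (at (b - x) within (\<lambda>x. b - x) ` J)"
    using assms x DERIV_subset[OF _ sub] by (auto simp: tsol_def)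
  have d: "((\<lambda>x. b - x) has_real_derivative -1) (at x within J)"
    by (auto intro!: derivative_eq_intros)
  show "((\<lambda>x. u (b - x)) has_real_derivative - w (b - x)) (at x within J)"
    using DERIV_image_chain[OF u d] by (simp add: o_def)
  show "((\<lambda>x. - w (b - x)) has_real_derivative tnl T (u (b - x))) (at x within J)"
    using DERIV_minus[OF DERIV_image_chain[OF w d]] by (simp add: o_def)
qed

lemma tsol_shift:
  assumes "tsol T I u w" and "\<And>x. x \<in> J \<Longrightarrow> b + x \<in> I"
  shows "tsol T J (\<lambda>x. u (b + x)) (\<lambda>x. w (b + x))"
  unfolding tsol_def
proof (intro ballI conjI)
  fix x assume x: "x \<in> J"
  have sub: "(\<lambda>x. b + x) ` J \<subseteq> I" using assms(2) by auto
  have u: "(u has_real_derivative w (b + x)) (at (b + x) within (\<lambda>x. b + x) ` J)"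
    and w: "(w has_real_derivative tnl T (u (b + x))) (at (b + x) within (\<lambda>x. b + x) ` J)"
    using assms x DERIV_subset[OF _ sub] by (auto simp: tsol_def)
  have d: "((\<lambda>x. b + x) has_real_derivative 1) (at x within J)"
    by (auto intro!: derivative_eq_intros)
  show "((\<lambda>x. u (b + x)) has_real_derivative w (b + x)) (at x within J)"
    using DERIV_image_chain[OF u d] by (simp add: o_def)
  show "((\<lambda>x. w (b + x)) has_real_derivative tnl T (u (b + x))) (at x within J)"
    using DERIV_image_chain[OF w d] by (simp add: o_def)
qed

lemma sol_minus: "sol I u w \<Longrightarrow> sol I (\<lambda>x. - u x) (\<lambda>x. - w x)"
  unfolding sol_def by (auto intro!: derivative_eq_intros)

lemma sol_continuous:
  assumes "sol I u w" shows "continuous_on I u" "continuous_on I w"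
  using assms by (auto simp: sol_def intro!: DERIV_continuous_on)

lemma sol_energy:
  assumes s: "sol I u w" and "convex I" "x \<in> I" "y \<in> I"
  shows "(w x)\<^sup>2 / 2 - pot (u x) = (w y)\<^sup>2 / 2 - pot (u y)"
proof -
  have d: "((\<lambda>x. (w x)\<^sup>2 / 2 - pot (u x)) has_real_derivative 0) (at x within I)" if "x \<in> I" for x
  proof -
    have u: "(u has_real_derivative w x) (at x within I)"
      and w: "(w has_real_derivative u x - nl (u x)) (at x within I)"
      using s that by (auto simp: sol_def)
    show ?thesis
      using w DERIV_chain2[OF pot_derivative u] by (auto intro!: derivative_eq_intros)
  qed
  show ?thesis
    using has_field_derivative_zero_constant[OF assms(2) d] assms(3,4) by auto
qed

end

section \<open>Weak and classical bound states\<close>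

lemma ac_integration_by_parts:
  fixes f g F G :: "real \<Rightarrow> real"
  assumes f: "set_integrable lborel {0..b} f" and g: "set_integrable lborel {0..b} g"
    and F: "\<And>x. x \<in> {0..b} \<Longrightarrow> F x = F 0 + (LBINT t:{0..x}. f t)"
    and G: "\<And>x. x \<in> {0..b} \<Longrightarrow> G x = G 0 + (LBINT t:{0..x}. g t)"
    and b: "b \<ge> 0"
  shows "set_integrable lborel {0..b} (\<lambda>x. F x * g x)" "set_integrable lborel {0..b} (\<lambda>x. f x * G x)"
    "(LBINT x:{0..b}. F x * g x + f x * G x) = F b * G b - F 0 * G 0"
proof -
  define f' g' where "f' x = indicator {0..b} x * f x" and "g' x = indicator {0..b} x * g x" for x
  have int: "integrable lborel f'" "integrable lborel g'"
    using f g by (simp_all add: set_integrable_def f'_def[abs_def] g'_def[abs_def])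
  have [measurable]: "f' \<in> borel_measurable borel" "g' \<in> borel_measurable borel"
    using int by (simp_all add: borel_measurable_integrable)
  define Fh Gh where "Fh x = (LINT t|lborel. indicator {..x} t * f' t)"
    and "Gh x = (LINT t|lborel. indicator {..x} t * g' t)" for x
  have [measurable]: "Fh \<in> borel_measurable lborel" "Gh \<in> borel_measurable lborel"
  proof -
    have "Fh = (\<lambda>x. LINT t|lborel. (if t \<le> x then f' t else 0))" "Gh = (\<lambda>x. LINT t|lborel. (if t \<le> x then g' t else 0))"
      unfolding Fh_def Gh_def by (intro ext Bochner_Integration.integral_cong; simp add: indicator_def)+
    then show "Fh \<in> borel_measurable lborel" "Gh \<in> borel_measurable lborel" by simp_all
  qed
  have inti: "integrable lborel (\<lambda>t. indicator S t * f' t)" "integrable lborel (\<lambda>t. indicator S t * g' t)"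
    if "S \<in> sets borel" for S
    using that int by (auto intro: integrable_real_mult_indicator simp: mult.commute)
  have bd: "\<bar>Fh x\<bar> \<le> (LINT t|lborel. \<bar>f' t\<bar>)" "\<bar>Gh x\<bar> \<le> (LINT t|lborel. \<bar>g' t\<bar>)" for x
    unfolding Fh_def Gh_def
    by (rule order_trans[OF integral_abs_bound], rule integral_mono;
        use int inti[of "{..x}"] in \<open>auto simp: indicator_def\<close>)+
  have i1: "integrable lborel (\<lambda>x. Fh x * g' x)"
    by (rule Bochner_Integration.integrable_bound[of _ "\<lambda>x. (LINT t|lborel. \<bar>f' t\<bar>) * g' x"])
      (use int bd in \<open>auto simp: abs_mult intro!: mult_right_mono\<close>)
  have i2: "integrable lborel (\<lambda>x. f' x * Gh x)"
    by (rule Bochner_Integration.integrable_bound[of _ "\<lambda>x. f' x * (LINT t|lborel. \<bar>g' t\<bar>)"])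
      (use int bd in \<open>auto simp: abs_mult intro!: mult_left_mono\<close>)
  have Fe: "F x = F 0 + Fh x" if "x \<in> {0..b}" for x
  proof -
    have "(LBINT t:{0..x}. f t) = Fh x"
      unfolding Fh_def set_lebesgue_integral_def f'_def
      by (rule Bochner_Integration.integral_cong) (use that in \<open>auto simp: indicator_def\<close>)
    then show ?thesis using F[OF that] by simp
  qed
  have Ge: "G x = G 0 + Gh x" if "x \<in> {0..b}" for x
  proof -
    have "(LBINT t:{0..x}. g t) = Gh x"
      unfolding Gh_def set_lebesgue_integral_def g'_def
      by (rule Bochner_Integration.integral_cong) (use that in \<open>auto simp: indicator_def\<close>)
    then show ?thesis using G[OF that] by simp
  qed
  have e1: "indicator {0..b} x *\<^sub>R (F x * g x) = F 0 * g' x + Fh x * g' x" for x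
    using Fe[of x] by (auto simp: g'_def indicator_def algebra_simps)
  have e2: "indicator {0..b} x *\<^sub>R (f x * G x) = G 0 * f' x + f' x * Gh x" for x
    using Ge[of x] by (auto simp: f'_def indicator_def algebra_simps)
  show s1: "set_integrable lborel {0..b} (\<lambda>x. F x * g x)"
    unfolding set_integrable_def e1 using int i1 by simp
  show s2: "set_integrable lborel {0..b} (\<lambda>x. f x * G x)"
    unfolding set_integrable_def e2 using int i2 by simp
  have main: "(LINT x|lborel. Fh x * g' x) + (LINT x|lborel. f' x * Gh x)
     = (LINT x|lborel. f' x) * (LINT x|lborel. g' x)"
  proof -
    \<comment> \<open>Integrated over \<open>t\<close> first, \<open>h\<close> gives
      \<open>f' s * Gh s\<close>; integrated over \<open>s\<close> first, it gives
      \<open>g' t\<close> times the total integral of \<open>f'\<close> minus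
      \<open>Fh t\<close>.\<close>
    define h where "h s t = (if t < s then f' s * g' t else 0)" for s t :: real
    have h: "integrable (lborel \<Otimes>\<^sub>M lborel) (case_prod h)"
    proof (rule lborel_pair.Fubini_integrable)
      show "case_prod h \<in> borel_measurable (lborel \<Otimes>\<^sub>M lborel)"
        unfolding h_def by measurable
      show "AE s in lborel. integrable lborel (\<lambda>t. case_prod h (s, t))"
      proof (rule AE_I2)
        fix s
        have "integrable lborel (\<lambda>t. f' s * (indicator {..<s} t * g' t))"
          by (intro integrable_mult_right inti) auto
        then show "integrable lborel (\<lambda>t. case_prod h (s, t))"
          by (rule Bochner_Integration.integrable_cong[THEN iffD1, rotated -1])
            (auto simp: h_def indicator_def)
      qed
      show "integrable lborel (\<lambda>s. LINT t|lborel. norm (case_prod h (s, t)))"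
      proof (rule Bochner_Integration.integrable_bound[of _ "\<lambda>s. f' s * (LINT t|lborel. \<bar>g' t\<bar>)"])
        show "integrable lborel (\<lambda>s. f' s * (LINT t|lborel. \<bar>g' t\<bar>))" using int by simp
        show "(\<lambda>s. LINT t|lborel. norm (case_prod h (s, t))) \<in> borel_measurable lborel"
          unfolding h_def by measurable
        show "AE s in lborel. norm (LINT t|lborel. norm (case_prod h (s, t))) \<le> norm (f' s * (LINT t|lborel. \<bar>g' t\<bar>))"
        proof (rule AE_I2)
          fix s
          have "(LINT t|lborel. norm (case_prod h (s, t))) \<le> (LINT t|lborel. \<bar>f' s\<bar> * \<bar>g' t\<bar>)"
          proof (rule integral_mono')
            show "integrable lborel (\<lambda>t. \<bar>f' s\<bar> * \<bar>g' t\<bar>)" using int by simp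
          qed (auto simp: h_def abs_mult indicator_def)
          then show "norm (LINT t|lborel. norm (case_prod h (s, t))) \<le> norm (f' s * (LINT t|lborel. \<bar>g' t\<bar>))"
            by (simp add: abs_mult)
        qed
      qed
    qed
    have "(LINT s|lborel. f' s * Gh s) = (LINT s|lborel. LINT t|lborel. h s t)"
    proof (rule Bochner_Integration.integral_cong[OF refl])
      fix s
      have "f' s * Gh s = (LINT t|lborel. f' s * (indicator {..s} t * g' t))"
        by (simp add: Gh_def)
      also have "\<dots> = (LINT t|lborel. h s t)"
        by (rule integral_cong_AE) (use AE_lborel_singleton[of s] in \<open>auto simp: h_def indicator_def\<close>)
      finally show "f' s * Gh s = (LINT t|lborel. h s t)" .
    qed
    also have "\<dots> = (LINT t|lborel. LINT s|lborel. h s t)"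
      using lborel_pair.Fubini_integral[OF h] by simp
    also have "\<dots> = (LINT t|lborel. (LINT s|lborel. f' s) * g' t - Fh t * g' t)"
    proof (rule Bochner_Integration.integral_cong[OF refl])
      fix t
      have "(LINT s|lborel. h s t) = (LINT s|lborel. f' s * g' t - indicator {..t} s * f' s * g' t)"
        by (rule Bochner_Integration.integral_cong) (auto simp: h_def indicator_def)
      also have "\<dots> = (LINT s|lborel. f' s) * g' t - Fh t * g' t"
        using int inti[of "{..t}"] by (simp add: Fh_def)
      finally show "(LINT s|lborel. h s t) = (LINT s|lborel. f' s) * g' t - Fh t * g' t" .
    qed
    also have "\<dots> = (LINT s|lborel. f' s) * (LINT t|lborel. g' t) - (LINT t|lborel. Fh t * g' t)"
      using int i1 by simp
    finally show ?thesis by simp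
  qed
  have tot: "(LINT x|lborel. f' x) = F b - F 0" "(LINT x|lborel. g' x) = G b - G 0"
    using F[of b] G[of b] b by (simp_all add: set_lebesgue_integral_def f'_def g'_def)
  have "(LBINT x:{0..b}. F x * g x + f x * G x) = (LBINT x:{0..b}. F x * g x) + (LBINT x:{0..b}. f x * G x)"
    using s1 s2 by (rule set_integral_add)
  also have "(LBINT x:{0..b}. F x * g x) = F 0 * (G b - G 0) + (LINT x|lborel. Fh x * g' x)"
    unfolding set_lebesgue_integral_def e1 using int i1 tot by simp
  also have "(LBINT x:{0..b}. f x * G x) = G 0 * (F b - F 0) + (LINT x|lborel. f' x * Gh x)"
    unfolding set_lebesgue_integral_def e2 using int i2 tot by simp
  finally show "(LBINT x:{0..b}. F x * g x + f x * G x) = F b * G b - F 0 * G 0"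
    using main tot by (simp add: algebra_simps)
qed

section \<open>Sobolev functions on a single edge\<close>

definition edge_interval :: "real set \<Rightarrow> bool" where
  "edge_interval I \<longleftrightarrow> I = {0..} \<or> (\<exists>b>0. I = {0..b})"

lemma edge_interval_borel: "edge_interval I \<Longrightarrow> I \<in> sets borel"
  by (auto simp: edge_interval_def)

lemma edge_interval_down: "edge_interval I \<Longrightarrow> x \<in> I \<Longrightarrow> {0..x} \<subseteq> I \<and> 0 \<le> x \<and> 0 \<in> I"
  by (auto simp: edge_interval_def)

lemma edge_interval_convex: "edge_interval I \<Longrightarrow> convex I"
  by (auto simp: edge_interval_def)

text \<open>Continuity is local, and near \<open>x\<close> the half-line coincides with
  \<open>{0..x+1}\<close>, so compact initial segments suffice. \<open>deriv_edge_interval\<close>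
  rests on the same remark.\<close>

lemma continuous_on_edge_interval:
  assumes I: "edge_interval I" and c: "\<And>b. b \<in> I \<Longrightarrow> continuous_on {0..b} f"
  shows "continuous_on I f"
proof (cases "I = {0..}")
  case True
  show ?thesis
    unfolding continuous_on_eq_continuous_within
  proof
    fix x assume x: "x \<in> I"
    have "continuous (at x within {0..x+1}) f"
      using c[of "x + 1"] x True by (auto simp: continuous_on_eq_continuous_within)
    moreover have "at x within {0..x+1} = at x within {0..}"
      by (rule at_within_nhd[of _ "{..<x+1}"]) auto
    ultimately show "continuous (at x within I) f" using True by simp
  qed
next
  case False
  then show ?thesis using I c by (auto simp: edge_interval_def)
qed

lemma deriv_edge_interval:
  assumes I: "edge_interval I" and x: "x \<in> I"
    and c: "\<And>b. b \<in> I \<Longrightarrow> x \<le> b \<Longrightarrow> (f has_real_derivative d) (at x within {0..b})"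
  shows "(f has_real_derivative d) (at x within I)"
proof (cases "I = {0..}")
  case True
  have "(f has_real_derivative d) (at x within {0..x+1})" using c[of "x + 1"] x True by auto
  moreover have "at x within {0..x+1} = at x within {0..}"
    by (rule at_within_nhd[of _ "{..<x+1}"]) auto
  ultimately show ?thesis using True by simp
next
  case False
  then show ?thesis using I c x by (auto simp: edge_interval_def)
qed

lemma measurable_edge_interval:
  fixes f :: "real \<Rightarrow> real"
  assumes I: "edge_interval I" and c: "\<And>b. b \<in> I \<Longrightarrow> set_borel_measurable lborel {0..b} f"
  shows "set_borel_measurable lborel I f"
proof (cases "I = {0..}")
  case True
  have "(\<lambda>x. indicat_real I x *\<^sub>R f x) \<in> borel_measurable lborel"
  proof (rule borel_measurable_LIMSEQ_real)
    fix n :: nat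
    show "(\<lambda>x. indicat_real {0..real n} x *\<^sub>R f x) \<in> borel_measurable lborel"
      using c[of "real n"] True by (simp add: set_borel_measurable_def)
  next
    fix x :: real
    obtain N where "x \<le> real N" using real_arch_simple by blast
    then have "\<forall>\<^sub>F n in sequentially. indicat_real {0..real n} x *\<^sub>R f x = indicat_real I x *\<^sub>R f x"
      unfolding True by (intro eventually_sequentiallyI[of N]) (auto simp: indicator_def)
    then show "(\<lambda>n. indicat_real {0..real n} x *\<^sub>R f x) \<longlonglongrightarrow> indicat_real I x *\<^sub>R f x"
      by (rule tendsto_eventually)
  qed
  then show ?thesis by (simp add: set_borel_measurable_def)
next
  case False
  then show ?thesis using I c by (auto simp: edge_interval_def)
qed

lemma set_integrable_imp_measurable:
  "set_integrable lborel I f \<Longrightarrow> set_borel_measurable lborel I f"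
  by (auto simp: set_integrable_def set_borel_measurable_def)

lemma set_borel_measurable_times:
  fixes f g :: "real \<Rightarrow> real"
  assumes "set_borel_measurable lborel I f" "set_borel_measurable lborel I g"
  shows "set_borel_measurable lborel I (\<lambda>x. f x * g x)"
proof -
  have "(\<lambda>x. (indicator I x *\<^sub>R f x) * (indicator I x *\<^sub>R g x)) \<in> borel_measurable lborel"
    using assms unfolding set_borel_measurable_def by (rule borel_measurable_times)
  moreover have "(\<lambda>x. (indicator I x *\<^sub>R f x) * (indicator I x *\<^sub>R g x)) = (\<lambda>x. indicator I x *\<^sub>R (f x * g x))"
    by (auto simp: indicator_def)
  ultimately show ?thesis by (simp add: set_borel_measurable_def)
qed

lemma continuous_imp_set_measurable:
  fixes f :: "real \<Rightarrow> real"
  assumes "I \<in> sets borel" "continuous_on I f"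
  shows "set_borel_measurable lborel I f"
  using set_measurable_continuous_on[OF assms] by (simp add: set_borel_measurable_def)

lemma set_integrable_times_L2:
  fixes f g :: "real \<Rightarrow> real"
  assumes "set_borel_measurable lborel I f" "set_borel_measurable lborel I g"
    and "set_integrable lborel I (\<lambda>x. (f x)\<^sup>2)" "set_integrable lborel I (\<lambda>x. (g x)\<^sup>2)"
  shows "set_integrable lborel I (\<lambda>x. f x * g x)"
proof (rule set_integrable_bound)
  show "set_integrable lborel I (\<lambda>x. (f x)\<^sup>2 + (g x)\<^sup>2)" using assms by (intro set_integral_add) auto
  have "\<bar>a * b\<bar> \<le> a\<^sup>2 + b\<^sup>2" for a b :: real
    using sum_squares_bound[of "\<bar>a\<bar>" "\<bar>b\<bar>"] abs_ge_zero[of "a * b"] unfolding abs_mult power2_abs by linarith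
  then show "AE x in lborel. x \<in> I \<longrightarrow> norm (f x * g x) \<le> norm ((f x)\<^sup>2 + (g x)\<^sup>2)" by auto
qed (use assms set_borel_measurable_times in auto)

text \<open>Stands in for decay estimates at infinity: the boundary term of the integration by parts
  and the conserved energy are both integrable and convergent, hence have limit zero.\<close>

lemma integrable_tendsto_imp_0:
  fixes f :: "real \<Rightarrow> real"
  assumes "set_integrable lborel {0..} f" "(f \<longlongrightarrow> c) at_top"
  shows "c = 0"
proof (rule ccontr)
  assume "c \<noteq> 0"
  then have "\<forall>\<^sub>F x in at_top. dist (f x) c < \<bar>c\<bar> / 2" using assms(2) by (intro tendstoD) auto
  then obtain M where M: "\<And>x. x \<ge> M \<Longrightarrow> dist (f x) c < \<bar>c\<bar> / 2" by (auto simp: eventually_at_top_linorder)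
  define N where "N = max 0 M"
  have i: "set_integrable lborel {N..} (\<lambda>x. \<bar>f x\<bar>)"
    using assms(1) by (intro set_integrable_abs, rule set_integrable_subset) (auto simp: N_def)
  have "\<bar>c\<bar> / 2 * r \<le> (LBINT x:{N..}. \<bar>f x\<bar>)" if r: "r \<ge> 0" for r
  proof -
    have "\<bar>c\<bar> / 2 * r = (LBINT x:{N..N+r}. \<bar>c\<bar> / 2)" using r by (simp add: set_integral_const)
    also have "\<dots> \<le> (LBINT x:{N..N+r}. \<bar>f x\<bar>)"
    proof (rule set_integral_mono)
      show "set_integrable lborel {N..N+r} (\<lambda>x. \<bar>f x\<bar>)" by (rule set_integrable_subset[OF i]) auto
      show "\<bar>c\<bar> / 2 \<le> \<bar>f x\<bar>" if "x \<in> {N..N+r}" for x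
      proof -
        have "\<bar>f x - c\<bar> < \<bar>c\<bar> / 2" using M[of x] that by (simp add: N_def dist_real_def)
        then show ?thesis by arith
      qed
      show "set_integrable lborel {N..N+r} (\<lambda>x. \<bar>c\<bar> / 2)" by (rule borel_integrable_atLeastAtMost') auto
    qed
    also have "\<dots> \<le> (LBINT x:{N..}. \<bar>f x\<bar>)"
      unfolding set_lebesgue_integral_def
      by (rule integral_mono') (use i in \<open>auto simp: set_integrable_def indicator_def\<close>)
    finally show ?thesis .
  qed
  from this[of "((LBINT x:{N..}. \<bar>f x\<bar>) + 1) / (\<bar>c\<bar> / 2)"] this[of 0] \<open>c \<noteq> 0\<close>
  show False by (auto simp: field_simps)
qed

lemma H1_edgeD:
  assumes "H1_edge I u g"
  shows "x \<in> I \<Longrightarrow> set_integrable lborel {0..x} g" "x \<in> I \<Longrightarrow> u x = u 0 + (LBINT t:{0..x}. g t)"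
    "set_integrable lborel I (\<lambda>t. (u t)\<^sup>2)" "set_integrable lborel I (\<lambda>t. (g t)\<^sup>2)"
  using assms unfolding H1_edge_def by blast+

lemma H1_edge_continuous:
  assumes I: "edge_interval I" and u: "H1_edge I u g"
  shows "continuous_on I u"
proof (rule continuous_on_edge_interval[OF I])
  fix b assume b: "b \<in> I"
  then have sub: "{0..b} \<subseteq> I" using edge_interval_down[OF I] by auto
  have i: "set_integrable lborel {0..b} g" using u b by (simp add: H1_edge_def)
  have c: "continuous_on {0..b} (\<lambda>x. u 0 + integral {0..x} g)"
    by (intro continuous_intros indefinite_integral_continuous_1 set_borel_integral_eq_integral(1)[OF i])
  have eq: "u 0 + integral {0..x} g = u x" if "x \<in> {0..b}" for x
    using u that sub set_borel_integral_eq_integral(2)[of "{0..x}" g] by (auto simp: H1_edge_def)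
  show "continuous_on {0..b} u" by (rule continuous_on_eq[OF c eq])
qed

lemma H1_edge_measurable:
  assumes I: "edge_interval I" and u: "H1_edge I u g"
  shows "set_borel_measurable lborel I u" "set_borel_measurable lborel I g"
proof -
  show "set_borel_measurable lborel I u"
    by (rule continuous_imp_set_measurable[OF edge_interval_borel[OF I] H1_edge_continuous[OF assms]])
  show "set_borel_measurable lborel I g"
    by (rule measurable_edge_interval[OF I], rule set_integrable_imp_measurable) (use u in \<open>simp add: H1_edge_def\<close>)
qed

lemma H1_edge_integrable_times:
  assumes I: "edge_interval I" and u: "H1_edge I u g" and v: "H1_edge I v h"
  shows "set_integrable lborel I (\<lambda>x. g x * h x)" "set_integrable lborel I (\<lambda>x. u x * v x)"
    "set_integrable lborel I (\<lambda>x. u x * h x)"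
  using u v H1_edge_measurable[OF I u] H1_edge_measurable[OF I v]
  by (auto simp: H1_edge_def intro!: set_integrable_times_L2)

text \<open>The weak derivative \<open>2 * (u x * g x)\<close> of \<open>u\<^sup>2\<close> is
  integrable over the whole of \<open>I\<close>, which bounds \<open>u\<close> on half-lines as
  well.\<close>

lemma H1_edge_bounded:
  assumes I: "edge_interval I" and u: "H1_edge I u g"
  obtains C where "C \<ge> 0" "\<And>x. x \<in> I \<Longrightarrow> \<bar>u x\<bar> \<le> C"
proof -
  define Q where "Q = (LBINT x:I. \<bar>u x * g x\<bar>)"
  have ug: "set_integrable lborel I (\<lambda>x. \<bar>u x * g x\<bar>)"
    using H1_edge_integrable_times(3)[OF I u u] by (rule set_integrable_abs)
  have Q0: "Q \<ge> 0" unfolding Q_def set_lebesgue_integral_def by (intro Bochner_Integration.integral_nonneg) (auto simp: indicator_def)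
  have "(u x)\<^sup>2 \<le> (u 0)\<^sup>2 + 2 * Q" if x: "x \<in> I" for x
  proof -
    have sub: "{0..x} \<subseteq> I" "0 \<le> x" using edge_interval_down[OF I x] by auto
    have i: "set_integrable lborel {0..x} g" using u x by (simp add: H1_edge_def)
    have F: "u y = u 0 + (LBINT t:{0..y}. g t)" if "y \<in> {0..x}" for y using u sub that by (auto simp: H1_edge_def)
    note ibp = ac_integration_by_parts[OF i i F F sub(2)]
    have "(u x)\<^sup>2 - (u 0)\<^sup>2 = (LBINT y:{0..x}. u y * g y + g y * u y)"
      using ibp(3) by (simp add: power2_eq_square)
    also have "\<dots> \<le> (LBINT y:{0..x}. 2 * \<bar>u y * g y\<bar>)"
    proof (rule set_integral_mono)
      show "set_integrable lborel {0..x} (\<lambda>y. u y * g y + g y * u y)" using ibp by (intro set_integral_add)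
      show "set_integrable lborel {0..x} (\<lambda>y. 2 * \<bar>u y * g y\<bar>)"
        by (intro set_integrable_mult_right set_integrable_abs ibp)
    qed (simp add: mult.commute)
    also have "\<dots> = 2 * (LBINT y:{0..x}. \<bar>u y * g y\<bar>)" by simp
    also have "(LBINT y:{0..x}. \<bar>u y * g y\<bar>) \<le> Q"
      unfolding Q_def set_lebesgue_integral_def
      by (rule integral_mono') (use ug sub in \<open>auto simp: set_integrable_def indicator_def\<close>)
    finally show ?thesis by simp
  qed
  then have "\<bar>u x\<bar> \<le> sqrt ((u 0)\<^sup>2 + 2 * Q)" if "x \<in> I" for x
    using that by (simp add: real_le_rsqrt)
  then show thesis using that[of "sqrt ((u 0)\<^sup>2 + 2 * Q)"] Q0 by auto
qed

section \<open>Classical and weak solutions on one edge\<close>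

context nls
begin

text \<open>Since \<open>u\<close> is bounded, the nonlinearity is dominated by a constant multiple
  of \<open>u\<close>.\<close>

lemma H1_edge_integrable_nl:
  assumes I: "edge_interval I" and u: "H1_edge I u g" and v: "H1_edge I v h"
  shows "set_integrable lborel I (\<lambda>x. nl (u x) * v x)"
proof -
  obtain C where C: "C \<ge> 0" "\<And>x. x \<in> I \<Longrightarrow> \<bar>u x\<bar> \<le> C" using H1_edge_bounded[OF I u] by blast
  show ?thesis
  proof (rule set_integrable_bound)
    show "set_integrable lborel I (\<lambda>x. C powr (p - 2) * (u x * v x))"
      by (intro set_integrable_mult_right H1_edge_integrable_times[OF I u v])
    show "set_borel_measurable lborel I (\<lambda>x. nl (u x) * v x)"
    proof (rule set_borel_measurable_times[OF _ H1_edge_measurable(1)[OF I v]])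
      show "set_borel_measurable lborel I (\<lambda>x. nl (u x))"
        by (rule continuous_imp_set_measurable[OF edge_interval_borel[OF I]
              continuous_nl[OF H1_edge_continuous[OF I u]]])
    qed
    have "norm (nl (u x) * v x) \<le> norm (C powr (p - 2) * (u x * v x))" if "x \<in> I" for x
    proof -
      have "\<bar>u x\<bar> powr (p - 2) * \<bar>u x * v x\<bar> \<le> C powr (p - 2) * \<bar>u x * v x\<bar>"
        using C(2)[OF that] p_gt_2 by (intro mult_right_mono powr_mono2) auto
      then show ?thesis by (simp add: nl_def abs_mult mult.assoc)
    qed
    then show "AE x in lborel. x \<in> I \<longrightarrow> norm (nl (u x) * v x) \<le> norm (C powr (p - 2) * (u x * v x))" by simp
  qed
qed

lemma sol_integral_form:
  assumes I: "edge_interval I" and s: "sol I u w" and x: "x \<in> I"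
  shows "set_integrable lborel {0..x} w" "u x = u 0 + (LBINT t:{0..x}. w t)"
    "set_integrable lborel {0..x} (\<lambda>t. u t - nl (u t))"
    "w x = w 0 + (LBINT t:{0..x}. u t - nl (u t))"
proof -
  have sub: "{0..x} \<subseteq> I" "0 \<le> x" using edge_interval_down[OF I x] by auto
  have s': "sol {0..x} u w" using sol_subset[OF s sub(1)] .
  note c = sol_continuous[OF s']
  have c2: "continuous_on {0..x} (\<lambda>t. u t - nl (u t))" by (intro continuous_intros c)
  show "set_integrable lborel {0..x} w" using c(2) by (rule borel_integrable_atLeastAtMost')
  show "set_integrable lborel {0..x} (\<lambda>t. u t - nl (u t))" using c2 by (rule borel_integrable_atLeastAtMost')
  have "(LBINT t:{0..x}. w t) = u x - u 0" unfolding set_lebesgue_integral_def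
    by (rule integral_FTC_atLeastAtMost[OF sub(2) _ c(2)])
      (use s' in \<open>auto simp: sol_def has_real_derivative_iff_has_vector_derivative\<close>)
  then show "u x = u 0 + (LBINT t:{0..x}. w t)" by simp
  have "(LBINT t:{0..x}. u t - nl (u t)) = w x - w 0" unfolding set_lebesgue_integral_def
    by (rule integral_FTC_atLeastAtMost[OF sub(2) _ c2])
      (use s' in \<open>auto simp: sol_def has_real_derivative_iff_has_vector_derivative\<close>)
  then show "w x = w 0 + (LBINT t:{0..x}. u t - nl (u t))" by simp
qed

lemma sol_H1_edge:
  assumes "edge_interval I" "sol I u w"
    "set_integrable lborel I (\<lambda>t. (u t)\<^sup>2)" "set_integrable lborel I (\<lambda>t. (w t)\<^sup>2)"
  shows "H1_edge I u w"
  unfolding H1_edge_def using assms(3,4) sol_integral_form(1,2)[OF assms(1,2)] by blast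

lemma sol_weak_compact:
  assumes s: "sol {0..b} u w" and b: "b > 0" and \<eta>: "H1_edge {0..b} \<eta> d\<eta>"
  shows "(LBINT x:{0..b}. w x * d\<eta> x + u x * \<eta> x - nl (u x) * \<eta> x) = w b * \<eta> b - w 0 * \<eta> 0"
proof -
  have I: "edge_interval {0..b}" using b by (auto simp: edge_interval_def)
  have "b \<in> {0..b}" using b by simp
  note sf = sol_integral_form(3)[OF I s this] sol_integral_form(4)[OF I s]
  have e1: "set_integrable lborel {0..b} d\<eta>" by (rule H1_edgeD[OF \<eta>]) (use b in simp)
  have e2: "\<eta> x = \<eta> 0 + (LBINT t:{0..x}. d\<eta> t)" if "x \<in> {0..b}" for x
    by (rule H1_edgeD(2)[OF \<eta> that])
  have "(LBINT x:{0..b}. w x * d\<eta> x + (u x - nl (u x)) * \<eta> x) = w b * \<eta> b - w 0 * \<eta> 0"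
    using ac_integration_by_parts(3)[OF sf(1) e1 sf(2) e2] b by simp
  then show ?thesis by (simp add: left_diff_distrib algebra_simps)
qed

text \<open>The boundary term \<open>w b * \<eta> b\<close> converges as \<open>b\<close> grows,
  because all other terms of the formula on \<open>{0..b}\<close> do, and it is integrable in
  \<open>b\<close>; so it tends to zero.\<close>

lemma sol_weak_halfline:
  assumes s: "sol {0..} u w" and u: "H1_edge {0..} u w" and \<eta>: "H1_edge {0..} \<eta> d\<eta>"
  shows "(LBINT x:{0..}. w x * d\<eta> x + u x * \<eta> x - nl (u x) * \<eta> x) = - w 0 * \<eta> 0"
proof -
  let ?f = "\<lambda>x. w x * d\<eta> x + u x * \<eta> x - nl (u x) * \<eta> x"
  have I: "edge_interval {0..}" by (auto simp: edge_interval_def)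
  have int: "set_integrable lborel {0..} ?f"
    by (intro set_integral_add set_integral_diff H1_edge_integrable_times[OF I u \<eta>] H1_edge_integrable_nl[OF I u \<eta>])
  have "((\<lambda>b. (LBINT x:{0..b}. ?f x) + w 0 * \<eta> 0) \<longlongrightarrow> (LBINT x:{0..}. ?f x) + w 0 * \<eta> 0) at_top"
    by (intro tendsto_intros tendsto_set_lebesgue_integral_at_top int) auto
  then have lim: "((\<lambda>b. w b * \<eta> b) \<longlongrightarrow> (LBINT x:{0..}. ?f x) + w 0 * \<eta> 0) at_top"
  proof (rule Lim_transform_eventually)
    show "\<forall>\<^sub>F b in at_top. (LBINT x:{0..b}. ?f x) + w 0 * \<eta> 0 = w b * \<eta> b"
    proof (rule eventually_mono[OF eventually_gt_at_top[of 0]])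
      fix b :: real assume b: "b > 0"
      have "H1_edge {0..b} \<eta> d\<eta>"
        unfolding H1_edge_def
        by (intro conjI ballI H1_edgeD[OF \<eta>] set_integrable_subset[OF H1_edgeD(3)[OF \<eta>]]
            set_integrable_subset[OF H1_edgeD(4)[OF \<eta>]]) auto
      then show "(LBINT x:{0..b}. ?f x) + w 0 * \<eta> 0 = w b * \<eta> b"
        using sol_weak_compact[OF sol_subset[OF s] b, of \<eta> d\<eta>] by simp
    qed
  qed
  have "set_integrable lborel {0..} (\<lambda>x. w x * \<eta> x)"
    using H1_edge_integrable_times(3)[OF I \<eta> u] by (simp add: mult.commute)
  from integrable_tendsto_imp_0[OF this lim] show ?thesis by simp
qed

text \<open>The conserved energy is integrable on a half-line, hence zero.\<close>
lemma sol_halfline_energy: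
  assumes s: "sol {0..} u w" and u: "H1_edge {0..} u w" and x: "x \<ge> 0"
  shows "(w x)\<^sup>2 = 2 * pot (u x)"
proof -
  have I: "edge_interval {0..}" by (auto simp: edge_interval_def)
  let ?e = "\<lambda>x. (w x)\<^sup>2 / 2 - pot (u x)"
  have "?e = (\<lambda>x. 1/2 * (w x * w x) - (1/2 * (u x * u x) - 1/p * (nl (u x) * u x)))"
    by (simp add: pot_def nl_mult power2_eq_square fun_eq_iff)
  moreover have "set_integrable lborel {0..} \<dots>"
    by (intro set_integral_diff set_integrable_mult_right H1_edge_integrable_times[OF I u u] H1_edge_integrable_nl[OF I u u])
  ultimately have int: "set_integrable lborel {0..} ?e" by simp
  have "(?e \<longlongrightarrow> ?e x) at_top"
  proof (rule tendsto_eventually, rule eventually_mono[OF eventually_ge_at_top[of 0]])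
    fix y :: real assume "y \<ge> 0"
    then show "?e y = ?e x" using x by (intro sol_energy[OF s edge_interval_convex[OF I]]) auto
  qed
  from integrable_tendsto_imp_0[OF int this] show ?thesis by simp
qed

text \<open>The du Bois-Reymond argument. Test functions are primitives of mean-zero
  \<open>f\<close>. With \<open>h\<close> a primitive of \<open>u - nl u\<close> and
  \<open>m\<close> the mean of \<open>g - h\<close>, the choice \<open>f = g - h - m\<close> turns
  the weak equation into \<open>\<integral> f\<^sup>2 = 0\<close>, so \<open>g = h + m\<close>
  almost everywhere.\<close>

lemma weak_edge_imp_sol:
  assumes I: "edge_interval I" and u: "H1_edge I u g"
    and weak: "\<And>b f. b \<in> I \<Longrightarrow> b > 0 \<Longrightarrow> set_integrable lborel {0..b} f \<Longrightarrow>
        set_integrable lborel {0..b} (\<lambda>x. (f x)\<^sup>2) \<Longrightarrow> (LBINT x:{0..b}. f x) = 0 \<Longrightarrow>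
        (LBINT x:{0..b}. g x * f x + (u x - nl (u x)) * (LBINT t:{0..x}. f t)) = 0"
  obtains w where "sol I u w" "AE x in lborel. x \<in> I \<longrightarrow> g x = w x"
proof -
  define k where "k x = u x - nl (u x)" for x
  have contk: "continuous_on I k"
    unfolding k_def using H1_edge_continuous[OF I u] by (intro continuous_intros)
  have contk': "continuous_on {0..x} k" if "x \<in> I" for x
    using continuous_on_subset[OF contk] edge_interval_down[OF I that] by blast
  define h where "h x = (LBINT t:{0..x}. k t)" for x
  have intk: "set_integrable lborel {0..b} k" if "b \<in> I" for b
    using contk'[OF that] by (rule borel_integrable_atLeastAtMost')
  have h_eq: "h x = integral {0..x} k" if "x \<in> I" for x
    unfolding h_def by (rule set_borel_integral_eq_integral(2)[OF intk[OF that]])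
  have h_deriv_b: "(h has_real_derivative k x) (at x within {0..b})" if "b \<in> I" "x \<in> {0..b}" for b x
  proof -
    have sub: "{0..b} \<subseteq> I" using edge_interval_down[OF I that(1)] by blast
    have "((\<lambda>x. integral {0..x} k) has_vector_derivative k x) (at x within {0..b})"
      by (rule integral_has_vector_derivative[OF contk'[OF that(1)] that(2)])
    then have "(h has_vector_derivative k x) (at x within {0..b})"
      by (rule has_vector_derivative_transform[OF that(2), rotated]) (use sub h_eq in auto)
    then show ?thesis by (simp add: has_real_derivative_iff_has_vector_derivative)
  qed
  have conth: "continuous_on {0..b} h" if "b \<in> I" for b
    using h_deriv_b[OF that] by (rule DERIV_continuous_on)
  have const: "\<exists>m. AE x in lborel. x \<in> {0..b} \<longrightarrow> g x = h x + m" if b: "b \<in> I" "b > 0" for b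
  proof -
    have sub: "{0..b} \<subseteq> I" using edge_interval_down[OF I b(1)] by blast
    have ig: "set_integrable lborel {0..b} g" by (rule H1_edgeD(1)[OF u b(1)])
    have ig2: "set_integrable lborel {0..b} (\<lambda>x. (g x)\<^sup>2)"
      by (rule set_integrable_subset[OF H1_edgeD(4)[OF u]]) (use sub in auto)
    have ih: "set_integrable lborel {0..b} h" using conth[OF b(1)] by (rule borel_integrable_atLeastAtMost')
    have ih2: "set_integrable lborel {0..b} (\<lambda>x. (h x)\<^sup>2)"
      using conth[OF b(1)] by (intro borel_integrable_atLeastAtMost' continuous_intros)
    define m where "m = (LBINT x:{0..b}. g x - h x) / b"
    have im: "set_integrable lborel {0..b} (\<lambda>x. m)" "set_integrable lborel {0..b} (\<lambda>x. m * m)"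
      by (auto intro!: borel_integrable_atLeastAtMost')
    define f where "f x = g x - h x - m" for x
    have if1: "set_integrable lborel {0..b} f"
      unfolding f_def by (intro set_integral_diff ig ih im)
    have igh: "set_integrable lborel {0..b} (\<lambda>x. g x * h x)"
      by (rule set_integrable_times_L2[OF set_integrable_imp_measurable[OF ig] set_integrable_imp_measurable[OF ih] ig2 ih2])
    have "set_integrable lborel {0..b} (\<lambda>x. (g x)\<^sup>2 + (h x)\<^sup>2 + m * m - 2 * (g x * h x) - (2 * m) * g x + (2 * m) * h x)"
      by (intro set_integral_add set_integral_diff set_integrable_mult_right ig ih ig2 ih2 im igh)
    also have "(\<lambda>x. (g x)\<^sup>2 + (h x)\<^sup>2 + m * m - 2 * (g x * h x) - (2 * m) * g x + (2 * m) * h x) = (\<lambda>x. (f x)\<^sup>2)"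
      by (simp add: fun_eq_iff f_def power2_eq_square algebra_simps)
    finally have if2: "set_integrable lborel {0..b} (\<lambda>x. (f x)\<^sup>2)" .
    have f0: "(LBINT x:{0..b}. f x) = 0"
    proof -
      have "(LBINT x:{0..b}. f x) = (LBINT x:{0..b}. g x - h x) - (LBINT x:{0..b}. m)"
        unfolding f_def by (intro set_integral_diff ig ih im)
      also have "(LBINT x:{0..b}. m) = m * b" using b by (simp add: set_integral_const)
      finally show ?thesis using b by (simp add: m_def)
    qed
    define F where "F x = (LBINT t:{0..x}. f t)" for x
    have F0: "F 0 = 0" "F b = 0"
    proof -
      have "set_integrable lborel {0..0} f" by (rule set_integrable_subset[OF if1]) (use b in auto)
      then show "F 0 = 0" unfolding F_def by (subst set_borel_integral_eq_integral(2)) auto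
      show "F b = 0" using f0 by (simp add: F_def)
    qed
    have h0: "h 0 = 0" using h_eq[of 0] edge_interval_down[OF I b(1)] by simp
    have H: "h x = h 0 + (LBINT t:{0..x}. k t)" "F x = F 0 + (LBINT t:{0..x}. f t)" for x
      using h0 F0 by (simp_all add: h_def F_def)
    note ibp = ac_integration_by_parts[of b k f h F, OF intk[OF b(1)] if1 H less_imp_le[OF b(2)]]
    have "(LBINT x:{0..b}. g x * f x + k x * F x) = 0"
      using weak[OF b if1 if2 f0] by (simp add: k_def F_def)
    moreover have igf: "set_integrable lborel {0..b} (\<lambda>x. g x * f x)"
      by (rule set_integrable_times_L2[OF set_integrable_imp_measurable[OF ig] set_integrable_imp_measurable[OF if1] ig2 if2])
    ultimately have "(LBINT x:{0..b}. g x * f x) + (LBINT x:{0..b}. k x * F x) = 0"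
      using set_integral_add(2)[OF igf ibp(2)] by simp
    moreover have "(LBINT x:{0..b}. h x * f x) + (LBINT x:{0..b}. k x * F x) = 0"
      using ibp(3) set_integral_add(2)[OF ibp(1) ibp(2)] F0 by simp
    ultimately have e: "(LBINT x:{0..b}. g x * f x) = (LBINT x:{0..b}. h x * f x)" by simp
    have "(LBINT x:{0..b}. (f x)\<^sup>2) = (LBINT x:{0..b}. g x * f x - h x * f x - m * f x)"
      by (rule set_lebesgue_integral_cong) (auto simp: f_def power2_eq_square algebra_simps)
    also have "\<dots> = (LBINT x:{0..b}. g x * f x) - (LBINT x:{0..b}. h x * f x) - m * (LBINT x:{0..b}. f x)"
      using igf ibp(1) if1 by simp
    also have "\<dots> = 0" using e f0 by simp
    finally have "integral\<^sup>L lborel (\<lambda>x. indicator {0..b} x * (f x)\<^sup>2) = 0"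
      by (simp add: set_lebesgue_integral_def)
    then have "AE x in lborel. indicator {0..b} x * (f x)\<^sup>2 = 0"
      by (subst (asm) integral_nonneg_eq_0_iff_AE) (use if2 in \<open>auto simp: set_integrable_def\<close>)
    then have "AE x in lborel. x \<in> {0..b} \<longrightarrow> g x = h x + m"
      by eventually_elim (auto simp: f_def indicator_def)
    then show ?thesis by blast
  qed
  obtain b0 where b0: "b0 \<in> I" "b0 > 0"
  proof (cases "I = {0..}")
    case True
    then show thesis using that[of 1] by simp
  next
    case False
    then obtain b where "b > 0" "I = {0..b}" using I by (auto simp: edge_interval_def)
    then show thesis using that[of b] by simp
  qed
  obtain m where m: "AE x in lborel. x \<in> {0..b0} \<longrightarrow> g x = h x + m" using const[OF b0] by blast
  \<comment> \<open>The constant obtained on \<open>{0..b}\<close> could depend on \<open>b\<close>;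
    two such intervals overlap in a set of positive measure, so it does not.\<close>
  have all: "AE x in lborel. x \<in> {0..b} \<longrightarrow> g x = h x + m" if b: "b \<in> I" "b > 0" for b
  proof -
    obtain m' where m': "AE x in lborel. x \<in> {0..b} \<longrightarrow> g x = h x + m'" using const[OF b] by blast
    have "m = m'"
    proof (rule ccontr)
      assume ne: "m \<noteq> m'"
      from m m' have "AE x in lborel. x \<notin> {0..min b b0}"
        by eventually_elim (use ne in auto)
      then have "emeasure lborel {0..min b b0} = 0"
        by (subst (asm) AE_iff_measurable[of "{0..min b b0}"]) auto
      then show False using b b0 by (simp add: min_def split: if_splits)
    qed
    then show ?thesis using m' by simp
  qed
  define w where "w x = h x + m" for x
  have ae: "AE x in lborel. x \<in> I \<longrightarrow> g x = w x"
  proof (cases "I = {0..}")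
    case True
    have "AE x in lborel. \<forall>n::nat. x \<in> {0..real (Suc n)} \<longrightarrow> g x = h x + m"
      unfolding AE_all_countable using all True by auto
    then show ?thesis
    proof eventually_elim
      case (elim x)
      obtain n where "x \<le> real n" using real_arch_simple by blast
      then show ?case using elim[rule_format, of n] True by (auto simp: w_def)
    qed
  next
    case False
    then obtain b where "b > 0" "I = {0..b}" using I by (auto simp: edge_interval_def)
    then show ?thesis using all[of b] by (simp add: w_def)
  qed
  \<comment> \<open>\<open>u\<close> is already a primitive of \<open>g\<close>; replacing
    \<open>g\<close> by the continuous \<open>w\<close> makes it differentiable at every
    point.\<close>
  have u_eq: "u x = u 0 + integral {0..x} w" if x: "x \<in> I" for x
  proof -
    have "(LBINT t:{0..x}. g t) = (LBINT t:{0..x}. w t)"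
      unfolding set_lebesgue_integral_def
    proof (rule integral_cong_AE)
      show "(\<lambda>t. indicator {0..x} t *\<^sub>R g t) \<in> borel_measurable lborel"
        using set_integrable_imp_measurable[OF H1_edgeD(1)[OF u x]] by (simp add: set_borel_measurable_def)
      have "set_integrable lborel {0..x} w" unfolding w_def
        by (intro borel_integrable_atLeastAtMost' continuous_intros conth x)
      from set_integrable_imp_measurable[OF this]
      show "(\<lambda>t. indicator {0..x} t *\<^sub>R w t) \<in> borel_measurable lborel"
        by (simp add: set_borel_measurable_def)
      show "AE t in lborel. indicator {0..x} t *\<^sub>R g t = indicator {0..x} t *\<^sub>R w t"
        using ae by eventually_elim (use edge_interval_down[OF I x] in \<open>auto simp: indicator_def\<close>)
    qed
    also have "\<dots> = integral {0..x} w"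
      by (rule set_borel_integral_eq_integral(2))
        (auto simp: w_def intro!: borel_integrable_atLeastAtMost' continuous_intros conth x)
    finally show ?thesis using H1_edgeD(2)[OF u x] by simp
  qed
  have contw: "continuous_on {0..b} w" if "b \<in> I" for b
    unfolding w_def by (intro continuous_intros conth that)
  have "sol I u w"
    unfolding sol_def
  proof (intro ballI conjI; rule deriv_edge_interval[OF I])
    fix x b assume x: "x \<in> I" "b \<in> I" "x \<le> b"
    then have xb: "x \<in> {0..b}" and sub: "{0..b} \<subseteq> I" using edge_interval_down[OF I] by auto
    have "((\<lambda>x. u 0 + integral {0..x} w) has_vector_derivative w x) (at x within {0..b})"
      using integral_has_vector_derivative[OF contw[OF x(2)] xb] by (auto intro: derivative_eq_intros)
    then have "(u has_vector_derivative w x) (at x within {0..b})"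
      by (rule has_vector_derivative_transform[OF xb, rotated]) (rule u_eq, use sub in auto)
    then show "(u has_real_derivative w x) (at x within {0..b})"
      by (simp add: has_real_derivative_iff_has_vector_derivative)
    show "(w has_real_derivative u x - nl (u x)) (at x within {0..b})"
      using h_deriv_b[OF x(2) xb] unfolding w_def[abs_def] k_def by (auto intro!: derivative_eq_intros)
  qed
  then show thesis using that ae by blast
qed

end

section \<open>The graph: vertex conditions and equivalence of the two formulations\<close>

locale knot = nls p for p +
  fixes H P L :: nat and l :: real
  assumes H_pos: "H \<ge> 1" and l_pos: "l > 0"
begin

text \<open>The sum of the outgoing derivatives at the vertex. The end \<open>2 * l\<close> of a
  loop lies there too, and its outgoing derivative is \<open>- w (Loop i) (2 * l)\<close>.
  Kirchhoff's condition is \<open>flux w = 0\<close>.\<close>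

definition flux :: "(edge \<Rightarrow> real \<Rightarrow> real) \<Rightarrow> real" where
  "flux w = (\<Sum>i<H. w (Half i) 0) + (\<Sum>i<P. w (Pend i) 0) + (\<Sum>i<L. w (Loop i) 0 - w (Loop i) (2 * l))"

text \<open>The classical formulation. \<open>w\<close> is the continuous representative of the weak
  derivative and may differ on a null set from the \<open>du\<close> that accompanies
  \<open>u\<close> in \<open>bound_state\<close>.\<close>

definition strong :: "(edge \<Rightarrow> real \<Rightarrow> real) \<Rightarrow> (edge \<Rightarrow> real \<Rightarrow> real) \<Rightarrow> bool" where
  "strong u w \<longleftrightarrow> H1_graph H P L l u w \<and> (\<forall>e\<in>edges H P L. sol (edom l e) (u e) (w e)) \<and>
     (\<forall>i<P. w (Pend i) l = 0) \<and> flux w = 0"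

definition nontriv :: "(edge \<Rightarrow> real \<Rightarrow> real) \<Rightarrow> bool" where
  "nontriv u \<longleftrightarrow> (\<exists>e\<in>edges H P L. \<exists>x\<in>edom l e. u e x \<noteq> 0)"

definition mass :: "(edge \<Rightarrow> real \<Rightarrow> real) \<Rightarrow> real" where
  "mass u = graph_int H P L l (\<lambda>e x. \<bar>u e x\<bar> powr p)"

lemma edges_eq: "edges H P L = Half ` {..<H} \<union> Pend ` {..<P} \<union> Loop ` {..<L}"
  by (auto simp: edges_def)

lemma finite_edges: "finite (edges H P L)" by (simp add: edges_eq)

lemma mem_edges [simp]: "Half i \<in> edges H P L \<longleftrightarrow> i < H" "Pend i \<in> edges H P L \<longleftrightarrow> i < P"
  "Loop i \<in> edges H P L \<longleftrightarrow> i < L"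
  by (auto simp: edges_def)

lemma sum_edges:
  fixes f :: "edge \<Rightarrow> real"
  shows "(\<Sum>e\<in>edges H P L. f e) = (\<Sum>i<H. f (Half i)) + (\<Sum>i<P. f (Pend i)) + (\<Sum>i<L. f (Loop i))"
proof -
  have "(\<Sum>e\<in>edges H P L. f e) = sum f (Half ` {..<H}) + sum f (Pend ` {..<P}) + sum f (Loop ` {..<L})"
    unfolding edges_eq by (subst sum.union_disjoint; (subst sum.union_disjoint)?) auto
  then show ?thesis by (simp add: sum.reindex inj_on_def)
qed

lemma edge_interval_edom: "edge_interval (edom l e)"
  using l_pos by (cases e) (auto simp: edge_interval_def)

lemma H1_graphD:
  assumes "H1_graph H P L l u du"
  shows "e \<in> edges H P L \<Longrightarrow> H1_edge (edom l e) (u e) (du e)"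
    "e \<in> edges H P L \<Longrightarrow> u e 0 = u (Half 0) 0"
    "i < L \<Longrightarrow> u (Loop i) (2 * l) = u (Half 0) 0"
proof -
  show "e \<in> edges H P L \<Longrightarrow> H1_edge (edom l e) (u e) (du e)" 
    using assms unfolding H1_graph_def by blast
  have "Half 0 \<in> edges H P L" using H_pos by simp
  then show *: "u e 0 = u (Half 0) 0" if "e \<in> edges H P L" for e
    using assms that unfolding H1_graph_def by metis
  show "u (Loop i) (2 * l) = u (Half 0) 0" if "i < L"
    using assms *[of "Loop i"] that unfolding H1_graph_def by auto
qed

text \<open>The boundary terms of all edges are added and the common vertex value of
  \<open>\<eta>\<close> is factored out. Only the pendant ends and the flux remain, so the formula
  serves both directions: it proves the weak equation and lets the vertex conditions be read
  off.\<close>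

lemma green_formula:
  assumes u: "H1_graph H P L l u w" and s: "\<And>e. e \<in> edges H P L \<Longrightarrow> sol (edom l e) (u e) (w e)"
    and \<eta>: "H1_graph H P L l \<eta> d\<eta>"
  shows "graph_int H P L l (\<lambda>e x. w e x * d\<eta> e x + u e x * \<eta> e x - nl (u e x) * \<eta> e x)
    = (\<Sum>i<P. w (Pend i) l * \<eta> (Pend i) l) - \<eta> (Half 0) 0 * flux w"
proof -
  let ?f = "\<lambda>e x. w e x * d\<eta> e x + u e x * \<eta> e x - nl (u e x) * \<eta> e x"
  let ?c = "\<eta> (Half 0) 0"
  have c: "\<eta> e 0 = ?c" if "e \<in> edges H P L" for e using H1_graphD(2)[OF \<eta> that] .
  have "(LBINT x:edom l (Half i). ?f (Half i) x) = - w (Half i) 0 * ?c" if "i < H" for i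
    using sol_weak_halfline[of "u (Half i)" "w (Half i)" "\<eta> (Half i)" "d\<eta> (Half i)"]
      s[of "Half i"] H1_graphD(1)[OF u, of "Half i"] H1_graphD(1)[OF \<eta>, of "Half i"] c[of "Half i"] that by simp
  moreover have "(LBINT x:edom l (Pend i). ?f (Pend i) x) = w (Pend i) l * \<eta> (Pend i) l - w (Pend i) 0 * ?c" if "i < P" for i
    using sol_weak_compact[of l "u (Pend i)" "w (Pend i)" "\<eta> (Pend i)" "d\<eta> (Pend i)"] l_pos
      s[of "Pend i"] H1_graphD(1)[OF \<eta>, of "Pend i"] c[of "Pend i"] that by simp
  moreover have "(LBINT x:edom l (Loop i). ?f (Loop i) x) = - (w (Loop i) 0 - w (Loop i) (2 * l)) * ?c" if "i < L" for i
    using sol_weak_compact[of "2 * l" "u (Loop i)" "w (Loop i)" "\<eta> (Loop i)" "d\<eta> (Loop i)"] l_pos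
      s[of "Loop i"] H1_graphD(1)[OF \<eta>, of "Loop i"] c[of "Loop i"] H1_graphD(3)[OF \<eta>, of i] that
    by (simp add: algebra_simps)
  ultimately have "graph_int H P L l ?f = (\<Sum>i<H. - w (Half i) 0 * ?c)
      + (\<Sum>i<P. w (Pend i) l * \<eta> (Pend i) l - w (Pend i) 0 * ?c)
      + (\<Sum>i<L. - (w (Loop i) 0 - w (Loop i) (2 * l)) * ?c)"
    unfolding graph_int_def sum_edges by simp
  also have "\<dots> = (\<Sum>i<P. w (Pend i) l * \<eta> (Pend i) l) - ?c * flux w"
    unfolding flux_def sum_subtractf sum_distrib_right[symmetric] sum_negf by (simp add: algebra_simps)
  finally show ?thesis .
qed

lemma bound_state_alt: "bound_state H P L l p u du \<longleftrightarrow> H1_graph H P L l u du \<and> nontriv u \<and>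
  (\<forall>\<eta> d\<eta>. H1_graph H P L l \<eta> d\<eta> \<longrightarrow>
    graph_int H P L l (\<lambda>e x. du e x * d\<eta> e x + u e x * \<eta> e x - nl (u e x) * \<eta> e x) = 0)"
  by (simp add: bound_state_def nontriv_def nl_def)

lemma bound_state_weak:
  assumes "bound_state H P L l p u du" "H1_graph H P L l \<eta> d\<eta>"
  shows "graph_int H P L l (\<lambda>e x. du e x * d\<eta> e x + u e x * \<eta> e x - nl (u e x) * \<eta> e x) = 0"
  using assms by (simp add: bound_state_alt)

lemma strong_imp_bound_state:
  assumes "strong u w" "nontriv u"
  shows "bound_state H P L l p u w"
  using assms green_formula[of u w] by (simp add: bound_state_alt strong_def)

lemma graph_int_add:
  assumes "\<And>e. e \<in> edges H P L \<Longrightarrow> set_integrable lborel (edom l e) (f e)"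
    "\<And>e. e \<in> edges H P L \<Longrightarrow> set_integrable lborel (edom l e) (g e)"
  shows "graph_int H P L l (\<lambda>e x. f e x + g e x) = graph_int H P L l f + graph_int H P L l g"
    "graph_int H P L l (\<lambda>e x. f e x - g e x) = graph_int H P L l f - graph_int H P L l g"
  using assms by (simp_all add: graph_int_def set_integral_add set_integral_diff sum.distrib sum_subtractf)

text \<open>The Nehari identity: test the equation with u itself.\<close>
lemma bound_state_nehari:
  assumes "bound_state H P L l p u du"
  shows "graph_int H P L l (\<lambda>e x. (du e x)\<^sup>2 + (u e x)\<^sup>2) = mass u"
    "action H P L l p u du = (1/2 - 1/p) * mass u"
proof -
  have u: "H1_graph H P L l u du" using assms by (simp add: bound_state_def)
  have "graph_int H P L l (\<lambda>e x. (du e x * du e x + u e x * u e x) - nl (u e x) * u e x) = 0"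
    using assms u by (simp add: bound_state_alt)
  also have "graph_int H P L l (\<lambda>e x. (du e x * du e x + u e x * u e x) - nl (u e x) * u e x)
     = graph_int H P L l (\<lambda>e x. du e x * du e x + u e x * u e x) - graph_int H P L l (\<lambda>e x. nl (u e x) * u e x)"
    using H1_edge_integrable_times[OF edge_interval_edom H1_graphD(1)[OF u] H1_graphD(1)[OF u]]
      H1_edge_integrable_nl[OF edge_interval_edom H1_graphD(1)[OF u] H1_graphD(1)[OF u]]
    by (intro graph_int_add set_integral_add) auto
  finally show 1: "graph_int H P L l (\<lambda>e x. (du e x)\<^sup>2 + (u e x)\<^sup>2) = mass u"
    by (simp add: mass_def nl_mult power2_eq_square)
  show "action H P L l p u du = (1/2 - 1/p) * mass u"
    unfolding action_def 1 by (simp add: mass_def algebra_simps)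
qed

text \<open>Test functions living on one edge. Mean zero makes the primitive vanish from
  \<open>b\<close> on, so its extension by zero to the other edges is continuous at the vertex, also
  at the far end of a loop.\<close>

lemma test_single_edge:
  assumes e: "e \<in> edges H P L" and b: "b \<in> edom l e" "b > 0"
    and f: "set_integrable lborel {0..b} f" "set_integrable lborel {0..b} (\<lambda>x. (f x)\<^sup>2)" "(LBINT x:{0..b}. f x) = 0"
  defines "f' \<equiv> \<lambda>x. indicator {0..b} x * f x"
  shows "H1_graph H P L l (\<lambda>e' x. if e' = e then (LBINT t:{0..x}. f' t) else 0) (\<lambda>e' x. if e' = e then f' x else 0)"
    "x \<in> {0..b} \<Longrightarrow> (LBINT t:{0..x}. f' t) = (LBINT t:{0..x}. f t)"
    "x \<ge> b \<Longrightarrow> (LBINT t:{0..x}. f' t) = 0"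
proof -
  let ?F = "\<lambda>x. LBINT t:{0..x}. f' t"
  have I: "edge_interval {0..b}" using b by (auto simp: edge_interval_def)
  show eq1: "?F x = (LBINT t:{0..x}. f t)" if "x \<in> {0..b}" for x
    unfolding f'_def set_lebesgue_integral_def
    by (rule Bochner_Integration.integral_cong) (use that in \<open>auto simp: indicator_def\<close>)
  show eq2: "?F x = 0" if "x \<ge> b" for x
  proof -
    have "?F x = (LBINT t:{0..b}. f t)"
      unfolding f'_def set_lebesgue_integral_def
      by (rule Bochner_Integration.integral_cong) (use that in \<open>auto simp: indicator_def\<close>)
    then show ?thesis using f(3) by simp
  qed
  have if': "integrable lborel f'" "integrable lborel (\<lambda>x. (f' x)\<^sup>2)"
  proof -
    show "integrable lborel f'" using f(1) by (simp add: set_integrable_def f'_def[abs_def])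
    have "(\<lambda>x. (f' x)\<^sup>2) = (\<lambda>x. indicator {0..b} x *\<^sub>R (f x)\<^sup>2)" by (auto simp: f'_def indicator_def)
    then show "integrable lborel (\<lambda>x. (f' x)\<^sup>2)" using f(2) by (simp add: set_integrable_def)
  qed
  have set_int: "set_integrable lborel S f'" "set_integrable lborel S (\<lambda>x. (f' x)\<^sup>2)" if "S \<in> sets borel" for S
    using if' that unfolding set_integrable_def by (intro integrable_mult_indicator; simp)+
  have F0: "?F 0 = 0"
  proof -
    have "set_integrable lborel {0..0} f'" by (rule set_int) simp
    then show ?thesis by (subst set_borel_integral_eq_integral(2)) auto
  qed
  have contF: "continuous_on {0..b} ?F"
  proof -
    have "f' integrable_on {0..b}" using set_int[of "{0..b}"] by (intro set_borel_integral_eq_integral) auto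
    then have c: "continuous_on {0..b} (\<lambda>x. integral {0..x} f')" by (rule indefinite_integral_continuous_1)
    have eq: "integral {0..x} f' = ?F x" for x
      by (rule set_borel_integral_eq_integral(2)[symmetric]) (auto intro: set_int)
    show ?thesis by (rule continuous_on_eq[OF c eq])
  qed
  have F2: "set_integrable lborel S (\<lambda>x. (?F x)\<^sup>2)" if "S \<in> sets borel" "S \<subseteq> {0..}" for S
  proof -
    have "set_integrable lborel {0..b} (\<lambda>x. (?F x)\<^sup>2)"
      by (intro borel_integrable_atLeastAtMost' continuous_intros contF)
    moreover have "(\<lambda>x. indicator {0..b} x *\<^sub>R (?F x)\<^sup>2) = (\<lambda>x. indicator {0..} x *\<^sub>R (?F x)\<^sup>2)"
      using eq2 by (auto simp: indicator_def fun_eq_iff)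
    ultimately have "set_integrable lborel {0..} (\<lambda>x. (?F x)\<^sup>2)" by (simp add: set_integrable_def)
    then show ?thesis by (rule set_integrable_subset) (use that in simp_all)
  qed
  have "H1_edge (edom l e) ?F f'"
    unfolding H1_edge_def
  proof (intro conjI ballI)
    have "edom l e \<in> sets borel" "edom l e \<subseteq> {0..}"
      using edge_interval_borel[OF edge_interval_edom] edge_interval_down[OF edge_interval_edom] by auto
    then show "set_integrable lborel (edom l e) (\<lambda>t. (?F t)\<^sup>2)" "set_integrable lborel (edom l e) (\<lambda>t. (f' t)\<^sup>2)"
      by (auto intro: F2 set_int)
    fix x
    show "set_integrable lborel {0..x} f'" by (rule set_int) simp
    show "?F x = ?F 0 + ?F x" using F0 by simp
  qed
  then show "H1_graph H P L l (\<lambda>e' x. if e' = e then ?F x else 0) (\<lambda>e' x. if e' = e then f' x else 0)"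
    unfolding H1_graph_def
  proof (intro conjI ballI allI impI exI[of _ 0])
    fix e'
    have "H1_edge I (\<lambda>x. 0) (\<lambda>x. 0)" for I
      by (simp add: H1_edge_def set_integrable_def)
    then show "H1_edge (edom l e') (\<lambda>x. if e' = e then ?F x else 0) (\<lambda>x. if e' = e then f' x else 0)"
      if "H1_edge (edom l e) ?F f'" using that by (cases "e' = e") simp_all
    show "(if e' = e then ?F 0 else 0) = 0" using F0 by simp
  next
    fix i assume "i < L"
    have "?F (2 * l) = 0" if "Loop i = e" using eq2[of "2 * l"] that b by auto
    then show "(if Loop i = e then ?F (2 * l) else 0) = (if Loop i = e then ?F 0 else 0)"
      using F0 by simp
  qed
qed

text \<open>The du Bois-Reymond argument on every edge gives the equation. What is left of the weak
  formulation are the boundary terms of \<open>green_formula\<close>, and these are tested with one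
  explicit function for each vertex condition.\<close>

lemma bound_state_imp_strong:
  assumes bs: "bound_state H P L l p u du"
  obtains w where "strong u w"
proof -
  have u: "H1_graph H P L l u du" using bs by (simp add: bound_state_def)
  have "\<exists>w. sol (edom l e) (u e) w \<and> (AE x in lborel. x \<in> edom l e \<longrightarrow> du e x = w x)" if e: "e \<in> edges H P L" for e
  proof -
    have weak: "(LBINT x:{0..b}. du e x * f x + (u e x - nl (u e x)) * (LBINT t:{0..x}. f t)) = 0"
      if b: "b \<in> edom l e" "b > 0" and f: "set_integrable lborel {0..b} f" "set_integrable lborel {0..b} (\<lambda>x. (f x)\<^sup>2)"
        "(LBINT x:{0..b}. f x) = 0" for b f
    proof -
      define f' where "f' = (\<lambda>x. indicator {0..b} x * f x)"
      define F where "F x = (LBINT t:{0..x}. f' t)" for x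
      define G where "G x = (LBINT t:{0..x}. f t)" for x
      have t: "H1_graph H P L l (\<lambda>e' x. if e' = e then F x else 0) (\<lambda>e' x. if e' = e then f' x else 0)"
        "\<And>x. x \<in> {0..b} \<Longrightarrow> F x = G x" "\<And>x. x \<ge> b \<Longrightarrow> F x = 0"
        unfolding F_def f'_def G_def
          by (rule test_single_edge(1)[OF e b f], erule test_single_edge(2)[OF e b f], erule test_single_edge(3)[OF e b f])
      let ?g = "\<lambda>x. du e x * f' x + u e x * F x - nl (u e x) * F x"
      have "graph_int H P L l (\<lambda>e' x. du e' x * (if e' = e then f' x else 0)
          + u e' x * (if e' = e then F x else 0) - nl (u e' x) * (if e' = e then F x else 0)) = 0"
        by (rule bound_state_weak[OF bs t(1)])
      also have "(\<lambda>e' x. du e' x * (if e' = e then f' x else 0)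
          + u e' x * (if e' = e then F x else 0) - nl (u e' x) * (if e' = e then F x else 0))
          = (\<lambda>e' x. if e' = e then ?g x else 0)" by (auto simp: fun_eq_iff)
      also have "graph_int H P L l (\<lambda>e' x. if e' = e then ?g x else 0)
          = (\<Sum>e'\<in>edges H P L. if e' = e then (LBINT x:edom l e. ?g x) else 0)"
        unfolding graph_int_def by (rule sum.cong) simp_all
      also have "\<dots> = (LBINT x:edom l e. ?g x)" using finite_edges e by simp
      finally have "(LBINT x:edom l e. ?g x) = 0" .
      moreover have "(LBINT x:edom l e. ?g x) = (LBINT x:{0..b}. du e x * f x + (u e x - nl (u e x)) * G x)"
        unfolding set_lebesgue_integral_def
      proof (rule Bochner_Integration.integral_cong[OF refl])
        fix x
        have sub: "{0..b} \<subseteq> edom l e" "edom l e \<subseteq> {0..}" 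
          using edge_interval_down[OF edge_interval_edom] b by auto
        consider "x \<in> {0..b}" | "x \<notin> {0..b}" "x \<in> edom l e" | "x \<notin> {0..b}" "x \<notin> edom l e" by blast
        then show "indicator (edom l e) x *\<^sub>R ?g x =
            indicator {0..b} x *\<^sub>R (du e x * f x + (u e x - nl (u e x)) * G x)"
        proof cases
          case 1
          then show ?thesis using sub t(2)[of x] by (auto simp: f'_def algebra_simps)
        next
          case 2
          then have "F x = 0" using t(3)[of x] sub by auto
          then show ?thesis using 2 by (simp add: f'_def)
        qed simp
      qed
      ultimately show ?thesis by (simp only: G_def)
    qed
    show ?thesis
      by (rule weak_edge_imp_sol[OF edge_interval_edom H1_graphD(1)[OF u e] weak]) blast+
  qed
  then obtain w where w: "\<And>e. e \<in> edges H P L \<Longrightarrow> sol (edom l e) (u e) (w e)"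
    "\<And>e. e \<in> edges H P L \<Longrightarrow> AE x in lborel. x \<in> edom l e \<longrightarrow> du e x = w e x" by metis
  have "H1_edge (edom l e) (u e) (w e)" if e: "e \<in> edges H P L" for e
  proof (rule sol_H1_edge[OF edge_interval_edom w(1)[OF e] H1_edgeD(3)[OF H1_graphD(1)[OF u e]]])
    have "set_borel_measurable lborel (edom l e) (w e)"
      by (rule continuous_imp_set_measurable[OF edge_interval_borel[OF edge_interval_edom] sol_continuous(2)[OF w(1)[OF e]]])
    then have "set_borel_measurable lborel (edom l e) (\<lambda>x. (w e x)\<^sup>2)"
      unfolding power2_eq_square by (intro set_borel_measurable_times)
    then show "set_integrable lborel (edom l e) (\<lambda>x. (w e x)\<^sup>2)"
      by (rule set_integrable_bound[OF H1_edgeD(4)[OF H1_graphD(1)[OF u e]]])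
        (use w(2)[OF e] in eventually_elim, simp)
  qed
  then have uw: "H1_graph H P L l u w" using u unfolding H1_graph_def by blast
  have weak: "(\<Sum>i<P. w (Pend i) l * \<eta> (Pend i) l) - \<eta> (Half 0) 0 * flux w = 0" if \<eta>: "H1_graph H P L l \<eta> d\<eta>" for \<eta> d\<eta>
  proof -
    have "graph_int H P L l (\<lambda>e x. du e x * d\<eta> e x + u e x * \<eta> e x - nl (u e x) * \<eta> e x) = 0"
      using bs \<eta> by (simp add: bound_state_alt)
    also have "graph_int H P L l (\<lambda>e x. du e x * d\<eta> e x + u e x * \<eta> e x - nl (u e x) * \<eta> e x) =
       graph_int H P L l (\<lambda>e x. w e x * d\<eta> e x + u e x * \<eta> e x - nl (u e x) * \<eta> e x)"
      unfolding graph_int_def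
    proof (rule sum.cong[OF refl])
      fix e assume e: "e \<in> edges H P L"
      note h = H1_graphD(1)[OF u e] H1_graphD(1)[OF uw e] H1_graphD(1)[OF \<eta> e]
      have m: "set_borel_measurable lborel (edom l e) (\<lambda>x. v x * d\<eta> e x + u e x * \<eta> e x - nl (u e x) * \<eta> e x)"
        if "H1_edge (edom l e) (u e) v" for v
        by (rule set_integrable_imp_measurable)
          (intro set_integral_add set_integral_diff H1_edge_integrable_times[OF edge_interval_edom that h(3)]
            H1_edge_integrable_nl[OF edge_interval_edom that h(3)])
      show "(LBINT x:edom l e. du e x * d\<eta> e x + u e x * \<eta> e x - nl (u e x) * \<eta> e x)
        = (LBINT x:edom l e. w e x * d\<eta> e x + u e x * \<eta> e x - nl (u e x) * \<eta> e x)"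
        unfolding set_lebesgue_integral_def
        by (rule integral_cong_AE[OF m[OF h(1), unfolded set_borel_measurable_def] m[OF h(2), unfolded set_borel_measurable_def]])
          (use w(2)[OF e] in eventually_elim, auto simp: indicator_def)
    qed
    also have "\<dots> = (\<Sum>i<P. w (Pend i) l * \<eta> (Pend i) l) - \<eta> (Half 0) 0 * flux w"
      by (rule green_formula[OF uw w(1) \<eta>])
    finally show ?thesis by simp
  qed
  have lin: "H1_edge {0..b} (\<lambda>x. c + d * x) (\<lambda>x. d)" if "b \<ge> 0" for b c d :: real
    unfolding H1_edge_def
    by (auto intro!: borel_integrable_atLeastAtMost' continuous_intros simp: set_integral_const)
  have neumann: "w (Pend i) l = 0" if i: "i < P" for i
  proof -
    \<comment> \<open>Supported on one pendant and zero at the vertex, this function isolates the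
      end slope \<open>w (Pend i) l\<close>.\<close>
    have "H1_graph H P L l (\<lambda>e x. if e = Pend i then x else 0) (\<lambda>e x. if e = Pend i then 1 else 0)"
      unfolding H1_graph_def using lin[of l 0 1] l_pos
      by (auto simp: H1_edge_def set_integrable_def)
    from weak[OF this] have "(\<Sum>j<P. if j = i then w (Pend j) l * l else 0) = 0"
      by (simp add: if_distrib[of "\<lambda>y. _ * y"] cong: if_cong)
    then show ?thesis using i l_pos by simp
  qed
  have "flux w = 0"
  proof -
    \<comment> \<open>A test function with value 1 at the vertex has to be cut off on the
      half-lines, where constants are not square integrable.\<close>
    have tent: "H1_edge {0..} (\<lambda>x. max 0 (1 - x)) (\<lambda>x. - indicator {0..1} x)"
    proof -
      have "integrable lborel (\<lambda>x::real. indicator {0..1::real} x :: real)"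
        by (rule integrable_real_indicator) simp_all
      then have i0: "integrable lborel (\<lambda>x::real. - indicator {0..1::real} x :: real)" by simp
      have i: "set_integrable lborel S (\<lambda>x::real. - indicator {0..1} x :: real)" if "S \<in> sets borel" for S
        unfolding set_integrable_def by (rule integrable_mult_indicator) (use that i0 in simp_all)
      have "(LBINT t:{0..x}. - indicator {0..1} t) = max 0 (1 - x) - 1" if "x \<ge> 0" for x :: real
      proof -
        have "(LBINT t:{0..x}. - indicator {0..1} t) = (LBINT t:{0..min x 1}. - 1 :: real)"
          unfolding set_lebesgue_integral_def by (rule Bochner_Integration.integral_cong) (auto simp: indicator_def)
        then show ?thesis using that by (simp add: set_integral_const)
      qed
      moreover have "set_integrable lborel {0..} (\<lambda>x::real. (max 0 (1 - x))\<^sup>2)"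
      proof -
        have "set_integrable lborel {0..1} (\<lambda>x::real. (max 0 (1 - x))\<^sup>2)"
          by (intro borel_integrable_atLeastAtMost' continuous_intros)
        moreover have "(\<lambda>x::real. indicator {0..1} x *\<^sub>R (max 0 (1 - x))\<^sup>2) = (\<lambda>x. indicator {0..} x *\<^sub>R (max 0 (1 - x))\<^sup>2)"
          by (auto simp: indicator_def fun_eq_iff)
        ultimately show ?thesis by (simp add: set_integrable_def)
      qed
      moreover have "set_integrable lborel {0..} (\<lambda>x::real. (- indicator {0..1} x)\<^sup>2 :: real)"
      proof -
        have "(\<lambda>x::real. (- indicator {0..1} x)\<^sup>2 :: real) = (\<lambda>x. - (- indicator {0..1} x))" by (auto simp: indicator_def)
        then show ?thesis
          using i0 unfolding set_integrable_def by (intro integrable_mult_indicator) simp_all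
      qed
      ultimately show ?thesis unfolding H1_edge_def using i by auto
    qed
    have "H1_graph H P L l (\<lambda>e x. case e of Half i \<Rightarrow> max 0 (1 - x) | _ \<Rightarrow> 1)
       (\<lambda>e x. case e of Half i \<Rightarrow> - indicator {0..1} x | _ \<Rightarrow> 0)"
      unfolding H1_graph_def using lin[of l 1 0] lin[of "2 * l" 1 0] tent l_pos
      by (auto split: edge.split simp: edges_def)
    from weak[OF this] show ?thesis using neumann by simp
  qed
  then show thesis using that uw w(1) neumann unfolding strong_def by blast
qed

end

section \<open>The soliton\<close>

context nls
begin

text \<open>The positive zero of \<open>pot\<close>, hence the height at which a zero-energy
  solution comes to rest.\<close>

definition amp :: real where "amp = (p / 2) powr (1 / (p - 2))"
text \<open>The homoclinic solution of \<open>u'' = u - nl u\<close> in closed form, centred at its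
  maximum.\<close>

definition soliton :: "real \<Rightarrow> real" where
  "soliton x = amp * cosh ((p - 2) / 2 * x) powr (- (2 / (p - 2)))"
definition dsoliton :: "real \<Rightarrow> real" where
  "dsoliton x = - soliton x * tanh ((p - 2) / 2 * x)"

lemma amp_gt_1: "amp > 1"
  unfolding amp_def using p_gt_2 by (intro gr_one_powr) auto

lemma amp_powr: "amp powr (p - 2) = p / 2"
  using p_gt_2 by (simp add: amp_def powr_powr)

lemma soliton_pos: "soliton x > 0"
  using amp_gt_1 cosh_real_pos[of "(p - 2) / 2 * x"] by (simp add: soliton_def less_imp_neq[symmetric])

lemma soliton_0 [simp]: "soliton 0 = amp" "dsoliton 0 = 0"
  by (simp_all add: soliton_def dsoliton_def)

lemma soliton_minus [simp]: "soliton (- x) = soliton x" "dsoliton (- x) = - dsoliton x"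
  by (simp_all add: soliton_def dsoliton_def)

lemma soliton_powr: "soliton x powr (p - 2) = p / 2 * (1 - (tanh ((p - 2) / 2 * x))\<^sup>2)"
proof -
  let ?c = "cosh ((p - 2) / 2 * x)"
  have c: "?c > 0" by (rule cosh_real_pos)
  have "soliton x powr (p - 2) = p / 2 * ?c powr (- 2)"
  proof -
    have "- (2 / (p - 2)) * (p - 2) = - 2" using p_gt_2 by (simp add: field_simps)
    then show ?thesis using c amp_gt_1 unfolding soliton_def by (simp only: powr_mult powr_powr amp_powr)
  qed
  also have "?c powr (- 2) = 1 / ?c\<^sup>2" using c by (simp add: powr_minus divide_simps)
  also have "1 / ?c\<^sup>2 = 1 - (tanh ((p - 2) / 2 * x))\<^sup>2"
  proof -
    have "(tanh ((p - 2) / 2 * x))\<^sup>2 = (?c\<^sup>2 - 1) / ?c\<^sup>2"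
      unfolding tanh_def power_divide using cosh_square_eq[of "(p - 2) / 2 * x"] by simp
    then show ?thesis using c by (simp add: diff_divide_distrib)
  qed
  finally show ?thesis .
qed

lemma soliton_deriv: "(soliton has_real_derivative dsoliton x) (at x)"
proof -
  let ?q = "(p - 2) / 2" and ?r = "- (2 / (p - 2))"
  have c: "cosh (?q * x) > 0" by (rule cosh_real_pos)
  have d: "(soliton has_real_derivative amp * (?r * cosh (?q * x) powr (?r - 1) * (sinh (?q * x) * ?q))) (at x)"
  proof -
    have "((\<lambda>x. amp * cosh (q * x) powr r) has_real_derivative
        amp * (r * cosh (q * x) powr (r - 1) * (sinh (q * x) * q))) (at x)" for q r
      using cosh_real_pos[of "q * x"] by (auto intro!: derivative_eq_intros)
    then show ?thesis unfolding soliton_def[abs_def] .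
  qed
  have "amp * (?r * cosh (?q * x) powr (?r - 1) * (sinh (?q * x) * ?q))
      = (?r * ?q) * (amp * cosh (?q * x) powr (?r - 1) * sinh (?q * x))" by (simp only: mult_ac)
  also have "\<dots> = - 1 * (amp * (cosh (?q * x) powr ?r / cosh (?q * x)) * sinh (?q * x))"
  proof -
    have "?r * ?q = - 1" using p_gt_2 by (simp add: field_simps)
    moreover have "cosh (?q * x) powr (?r - 1) = cosh (?q * x) powr ?r / cosh (?q * x)"
      using c by (simp add: powr_diff)
    ultimately show ?thesis by (simp only:)
  qed
  also have "\<dots> = dsoliton x"
    unfolding dsoliton_def soliton_def tanh_def by simp
  finally show ?thesis by (rule DERIV_cong[OF d])
qed

lemma dsoliton_deriv: "(dsoliton has_real_derivative soliton x - nl (soliton x)) (at x)"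
proof -
  let ?q = "(p - 2) / 2"
  have c: "cosh (?q * x) \<noteq> 0" using cosh_real_pos[of "?q * x"] by simp
  have "((\<lambda>x. tanh (?q * x)) has_real_derivative (1 - (tanh (?q * x))\<^sup>2) * ?q) (at x)"
    using c by (auto intro!: derivative_eq_intros)
  from DERIV_mult[OF DERIV_minus[OF soliton_deriv] this]
  have "(dsoliton has_real_derivative - dsoliton x * tanh (?q * x)
      + (1 - (tanh (?q * x))\<^sup>2) * ?q * - soliton x) (at x)"
    unfolding dsoliton_def[abs_def] by simp
  moreover have "nl (soliton x) = p / 2 * (1 - (tanh (?q * x))\<^sup>2) * soliton x"
    using soliton_pos[of x] soliton_powr[of x] by (simp add: nl_def)
  moreover have "- (- s * t) * t + (1 - t\<^sup>2) * ?q * - s = s - p / 2 * (1 - t\<^sup>2) * s" for s t :: real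
    by (simp add: field_simps power2_eq_square)
  ultimately show ?thesis by (simp only: dsoliton_def)
qed

lemma soliton_sol: "sol I (\<lambda>x. soliton (x + y)) (\<lambda>x. dsoliton (x + y))"
proof -
  have s: "((\<lambda>x. x + y) has_real_derivative 1) (at x)" for x by (auto intro!: derivative_eq_intros)
  show ?thesis
    unfolding sol_def
    using DERIV_chain2[OF soliton_deriv s] DERIV_chain2[OF dsoliton_deriv s]
    by (auto intro: has_field_derivative_at_within)
qed

lemma pot_pos_eq: "c > 0 \<Longrightarrow> pot c = c\<^sup>2 / 2 * (1 - 2 / p * c powr (p - 2))"
  using powr_add[of c "p - 2" 2] p_gt_2 by (simp add: pot_def algebra_simps)

lemma dsoliton_square: "(dsoliton x)\<^sup>2 = 2 * pot (soliton x)"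
proof -
  have eq: "2 / p * (p / 2 * z) = z" for z using p_gt_2 by simp
  then show ?thesis
    unfolding pot_pos_eq[OF soliton_pos] soliton_powr dsoliton_def
    by (simp only: eq) (simp add: power_mult_distrib)
qed

lemma pot_nonneg_imp_le_amp:
  assumes "pot c \<ge> 0" "c > 0" shows "c \<le> amp"
proof (rule ccontr)
  assume "\<not> c \<le> amp"
  then have "amp powr (p - 2) < c powr (p - 2)" using amp_gt_1 p_gt_2 by (intro powr_less_mono2) auto
  then have "1 - 2 / p * c powr (p - 2) < 0" using p_gt_2 by (simp add: amp_powr field_simps)
  then have "pot c < 0"
    unfolding pot_pos_eq[OF assms(2)] using assms(2) by (intro mult_pos_neg) auto
  then show False using assms by simp
qed

lemma soliton_le_amp: "soliton x \<le> amp"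
  using dsoliton_square[of x] by (intro pot_nonneg_imp_le_amp soliton_pos) (metis zero_le_power2 zero_le_mult_iff zero_less_numeral not_less_iff_gr_or_eq less_le_not_le linorder_not_le)

lemma soliton_exp_bound: "soliton x \<le> amp * 2 powr (2 / (p - 2)) * exp (- \<bar>x\<bar>)"
proof -
  let ?q = "(p - 2) / 2"
  have "exp (?q * \<bar>x\<bar>) / 2 \<le> cosh (?q * \<bar>x\<bar>)" by (simp add: cosh_def)
  also have "cosh (?q * \<bar>x\<bar>) = cosh (?q * x)" by (cases "x \<ge> 0") auto
  finally have "cosh (?q * x) powr (- (2 / (p - 2))) \<le> (exp (?q * \<bar>x\<bar>) / 2) powr (- (2 / (p - 2)))"
    using p_gt_2 by (intro powr_mono2') auto
  also have "\<dots> = exp (?q * \<bar>x\<bar>) powr (- (2 / (p - 2))) * 2 powr (2 / (p - 2))"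
    by (simp add: powr_divide powr_minus field_simps)
  also have "exp (?q * \<bar>x\<bar>) powr (- (2 / (p - 2))) = exp (- \<bar>x\<bar>)"
    using p_gt_2 by (simp add: powr_def)
  finally show ?thesis using amp_gt_1 by (simp add: soliton_def mult_ac)
qed

lemma soliton_borel [measurable]: "soliton \<in> borel_measurable borel"
  by (rule borel_measurable_continuous_onI, rule DERIV_continuous_on[of UNIV]) (rule soliton_deriv)

lemma integrable_exp_abs: "integrable lborel (\<lambda>x::real. exp (- \<bar>x\<bar>))"
proof -
  have "set_integrable lborel {0..} (\<lambda>x::real. exp (- x))"
  proof -
    have "((\<lambda>x::real. - exp (- x)) \<longlongrightarrow> - 0) at_top"
      by (intro tendsto_minus filterlim_compose[OF exp_at_bot] filterlim_uminus_at_bot_at_top)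
    then have "(\<integral>\<^sup>+x. ennreal (exp (- x)) * indicator {0::real ..} x \<partial>lborel) = ennreal (0 - (- exp (- 0)))"
      by (intro nn_integral_FTC_atLeast) (auto intro!: derivative_eq_intros)
    then have "(\<integral>\<^sup>+x. ennreal (indicator {0::real..} x *\<^sub>R exp (- x)) \<partial>lborel) < \<infinity>"
      by (simp add: mult.commute ennreal_mult' ennreal_indicator)
    then show ?thesis
      unfolding set_integrable_def by (intro integrableI_bounded) (auto simp: abs_mult)
  qed
  then have 1: "set_integrable lborel {0..} (\<lambda>x::real. exp (- \<bar>x\<bar>))"
    by (rule set_integrable_cong[THEN iffD1, rotated 3]) auto
  then have "integrable lborel (\<lambda>x. indicator {0..} (0 + (-1) * x) *\<^sub>R exp (- \<bar>0 + (-1) * x\<bar>) :: real)"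
    unfolding set_integrable_def by (rule lborel_integrable_real_affine) simp
  moreover have "(\<lambda>x::real. indicator {0..} (0 + (-1) * x) *\<^sub>R exp (- \<bar>0 + (-1) * x\<bar>) :: real) = (\<lambda>x. indicator {..0} x *\<^sub>R exp (- \<bar>x\<bar>))"
    by (auto simp: indicator_def)
  ultimately have 2: "set_integrable lborel {..0} (\<lambda>x::real. exp (- \<bar>x\<bar>))"
    by (simp add: set_integrable_def)
  have "set_integrable lborel ({0..} \<union> {..0}) (\<lambda>x::real. exp (- \<bar>x\<bar>))"
    by (rule set_integrable_Un[OF 1 2]) auto
  moreover have "{0..} \<union> {..0::real} = UNIV" by auto
  ultimately show ?thesis by (simp add: set_integrable_def)
qed

lemma soliton_integrable:
  "integrable lborel (\<lambda>x. (soliton x)\<^sup>2)" "integrable lborel (\<lambda>x. soliton x powr p)"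
proof -
  let ?C = "amp * 2 powr (2 / (p - 2))"
  have s: "\<bar>soliton x\<bar> = soliton x" for x using soliton_pos[of x] by simp
  show sq: "integrable lborel (\<lambda>x. (soliton x)\<^sup>2)"
  proof (rule Bochner_Integration.integrable_bound)
    show "integrable lborel (\<lambda>x::real. amp * ?C * exp (- \<bar>x\<bar>))"
      by (intro integrable_mult_right integrable_exp_abs)
    show "AE x in lborel. norm ((soliton x)\<^sup>2) \<le> norm (amp * ?C * exp (- \<bar>x\<bar>))"
    proof (rule AE_I2)
      fix x
      have "soliton x * soliton x \<le> amp * (?C * exp (- \<bar>x\<bar>))"
        using soliton_le_amp[of x] soliton_exp_bound[of x] soliton_pos[of x] amp_gt_1 by (intro mult_mono) auto
      then show "norm ((soliton x)\<^sup>2) \<le> norm (amp * ?C * exp (- \<bar>x\<bar>))"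
        using amp_gt_1 by (simp add: power2_eq_square abs_mult s mult.assoc)
    qed
  qed simp
  show "integrable lborel (\<lambda>x. soliton x powr p)"
  proof (rule Bochner_Integration.integrable_bound)
    show "integrable lborel (\<lambda>x. p / 2 * (soliton x)\<^sup>2)" using sq by simp
    show "AE x in lborel. norm (soliton x powr p) \<le> norm (p / 2 * (soliton x)\<^sup>2)"
    proof (rule AE_I2)
      fix x
      have "soliton x powr p = soliton x powr (p - 2) * (soliton x)\<^sup>2"
        using powr_add[of "soliton x" "p - 2" 2] soliton_pos[of x] by simp
      also have "\<dots> \<le> p / 2 * (soliton x)\<^sup>2"
        using p_gt_2 by (intro mult_right_mono) (auto simp: soliton_powr)
      finally show "norm (soliton x powr p) \<le> norm (p / 2 * (soliton x)\<^sup>2)" using p_gt_2 by simp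
    qed
  qed simp
qed

lemma soliton_H1: "H1_edge {0..} (\<lambda>x. soliton (x + y)) (\<lambda>x. dsoliton (x + y))"
proof (rule sol_H1_edge[OF _ soliton_sol])
  show I: "edge_interval {0..}" by (simp add: edge_interval_def)
  have "integrable lborel (\<lambda>x. (soliton (y + 1 * x))\<^sup>2)"
    by (rule lborel_integrable_real_affine[OF soliton_integrable(1)]) simp
  then show s: "set_integrable lborel {0..} (\<lambda>x. (soliton (x + y))\<^sup>2)"
    unfolding set_integrable_def by (intro integrable_mult_indicator) (auto simp: add.commute)
  have "(\<lambda>x. (dsoliton (x + y))\<^sup>2) = (\<lambda>x. (tanh ((p - 2) / 2 * (x + y)))\<^sup>2 * (soliton (x + y))\<^sup>2)"
    by (simp add: dsoliton_def power_mult_distrib mult.commute)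
  moreover have "set_integrable lborel {0..} \<dots>"
  proof (rule set_integrable_bound[OF s])
    have "isCont (\<lambda>x. (tanh ((p - 2) / 2 * (x + y)))\<^sup>2 * (soliton (x + y))\<^sup>2) x" for x
      by (intro continuous_intros DERIV_isCont[OF DERIV_chain2[OF soliton_deriv]])
        (auto simp: cosh_real_pos[THEN less_imp_neq, symmetric] intro!: derivative_eq_intros)
    then show "set_borel_measurable lborel {0..} (\<lambda>x. (tanh ((p - 2) / 2 * (x + y)))\<^sup>2 * (soliton (x + y))\<^sup>2)"
      by (intro continuous_imp_set_measurable) (auto intro: continuous_at_imp_continuous_on)
    have "(tanh z)\<^sup>2 \<le> 1" for z :: real
      using tanh_real_bounds[of z] by (auto simp: abs_square_le_1 abs_le_iff)
    then show "AE x in lborel. x \<in> {0..} \<longrightarrow> norm ((tanh ((p - 2) / 2 * (x + y)))\<^sup>2 * (soliton (x + y))\<^sup>2) \<le> norm ((soliton (x + y))\<^sup>2)"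
      by (intro AE_I2) (auto simp: abs_mult intro: mult_left_le_one_le)
  qed
  ultimately show "set_integrable lborel {0..} (\<lambda>x. (dsoliton (x + y))\<^sup>2)" by simp
qed

text \<open>The soliton is even, so the two integrals are those of \<open>soliton x powr p\<close>
  to the right and to the left of \<open>y\<close>.\<close>

lemma soliton_tail_sum:
  "(LBINT x:{0..}. soliton (x + y) powr p) + (LBINT x:{0..}. soliton (x - y) powr p)
    = (LINT x|lborel. soliton x powr p)"
proof -
  let ?f = "\<lambda>x. soliton x powr p"
  have i: "integrable lborel (\<lambda>x. indicator S x * ?f x)" if "S \<in> sets borel" for S
    using integrable_mult_indicator[OF _ soliton_integrable(2), of S] that by simp
  have "(LBINT x:{0..}. soliton (x + y) powr p) = (LINT x|lborel. indicator {y..} (y + 1 * x) * ?f (y + 1 * x))"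
    unfolding set_lebesgue_integral_def
    by (rule Bochner_Integration.integral_cong) (auto simp: indicator_def add.commute)
  also have "\<dots> = (LINT x|lborel. indicator {y..} x * ?f x)"
    using lborel_integral_real_affine[of 1 "\<lambda>x. indicator {y..} x * ?f x" y] by simp
  finally have 1: "(LBINT x:{0..}. soliton (x + y) powr p) = (LINT x|lborel. indicator {y..} x * ?f x)" .
  have "(LBINT x:{0..}. soliton (x - y) powr p) = (LINT x|lborel. indicator {..y} (y + (-1) * x) * ?f (y + (-1) * x))"
    unfolding set_lebesgue_integral_def
    by (rule Bochner_Integration.integral_cong)
      (use soliton_minus(1)[of "y - x" for x] in \<open>auto simp: indicator_def\<close>)
  also have "\<dots> = (LINT x|lborel. indicator {..y} x * ?f x)"
    using lborel_integral_real_affine[of "-1" "\<lambda>x. indicator {..y} x * ?f x" y] by simp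
  finally have 2: "(LBINT x:{0..}. soliton (x - y) powr p) = (LINT x|lborel. indicator {..y} x * ?f x)" .
  have "(LINT x|lborel. indicator {y..} x * ?f x) + (LINT x|lborel. indicator {..y} x * ?f x)
      = (LINT x|lborel. indicator {y..} x * ?f x + indicator {..y} x * ?f x)"
    by (rule Bochner_Integration.integral_add[symmetric]) (auto intro: i)
  also have "\<dots> = (LINT x|lborel. ?f x)"
  proof (rule integral_cong_AE)
    show "AE x in lborel. indicator {y..} x * ?f x + indicator {..y} x * ?f x = ?f x"
      using AE_lborel_singleton[of y] by eventually_elim (auto simp: indicator_def)
  qed auto
  finally show ?thesis using 1 2 by simp
qed

lemma soliton_hits:
  assumes "0 < c" "c \<le> amp"
  obtains y where "y \<ge> 0" "soliton y = c"
proof -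
  let ?C = "amp * 2 powr (2 / (p - 2))"
  have C: "?C > 0" using amp_gt_1 by simp
  define Y where "Y = max 0 (ln (?C / c))"
  have "soliton Y \<le> ?C * exp (- Y)" using soliton_exp_bound[of Y] by (simp add: Y_def)
  also have "\<dots> \<le> ?C * exp (- ln (?C / c))" using C by (intro mult_left_mono) (auto simp: Y_def)
  also have "\<dots> = c" using C assms by (simp add: exp_minus)
  finally have "soliton Y \<le> c" .
  moreover have "continuous_on {0..Y} soliton"
    by (rule DERIV_continuous_on, rule has_field_derivative_at_within, rule soliton_deriv)
  ultimately obtain y where "0 \<le> y" "soliton y = c"
    using IVT2'[of soliton Y c 0] assms by (auto simp: Y_def)
  then show thesis by (rule that)
qed

text \<open>At a given height zero energy leaves two slopes \<open>\<plusminus>b\<close>; the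
  soliton has one of them at \<open>y\<close> and the other at \<open>- y\<close>.\<close>

lemma soliton_hits_data:
  assumes "0 < c" "b\<^sup>2 = 2 * pot c"
  obtains y where "soliton y = c" "dsoliton y = b"
proof -
  have "pot c \<ge> 0" using assms(2) by (metis zero_le_power2 zero_le_mult_iff zero_less_numeral not_le)
  then obtain y where y: "soliton y = c" using soliton_hits[of c] pot_nonneg_imp_le_amp[of c] assms by metis
  then have "(dsoliton y)\<^sup>2 = b\<^sup>2" using dsoliton_square[of y] assms by simp
  then have "dsoliton y = b \<or> dsoliton (- y) = b" by (auto simp: power2_eq_iff)
  then show thesis using that[of y] that[of "- y"] y by auto
qed

text \<open>Both functions are bounded, hence solve the equation truncated at one common level,
  where uniqueness is available.\<close>

lemma halfline_sol_unique:
  assumes "sol {0..} u w" "H1_edge {0..} u w" "sol {0..} v z" "H1_edge {0..} v z"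
    and "u 0 = v 0" "w 0 = z 0" "x \<ge> 0"
  shows "u x = v x"
proof -
  have I: "edge_interval {0..}" by (simp add: edge_interval_def)
  obtain C where C: "C \<ge> 0" "\<And>x. x \<in> {0..} \<Longrightarrow> \<bar>u x\<bar> \<le> C" using H1_edge_bounded[OF I assms(2)] by blast
  obtain D where D: "D \<ge> 0" "\<And>x. x \<in> {0..} \<Longrightarrow> \<bar>v x\<bar> \<le> D" using H1_edge_bounded[OF I assms(4)] by blast
  have "tsol (max C D) {0..} u w" "tsol (max C D) {0..} v z"
    using C(2) D(2) assms(1,3) by (auto intro!: sol_imp_tsol le_max_iff_disj[THEN iffD2])
  then show ?thesis using tsol_unique(1)[of "max C D" "{0..}" u w v z x] C(1) assms(5-7) by simp
qed

lemma halfline_sol_zero: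
  assumes "sol {0..} u w" "H1_edge {0..} u w" "u 0 = 0" "x \<ge> 0"
  shows "u x = 0"
proof -
  \<comment> \<open>Zero energy turns the zero value at the vertex into a zero slope.\<close>
  have "(w 0)\<^sup>2 = 0" using sol_halfline_energy[OF assms(1,2), of 0] assms(3) p_gt_2 by (simp add: pot_def)
  then show ?thesis
    using halfline_sol_unique[OF assms(1,2), of "\<lambda>x. 0" "\<lambda>x. 0" x] assms
    by (simp add: sol_def H1_edge_def set_integrable_def)
qed

lemma halfline_sol_soliton:
  assumes "sol {0..} u w" "H1_edge {0..} u w" "u 0 > 0"
  obtains y where "soliton y = u 0" "dsoliton y = w 0" "\<And>x. x \<ge> 0 \<Longrightarrow> u x = soliton (x + y)"
proof -
  obtain y where y: "soliton y = u 0" "dsoliton y = w 0"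
    using soliton_hits_data[OF assms(3) sol_halfline_energy[OF assms(1,2), of 0]] by auto
  show thesis
  proof
    show "u x = soliton (x + y)" if "x \<ge> 0" for x
      using halfline_sol_unique[OF assms(1,2) soliton_sol soliton_H1, of y x] y that by simp
  qed (use y in auto)
qed

end

section \<open>Absence of small bound states\<close>

text \<open>Maximum principle: z is negative only where it is strictly concave, so a negative minimum
  can sit neither in the interior nor at an endpoint with vanishing derivative.\<close>
lemma concave_where_negative_imp_nonneg:
  fixes z z' z'' :: "real \<Rightarrow> real"
  assumes b: "b > 0"
    and d1: "\<And>x. x \<in> {0..b} \<Longrightarrow> (z has_real_derivative z' x) (at x within {0..b})"
    and d2: "\<And>x. x \<in> {0..b} \<Longrightarrow> (z' has_real_derivative z'' x) (at x within {0..b})"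
    and neg: "\<And>x. x \<in> {0..b} \<Longrightarrow> z x < 0 \<Longrightarrow> z'' x < 0"
    and bc: "z 0 \<ge> 0" "z b \<ge> 0 \<or> z' b = 0" and x: "x \<in> {0..b}"
  shows "z x \<ge> 0"
proof (rule ccontr)
  assume nx: "\<not> z x \<ge> 0"
  have cont: "continuous_on {0..b} z" using d1 by (rule DERIV_continuous_on)
  obtain m where m: "m \<in> {0..b}" "\<And>y. y \<in> {0..b} \<Longrightarrow> z m \<le> z y"
    using continuous_attains_inf[OF compact_Icc _ cont] x by auto
  have zm: "z m < 0" using m(2)[OF x] nx by simp
  have m0: "m > 0" using m(1) zm bc(1) by (cases "m = 0") auto
  have z'm: "z' m = 0"
  proof (cases "m = b")
    case True
    then show ?thesis using bc(2) zm by auto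
  next
    case False
    then have int: "m \<in> interior {0..b}" using m m0 by auto
    then have "(z has_real_derivative z' m) (at m)"
      using d1[OF m(1)] at_within_interior[OF int] by simp
    moreover have "\<forall>y. \<bar>m - y\<bar> < min m (b - m) \<longrightarrow> z m \<le> z y" using m by (auto simp: abs_if split: if_splits)
    moreover have "min m (b - m) > 0" using int by auto
    ultimately show ?thesis by (metis DERIV_local_min)
  qed
  have "continuous (at m within {0..b}) z" using cont m by (auto simp: continuous_on_eq_continuous_within)
  then obtain e where e: "e > 0" "\<And>y. y \<in> {0..b} \<Longrightarrow> dist y m < e \<Longrightarrow> dist (z y) (z m) < - z m"
    using zm unfolding continuous_within_eps_delta by (metis neg_0_less_iff_less)
  \<comment> \<open>On \<open>{a..m}\<close> the function \<open>z\<close> stays negative, so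
    \<open>z'\<close> decreases strictly to its value 0 at \<open>m\<close>. Thus
    \<open>z' > 0\<close> before \<open>m\<close>, and \<open>z\<close> would increase strictly up
    to its minimum.\<close>
  define a where "a = max 0 (m - e / 2)"
  have a: "0 \<le> a" "a < m" "m \<le> b" using e m m0 by (auto simp: a_def)
  have near: "z'' y < 0" if "y \<in> {a..m}" for y
  proof (rule neg)
    show "y \<in> {0..b}" using that a by auto
    moreover have "dist y m < e" using that e(1) by (auto simp: a_def dist_real_def)
    ultimately have "dist (z y) (z m) < - z m" by (rule e(2))
    then show "z y < 0" by (auto simp: dist_real_def)
  qed
  have d1': "(z has_real_derivative z' y) (at y within {a..m})"
    and d2': "(z' has_real_derivative z'' y) (at y within {a..m})" if "y \<in> {a..m}" for y
    using d1[of y] d2[of y] that a by (auto elim!: DERIV_subset)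
  have mono: "z' y > 0" if y: "a < y" "y < m" for y
  proof -
    have "z' m < z' y"
    proof (rule DERIV_neg_imp_decreasing_open[OF y(2)])
      fix t assume t: "y < t" "t < m"
      then have int: "t \<in> interior {a..m}" using y by auto
      then have "(z' has_real_derivative z'' t) (at t)"
        using d2'[of t] at_within_interior[OF int] interior_subset by (metis subsetD)
      then show "\<exists>d. (z' has_real_derivative d) (at t) \<and> d < 0" using near[of t] t y by auto
    next
      have "continuous_on {a..m} z'" using d2' by (rule DERIV_continuous_on)
      then show "continuous_on {y..m} z'" by (rule continuous_on_subset) (use y in auto)
    qed
    then show ?thesis using z'm by simp
  qed
  have "z a < z m"
  proof (rule DERIV_pos_imp_increasing_open[OF a(2)])
    fix t assume t: "a < t" "t < m"
    then have int: "t \<in> interior {a..m}" by auto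
    then have "(z has_real_derivative z' t) (at t)"
      using d1'[of t] at_within_interior[OF int] interior_subset by (metis subsetD)
    then show "\<exists>d. (z has_real_derivative d) (at t) \<and> d > 0" using mono[OF t] by auto
  next
    show "continuous_on {a..m} z" using d1' by (rule DERIV_continuous_on)
  qed
  then show False using m(2)[of a] a by auto
qed

text \<open>\<open>\<theta>\<close> is the distance from \<open>r\<close> to the nearest integer
  different from \<open>r\<close>. It depends on \<open>r\<close> alone and later turns an estimate
  into an equation.\<close>

lemma nearest_integer_gap:
  fixes r :: real
  obtains \<theta> where "\<theta> > 0" "\<And>k::int. \<bar>r - of_int k\<bar> < \<theta> \<Longrightarrow> r = of_int k"
proof (cases "r \<in> \<int>")
  case True
  then obtain n :: int where n: "r = of_int n" by (auto elim: Ints_cases)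
  show thesis
  proof
    fix k :: int assume "\<bar>r - of_int k\<bar> < 1"
    then have "real_of_int \<bar>n - k\<bar> < 1" unfolding n by simp
    then have "\<bar>n - k\<bar> < 1" by linarith
    then show "r = of_int k" unfolding n by simp
  qed simp
next
  case False
  have f: "r - of_int \<lfloor>r\<rfloor> > 0" "of_int \<lfloor>r\<rfloor> + 1 - r > 0"
  proof -
    have "r \<noteq> of_int \<lfloor>r\<rfloor>" using False by (metis Ints_of_int)
    then show "r - of_int \<lfloor>r\<rfloor> > 0" using of_int_floor_le[of r] by linarith
    show "of_int \<lfloor>r\<rfloor> + 1 - r > 0" using floor_correct[of r] by linarith
  qed
  show thesis
  proof
    show "min (r - of_int \<lfloor>r\<rfloor>) (of_int \<lfloor>r\<rfloor> + 1 - r) > 0" using f by simp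
    fix k :: int assume k: "\<bar>r - of_int k\<bar> < min (r - of_int \<lfloor>r\<rfloor>) (of_int \<lfloor>r\<rfloor> + 1 - r)"
    have "k \<le> \<lfloor>r\<rfloor> \<or> \<lfloor>r\<rfloor> + 1 \<le> k" by linarith
    then have "real_of_int k \<le> of_int \<lfloor>r\<rfloor> \<or> of_int \<lfloor>r\<rfloor> + 1 \<le> real_of_int k" by linarith
    then show "r = of_int k" using k by linarith
  qed
qed

context nls
begin

text \<open>Below height 1 the right side \<open>u - nl u\<close> has the sign of \<open>u\<close>,
  so \<open>u\<close> is strictly concave where it is negative and the maximum principle
  applies.\<close>

lemma small_compact_sol_nonneg:
  assumes b: "b > 0" and s: "sol {0..b} u w" and small: "\<And>x. x \<in> {0..b} \<Longrightarrow> \<bar>u x\<bar> < 1"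
    and bc: "u 0 \<ge> 0" "u b \<ge> 0 \<or> w b = 0" and x: "x \<in> {0..b}"
  shows "u x \<ge> 0"
proof (rule concave_where_negative_imp_nonneg[where z = u and z' = w and z'' = "\<lambda>x. u x - nl (u x)", OF b _ _ _ bc x])
  fix y assume y: "y \<in> {0..b}" "u y < 0"
  have "\<bar>u y\<bar> powr (p - 2) < 1" using powr_less_mono2[of "p - 2" "\<bar>u y\<bar>" 1] small[OF y(1)] p_gt_2 by simp
  then have "u y * (1 - \<bar>u y\<bar> powr (p - 2)) < 0" using y by (simp add: mult_neg_pos)
  then show "u y - nl (u y) < 0" by (simp add: nl_def algebra_simps)
qed (use s in \<open>auto simp: sol_def\<close>)

lemma small_compact_sol_zero:
  assumes b: "b > 0" and s: "sol {0..b} u w" and small: "\<And>x. x \<in> {0..b} \<Longrightarrow> \<bar>u x\<bar> < 1"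
    and bc: "u 0 = 0" "u b = 0 \<or> w b = 0" and x: "x \<in> {0..b}"
  shows "u x = 0"
  using small_compact_sol_nonneg[OF b s small _ _ x]
    small_compact_sol_nonneg[OF b sol_minus[OF s] _ _ _ x] small bc by auto

text \<open>The cases n = 1 and n = 2 are a pendant and a loop.  The exact flux identity comes from
  pairing with \<open>v x = cosh (l - x) / cosh l\<close>, the solution of the linearised equation, which is
  also a lower bound for \<open>u / c\<close> by the maximum principle.\<close>
lemma small_compact_sol_flux:
  fixes n :: real
  assumes l: "l > 0" and bn: "b = l \<and> n = 1 \<and> w b = 0 \<or> b = 2 * l \<and> n = 2 \<and> u b = c"
    and s: "sol {0..b} u w" and small: "\<And>x. x \<in> {0..b} \<Longrightarrow> \<bar>u x\<bar> < 1"
    and c: "c > 0" "u 0 = c"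
  defines "\<gamma> \<equiv> (p - 1) * l / (p * cosh l powr p)"
  defines "J \<equiv> w 0 - (if n = 2 then w b else 0) + n * c * tanh l"
  shows "n * c powr (p - 1) * (tanh l / p + \<gamma>) \<le> J" "J \<le> n * c powr (p - 1) * l"
proof -
  have b: "b > 0" "b = n * l" "n \<ge> 0" using bn l by auto
  have du: "(u has_real_derivative w x) (at x within {0..b})"
    and dw: "(w has_real_derivative u x - nl (u x)) (at x within {0..b})" if "x \<in> {0..b}" for x
    using s that by (auto simp: sol_def)
  have u0: "u x \<ge> 0" if "x \<in> {0..b}" for x
    using small_compact_sol_nonneg[OF b(1) s small _ _ that] bn c by auto
  define C where "C = cosh l"
  have C: "C > 0" "C \<ge> 1" unfolding C_def using cosh_real_ge_1[of l] by auto
  \<comment> \<open>\<open>v\<close> has value 1 at both ends of a loop and slope zero at the end of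
    a pendant: the same boundary conditions as \<open>u / c\<close>.\<close>
  define v where "v x = cosh (l - x) / C" for x
  define v' where "v' x = - sinh (l - x) / C" for x
  have v: "v x > 0" "v x \<le> 1" if "x \<in> {0..b}" for x
  proof -
    have "\<bar>l - x\<bar> \<le> \<bar>l\<bar>" using that bn l by auto
    then have "cosh \<bar>l - x\<bar> \<le> cosh \<bar>l\<bar>" by (subst cosh_real_nonneg_le_iff) auto
    then show "v x > 0" "v x \<le> 1"
      using C cosh_real_pos[of "l - x"] by (auto simp: v_def C_def)
  qed
  have dv: "(v has_real_derivative v' x) (at x within {0..b})"
    "(v' has_real_derivative v x) (at x within {0..b})" for x
    unfolding v_def[abs_def] v'_def[abs_def] using C by (auto intro!: derivative_eq_intros)
  have bv: "v 0 = 1" "v' 0 = - tanh l" using C by (simp_all add: v_def v'_def C_def tanh_def)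
  have uc: "u x \<le> c" if x: "x \<in> {0..b}" for x
  proof -
    have "c - u x \<ge> 0"
    proof (rule concave_where_negative_imp_nonneg[OF b(1) _ _ _ _ _ x])
      show "((\<lambda>x. c - u x) has_real_derivative - w y) (at y within {0..b})"
        "((\<lambda>x. - w x) has_real_derivative - (u y - nl (u y))) (at y within {0..b})" if "y \<in> {0..b}" for y
        using du[OF that] dw[OF that] by (auto intro!: derivative_eq_intros)
      fix y assume y: "y \<in> {0..b}" "c - u y < 0"
      then have "u y > 0" using c by simp
      moreover have "\<bar>u y\<bar> powr (p - 2) < 1" using powr_less_mono2[of "p - 2" "\<bar>u y\<bar>" 1] small[OF y(1)] p_gt_2 by simp
      ultimately have "u y * (1 - \<bar>u y\<bar> powr (p - 2)) > 0" by simp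
      then show "- (u y - nl (u y)) < 0" by (simp add: nl_def algebra_simps)
    qed (use bn c in auto)
    then show ?thesis by simp
  qed
  have lower: "c * v x \<le> u x" if x: "x \<in> {0..b}" for x
  proof -
    have "u x - c * v x \<ge> 0"
    proof (rule concave_where_negative_imp_nonneg[OF b(1) _ _ _ _ _ x])
      show "((\<lambda>x. u x - c * v x) has_real_derivative w y - c * v' y) (at y within {0..b})"
        "((\<lambda>x. w x - c * v' x) has_real_derivative (u y - nl (u y)) - c * v y) (at y within {0..b})"
        if "y \<in> {0..b}" for y
        using du[OF that] dw[OF that] dv[of y] by (auto intro!: derivative_eq_intros)
      fix y assume y: "y \<in> {0..b}" "u y - c * v y < 0"
      have "nl (u y) \<ge> 0" using u0[OF y(1)] by (simp add: nl_def)
      then show "u y - nl (u y) - c * v y < 0" using y by simp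
    next
      show "u 0 - c * v 0 \<ge> 0" using bv c by simp
      show "0 \<le> u b - c * v b \<or> w b - c * v' b = 0"
      proof (cases "n = 2")
        case True
        then have "u b = c" "b \<in> {0..b}" using bn b by auto
        then show ?thesis using v(2)[of b] c by simp
      next
        case False
        then show ?thesis using bn by (auto simp: v'_def)
      qed
    qed
    then show ?thesis by simp
  qed
  \<comment> \<open>The Wronskian of \<open>u\<close> and \<open>v\<close>: the linear terms cancel
    in its derivative, which leaves the nonlinearity, and its boundary values make up
    \<open>J\<close>.\<close>
  define B where "B x = w x * v x - u x * v' x" for x
  have dB: "(B has_real_derivative - nl (u x) * v x) (at x within {0..b})" if "x \<in> {0..b}" for x
    unfolding B_def[abs_def] using du[OF that] dw[OF that] dv[of x]
    by (auto intro!: derivative_eq_intros simp: algebra_simps)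
  have BJ: "B 0 - B b = J"
  proof (cases "n = 2")
    case True
    then have "b = 2 * l" "u b = c" using bn by auto
    then show ?thesis using True bv c C by (simp add: B_def J_def v_def v'_def C_def tanh_def)
  next
    case False
    then have "b = l" "w b = 0" "n = 1" using bn by auto
    then show ?thesis using bv c by (simp add: B_def J_def v'_def)
  qed
  \<comment> \<open>\<open>M' x\<close> is \<open>p * v x powr p\<close> minus
    \<open>(p - 1) * cosh (l - x) powr (p - 2) / C powr p\<close>. The total increment
    \<open>n * tanh l\<close> of \<open>M\<close> gives the main term, and the subtracted quantity
    is what \<open>\<gamma>\<close> measures.\<close>
  define M where "M x = - sinh (l - x) * cosh (l - x) powr (p - 1) / C powr p" for x
  define M' where "M' x = (p * cosh (l - x) powr p - (p - 1) * cosh (l - x) powr (p - 2)) / C powr p" for x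
  have dM: "(M has_real_derivative M' x) (at x within {0..b})" for x
  proof -
    have cp: "cosh (l - x) > 0" by (rule cosh_real_pos)
    have "((\<lambda>x. - sinh (l - x) * cosh (l - x) powr (p - 1)) has_real_derivative
       cosh (l - x) * cosh (l - x) powr (p - 1)
        + sinh (l - x) * ((p - 1) * cosh (l - x) powr (p - 1 - 1) * sinh (l - x))) (at x within {0..b})"
      using cp by (auto intro!: derivative_eq_intros)
    moreover have "cosh (l - x) * cosh (l - x) powr (p - 1) = cosh (l - x) powr p"
      using powr_add[of "cosh (l - x)" 1 "p - 1"] cp by simp
    moreover have "sinh (l - x) * ((p - 1) * cosh (l - x) powr (p - 1 - 1) * sinh (l - x))
       = (p - 1) * (cosh (l - x) powr p - cosh (l - x) powr (p - 2))"
    proof -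
      have "cosh (l - x) powr p = cosh (l - x) powr (p - 2) * (cosh (l - x))\<^sup>2"
        using powr_add[of "cosh (l - x)" "p - 2" 2] cp by simp
      then have "cosh (l - x) powr p - cosh (l - x) powr (p - 2) = cosh (l - x) powr (p - 2) * (sinh (l - x))\<^sup>2"
        by (simp add: cosh_square_eq algebra_simps)
      then show ?thesis by (simp add: power2_eq_square mult_ac)
    qed
    ultimately have "((\<lambda>x. - sinh (l - x) * cosh (l - x) powr (p - 1)) has_real_derivative
       cosh (l - x) powr p + (p - 1) * (cosh (l - x) powr p - cosh (l - x) powr (p - 2))) (at x within {0..b})"
      by (simp only:)
    moreover have "cosh (l - x) powr p + (p - 1) * (cosh (l - x) powr p - cosh (l - x) powr (p - 2))
      = p * cosh (l - x) powr p - (p - 1) * cosh (l - x) powr (p - 2)" by (simp add: algebra_simps)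
    ultimately show ?thesis unfolding M_def[abs_def] M'_def by (intro DERIV_cdivide) simp
  qed
  \<comment> \<open>Bounding \<open>cosh (l - x) powr (p - 2)\<close> below by 1 turns the
    subtracted quantity into the constant surplus \<open>\<gamma> / l\<close> per unit
    length.\<close>
  have M'_le: "M' x / p + \<gamma> / l \<le> v x powr p" for x
  proof -
    have "cosh (l - x) powr (p - 2) \<ge> 1" using cosh_real_ge_1[of "l - x"] p_gt_2 by (simp add: ge_one_powr_ge_zero)
    then have "M' x \<le> (p * cosh (l - x) powr p - (p - 1)) / C powr p"
      unfolding M'_def using p_gt_2 by (intro divide_right_mono diff_left_mono) auto
    then have "M' x / p \<le> (p * cosh (l - x) powr p - (p - 1)) / C powr p / p"
      using p_gt_2 by (intro divide_right_mono) auto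
    also have "\<dots> = v x powr p - \<gamma> / l"
      using p_gt_2 l C cosh_real_pos[of "l - x"]
      by (simp add: \<gamma>_def v_def C_def[symmetric] powr_divide diff_divide_distrib)
    finally show ?thesis by simp
  qed
  have MM: "M b - M 0 = n * tanh l"
  proof -
    have C1: "C * C powr (p - 1) = C powr p" using powr_add[of C 1 "p - 1"] C by simp
    have "M 0 = - (sinh l / C)" unfolding M_def using C by (simp add: C_def[symmetric] flip: C1)
    moreover have "M b = (if n = 2 then sinh l / C else 0)"
    proof (cases "n = 2")
      case True
      then have "b = 2 * l" using bn by auto
      then show ?thesis unfolding M_def using C True by (simp add: C_def[symmetric] flip: C1)
    next
      case False
      then have "b = l" using bn by auto
      then show ?thesis using False by (simp add: M_def)
    qed
    ultimately show ?thesis using bn by (auto simp: tanh_def C_def)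
  qed
  have nl_le: "nl (u x) * v x \<le> c powr (p - 1)" if x: "x \<in> {0..b}" for x
  proof -
    have "nl (u x) \<le> c powr (p - 1)" using u0[OF x] uc[OF x] p_gt_2 by (simp add: nl_pos powr_mono2)
    then have "nl (u x) * v x \<le> c powr (p - 1) * 1" using v[OF x] by (intro mult_mono) auto
    then show ?thesis by simp
  qed
  have nl_ge: "c powr (p - 1) * v x powr p \<le> nl (u x) * v x" if x: "x \<in> {0..b}" for x
  proof -
    have "(c * v x) powr (p - 1) \<le> nl (u x)"
      using lower[OF x] v(1)[OF x] c p_gt_2 u0[OF x] by (simp add: nl_pos powr_mono2)
    then have "(c * v x) powr (p - 1) * v x \<le> nl (u x) * v x" using v(1)[OF x] by simp
    moreover have "v x powr p = v x powr (p - 1) * v x" using powr_add[of "v x" "p - 1" 1] v(1)[OF x] by simp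
    ultimately show ?thesis using c v(1)[OF x] by (simp add: powr_mult mult.assoc)
  qed
  \<comment> \<open>Comparing derivatives of auxiliary functions takes the place of integrating
    \<open>nl (u x) * v x\<close> over the edge.\<close>
  have "B b + c powr (p - 1) * (M b / p + \<gamma> / l * b) \<le> B 0 + c powr (p - 1) * (M 0 / p + \<gamma> / l * 0)"
  proof (rule nonpos_derivative_within_imp_antimono[where a = 0 and b = b
        and f = "\<lambda>x. B x + c powr (p - 1) * (M x / p + \<gamma> / l * x)"])
    fix x assume x: "x \<in> {0..b}"
    show "((\<lambda>x. B x + c powr (p - 1) * (M x / p + \<gamma> / l * x)) has_real_derivative
        - nl (u x) * v x + c powr (p - 1) * (M' x / p + \<gamma> / l)) (at x within {0..b})"
      using dB[OF x] dM[of x] p_gt_2 l by (auto intro!: derivative_eq_intros)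
    have "c powr (p - 1) * (M' x / p + \<gamma> / l) \<le> c powr (p - 1) * v x powr p"
      using M'_le[of x] by (intro mult_left_mono) auto
    then show "- nl (u x) * v x + c powr (p - 1) * (M' x / p + \<gamma> / l) \<le> 0" using nl_ge[OF x] by simp
  qed (use b in auto)
  then have "c powr (p - 1) * ((M b - M 0) / p + \<gamma> / l * b) \<le> J"
    unfolding BJ[symmetric] by (simp add: algebra_simps diff_divide_distrib)
  also have "(M b - M 0) / p + \<gamma> / l * b = n * (tanh l / p + \<gamma>)"
    unfolding MM using l b(2) by (simp add: algebra_simps)
  finally show "n * c powr (p - 1) * (tanh l / p + \<gamma>) \<le> J" by (simp add: mult_ac)
  have "B 0 + c powr (p - 1) * 0 \<le> B b + c powr (p - 1) * b"
  proof (rule nonneg_derivative_within_imp_mono[where a = 0 and b = b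
        and f = "\<lambda>x. B x + c powr (p - 1) * x"])
    fix x assume x: "x \<in> {0..b}"
    show "((\<lambda>x. B x + c powr (p - 1) * x) has_real_derivative - nl (u x) * v x + c powr (p - 1)) (at x within {0..b})"
      using dB[OF x] by (auto intro!: derivative_eq_intros)
    show "0 \<le> - nl (u x) * v x + c powr (p - 1)" using nl_le[OF x] by simp
  qed (use b in auto)
  then show "J \<le> n * c powr (p - 1) * l" unfolding BJ[symmetric] b(2) by (simp add: mult_ac)
qed

end

section \<open>Smallness on the compact edges against the Kirchhoff condition\<close>

context knot
begin

lemma H1_graphI:
  assumes "\<And>e. e \<in> edges H P L \<Longrightarrow> H1_edge (edom l e) (u e) (w e)"
    "\<And>e. e \<in> edges H P L \<Longrightarrow> u e 0 = c" "\<And>i. i < L \<Longrightarrow> u (Loop i) (2 * l) = c"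
  shows "H1_graph H P L l u w"
  unfolding H1_graph_def
proof (intro conjI ballI exI[of _ c] allI impI)
  fix i assume "i < L"
  then show "u (Loop i) (2 * l) = u (Loop i) 0" using assms(2)[of "Loop i"] assms(3)[of i] by simp
qed (rule assms, assumption)+

lemma strong_minus: "strong u w \<Longrightarrow> strong (\<lambda>e x. - u e x) (\<lambda>e x. - w e x)"
proof -
  assume s: "strong u w"
  then have g: "H1_graph H P L l u w" by (simp add: strong_def)
  have "H1_edge (edom l e) (\<lambda>x. - u e x) (\<lambda>x. - w e x)" if "e \<in> edges H P L" for e
  proof (rule sol_H1_edge[OF edge_interval_edom sol_minus])
    show "sol (edom l e) (u e) (w e)" using s that by (simp add: strong_def)
  qed (use H1_edgeD(3,4)[OF H1_graphD(1)[OF g that]] in simp_all)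
  then have "H1_graph H P L l (\<lambda>e x. - u e x) (\<lambda>e x. - w e x)"
    by (rule H1_graphI[where c = "- u (Half 0) 0"])
      (simp_all only: neg_equal_iff_equal, erule H1_graphD(2)[OF g], erule H1_graphD(3)[OF g])
  moreover have "flux (\<lambda>e x. - w e x) = - flux w"
    by (simp add: flux_def sum_negf sum_subtractf)
  ultimately show ?thesis using s by (simp add: strong_def sol_minus)
qed

lemma nontriv_minus [simp]: "nontriv (\<lambda>e x. - u e x) = nontriv u"
  by (simp add: nontriv_def)

lemma strongD:
  assumes "strong u w"
  shows "i < H \<Longrightarrow> sol {0..} (u (Half i)) (w (Half i))" "i < H \<Longrightarrow> H1_edge {0..} (u (Half i)) (w (Half i))"
    "i < P \<Longrightarrow> sol {0..l} (u (Pend i)) (w (Pend i))" "i < L \<Longrightarrow> sol {0..2*l} (u (Loop i)) (w (Loop i))"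
    "i < P \<Longrightarrow> w (Pend i) l = 0" "i < H \<Longrightarrow> u (Half i) 0 = u (Half 0) 0"
    "i < P \<Longrightarrow> u (Pend i) 0 = u (Half 0) 0" "i < L \<Longrightarrow> u (Loop i) 0 = u (Half 0) 0"
    "i < L \<Longrightarrow> u (Loop i) (2 * l) = u (Half 0) 0" "flux w = 0"
proof -
  have g: "H1_graph H P L l u w" and s: "\<And>e. e \<in> edges H P L \<Longrightarrow> sol (edom l e) (u e) (w e)"
    using assms by (auto simp: strong_def)
  show "i < H \<Longrightarrow> sol {0..} (u (Half i)) (w (Half i))" "i < H \<Longrightarrow> H1_edge {0..} (u (Half i)) (w (Half i))"
    using s[of "Half i"] H1_graphD(1)[OF g, of "Half i"] by simp_all
  show "i < P \<Longrightarrow> sol {0..l} (u (Pend i)) (w (Pend i))" "i < L \<Longrightarrow> sol {0..2*l} (u (Loop i)) (w (Loop i))"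
    using s[of "Pend i"] s[of "Loop i"] by simp_all
  show "i < P \<Longrightarrow> w (Pend i) l = 0" "flux w = 0" using assms by (auto simp: strong_def)
  show "i < H \<Longrightarrow> u (Half i) 0 = u (Half 0) 0"
    "i < P \<Longrightarrow> u (Pend i) 0 = u (Half 0) 0" "i < L \<Longrightarrow> u (Loop i) 0 = u (Half 0) 0"
    by (rule H1_graphD(2)[OF g], simp)+
  show "i < L \<Longrightarrow> u (Loop i) (2 * l) = u (Half 0) 0" by (rule H1_graphD(3)[OF g])
qed

text \<open>Half-lines are left out on purpose: when a sequence of bound states tends to zero
  locally uniformly, bumps may still travel along them to infinity.\<close>

definition compact_small :: "real \<Rightarrow> (edge \<Rightarrow> real \<Rightarrow> real) \<Rightarrow> bool" where
  "compact_small d u \<longleftrightarrow> (\<forall>i<P. \<forall>x\<in>{0..l}. \<bar>u (Pend i) x\<bar> < d) \<and> (\<forall>i<L. \<forall>x\<in>{0..2*l}. \<bar>u (Loop i) x\<bar> < d)"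

text \<open>With value zero at the vertex a compact edge could still carry a large solution, which
  smallness excludes; on a half-line zero energy does so.\<close>

lemma compact_small_zero_imp_trivial:
  assumes s: "strong u w" and small: "compact_small 1 u" and "u (Half 0) 0 = 0"
  shows "\<not> nontriv u"
proof -
  have half: "u (Half i) x = 0" if "i < H" "x \<ge> 0" for i x
  proof (rule halfline_sol_zero[OF strongD(1,2)[OF s that(1)] _ that(2)])
    show "u (Half i) 0 = 0" using strongD(6)[OF s that(1)] assms(3) by simp
  qed
  have pend: "u (Pend i) x = 0" if "i < P" "x \<in> {0..l}" for i x
  proof (rule small_compact_sol_zero[OF l_pos strongD(3)[OF s that(1)] _ _ _ that(2)])
    show "u (Pend i) 0 = 0" using strongD(7)[OF s that(1)] assms(3) by simp
  qed (use small strongD(5)[OF s that(1)] that in \<open>auto simp: compact_small_def\<close>)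
  have loop: "u (Loop i) x = 0" if "i < L" "x \<in> {0..2*l}" for i x
  proof (rule small_compact_sol_zero[OF _ strongD(4)[OF s that(1)] _ _ _ that(2)])
    show "u (Loop i) 0 = 0" "u (Loop i) (2 * l) = 0 \<or> w (Loop i) (2 * l) = 0"
      using strongD(8,9)[OF s that(1)] assms(3) by simp_all
  qed (use small that l_pos in \<open>auto simp: compact_small_def\<close>)
  have "u e x = 0" if "e \<in> edges H P L" "x \<in> edom l e" for e x
    using that half pend loop by (cases e) simp_all
  then show ?thesis by (auto simp: nontriv_def)
qed

text \<open>Zero energy fixes each half-line slope up to its sign, and \<open>k\<close> is the sum
  of the signs. Its bound keeps the error of replacing the square root by 1 of order
  \<open>c powr (p - 2)\<close>, with a constant depending on \<open>H\<close> and \<open>p\<close>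
  only.\<close>

lemma half_flux_integer:
  assumes s: "strong u w" and c: "u (Half 0) 0 = c" "c > 0" and sc: "c powr (p - 2) \<le> p / 2"
  obtains k :: int where "(\<Sum>i<H. w (Half i) 0) = of_int k * (c * sqrt (1 - 2 / p * c powr (p - 2)))"
    "\<bar>k\<bar> \<le> int H"
proof -
  define q where "q = sqrt (1 - 2 / p * c powr (p - 2))"
  have q2: "q\<^sup>2 = 1 - 2 / p * c powr (p - 2)" unfolding q_def using sc p_gt_2 by (simp add: field_simps)
  have "w (Half i) 0 = c * q \<or> w (Half i) 0 = - (c * q)" if "i < H" for i
  proof -
    have "(w (Half i) 0)\<^sup>2 = 2 * pot c"
      using sol_halfline_energy[OF strongD(1,2)[OF s that], of 0] strongD(6)[OF s that] c(1) by simp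
    also have "\<dots> = (c * q)\<^sup>2" unfolding pot_pos_eq[OF c(2)] power_mult_distrib q2 by simp
    finally show ?thesis by (simp only: power2_eq_iff)
  qed
  then have "\<exists>\<sigma>::int. \<bar>\<sigma>\<bar> \<le> 1 \<and> w (Half i) 0 = of_int \<sigma> * (c * q)" if "i < H" for i
    using that by (metis abs_minus_cancel abs_one mult_1 mult_minus_left of_int_1 of_int_minus order_refl)
  then obtain \<sigma> :: "nat \<Rightarrow> int" where \<sigma>: "\<And>i. i < H \<Longrightarrow> \<bar>\<sigma> i\<bar> \<le> 1" "\<And>i. i < H \<Longrightarrow> w (Half i) 0 = of_int (\<sigma> i) * (c * q)"
    by metis
  show thesis
  proof
    show "(\<Sum>i<H. w (Half i) 0) = of_int (\<Sum>i<H. \<sigma> i) * (c * sqrt (1 - 2 / p * c powr (p - 2)))"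
      using \<sigma>(2) by (simp add: sum_distrib_right q_def)
    have "\<bar>\<Sum>i<H. \<sigma> i\<bar> \<le> (\<Sum>i<H. \<bar>\<sigma> i\<bar>)" by (rule sum_abs)
    also have "\<dots> \<le> (\<Sum>i<H. 1)" using \<sigma>(1) by (intro sum_mono) simp
    finally show "\<bar>\<Sum>i<H. \<sigma> i\<bar> \<le> int H" by simp
  qed
qed

text \<open>If the compact part is small then the vertex condition reads
  \<open>N tanh l - k s = O(c\<^sup>p\<^sup>-\<^sup>2)\<close> with an integer k, which forces \<open>k = N tanh l\<close>; the term of order
  \<open>c\<^sup>p\<^sup>-\<^sup>2\<close> then has the wrong sign.\<close>
lemma no_small_bound_state:
  assumes N: "P + L \<ge> 1"
  obtains d where "d > 0" "\<And>u w. strong u w \<Longrightarrow> nontriv u \<Longrightarrow> \<not> compact_small d u"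
proof -
  define N where "N = real P + 2 * real L"
  have N1: "N \<ge> 1" using N unfolding N_def by linarith
  define t where "t = tanh l"
  have t0: "t > 0" using l_pos by (simp add: t_def)
  define \<gamma> where "\<gamma> = (p - 1) * l / (p * cosh l powr p)"
  have g0: "\<gamma> > 0" using p_gt_2 l_pos cosh_real_pos[of l] by (simp add: \<gamma>_def)
  obtain \<theta> where \<theta>: "\<theta> > 0" "\<And>k::int. \<bar>N * t - of_int k\<bar> < \<theta> \<Longrightarrow> N * t = of_int k"
    using nearest_integer_gap[of "N * t"] by blast
  \<comment> \<open>Errors per unit of \<open>e = c powr (p - 2)\<close>: \<open>N * l\<close> from
    the compact edges, \<open>2 * real H / p\<close> from replacing the square root by 1. The last
    summand makes the estimate strict.\<close>
  define R where "R = N * l + 2 * real H / p + 1"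
  have R: "R > 0" using N1 l_pos p_gt_2 by (auto simp: R_def intro!: add_nonneg_pos)
  \<comment> \<open>The three entries keep the radicand \<open>1 - 2 / p * e\<close> nonnegative,
    force the integer, and let \<open>\<gamma>\<close> win the final comparison.\<close>
  define e0 where "e0 = min (1/2) (min (\<theta> / R) (\<gamma> / (t / p + \<gamma>)))"
  have tg: "t / p + \<gamma> > 0" using t0 g0 p_gt_2 by (simp add: add_pos_pos)
  have e0: "e0 > 0" "e0 \<le> 1/2" "e0 * R \<le> \<theta>" "e0 * (t / p + \<gamma>) \<le> \<gamma>"
  proof -
    show "e0 > 0" unfolding e0_def using \<theta>(1) R g0 tg by simp
    show "e0 \<le> 1/2" unfolding e0_def by (rule min.cobounded1)
    have "e0 \<le> \<theta> / R" "e0 \<le> \<gamma> / (t / p + \<gamma>)" by (simp_all add: e0_def)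
    then show "e0 * R \<le> \<theta>" "e0 * (t / p + \<gamma>) \<le> \<gamma>" using R tg by (simp_all add: pos_le_divide_eq)
  qed
  define d where "d = e0 powr (1 / (p - 2))"
  have d: "d > 0" "d powr (p - 2) = e0" using e0(1) p_gt_2 by (simp_all add: d_def powr_powr)
  have d1: "d < 1"
    using powr_less_mono2[of "1 / (p - 2)" e0 1] e0 p_gt_2 by (simp add: d_def)
  have pos: False if s: "strong u w" and small: "compact_small d u" and c0: "u (Half 0) 0 > 0" for u w
  proof -
    define c where "c = u (Half 0) 0"
    have c: "c > 0" using c0 by (simp add: c_def)
    have smallp: "\<bar>u (Pend i) x\<bar> < d" if "i < P" "x \<in> {0..l}" for i x
      using small that by (simp add: compact_small_def)
    have smalll: "\<bar>u (Loop i) x\<bar> < d" if "i < L" "x \<in> {0..2*l}" for i x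
      using small that by (simp add: compact_small_def)
    \<comment> \<open>A compact edge has to exist here: its smallness at 0 is smallness of the
      vertex value.\<close>
    have cd: "c < d"
    proof (cases "P = 0")
      case True
      then have "0 < L" using N by simp
      then show ?thesis using smalll[of 0 0] strongD(8)[OF s, of 0] l_pos c by (simp add: c_def)
    next
      case False
      then show ?thesis using smallp[of 0 0] strongD(7)[OF s, of 0] l_pos c by (simp add: c_def)
    qed
    define e where "e = c powr (p - 2)"
    have e: "e > 0" "e < e0" using c cd d powr_less_mono2[of "p - 2" c d] p_gt_2 by (simp_all add: e_def)
    have cp: "c powr (p - 1) = c * e" using powr_add[of c "p - 2" 1] c by (simp add: e_def)
    have pend: "c * e * (t / p + \<gamma>) \<le> w (Pend i) 0 + c * t" "w (Pend i) 0 + c * t \<le> c * e * l" if i: "i < P" for i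
      using small_compact_sol_flux[of l l 1 "w (Pend i)" "u (Pend i)" c] l_pos strongD(3,5,7)[OF s i] smallp[OF i] d1 c
      by (fastforce simp: c_def[symmetric] cp t_def \<gamma>_def)+
    have loop: "2 * (c * e) * (t / p + \<gamma>) \<le> w (Loop i) 0 - w (Loop i) (2 * l) + 2 * c * t"
      "w (Loop i) 0 - w (Loop i) (2 * l) + 2 * c * t \<le> 2 * (c * e) * l" if i: "i < L" for i
      using small_compact_sol_flux[of l "2 * l" 2 "w (Loop i)" "u (Loop i)" c] l_pos strongD(4,8,9)[OF s i] smalll[OF i] d1 c
      by (fastforce simp: c_def[symmetric] cp t_def \<gamma>_def)+
    define X where "X = (\<Sum>i<P. w (Pend i) 0 + c * t) + (\<Sum>i<L. w (Loop i) 0 - w (Loop i) (2 * l) + 2 * c * t)"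
    have X1: "c * e * (t / p + \<gamma>) * N \<le> X"
    proof -
      have "(\<Sum>i<P. c * e * (t / p + \<gamma>)) + (\<Sum>i<L. 2 * (c * e) * (t / p + \<gamma>)) \<le> X"
        unfolding X_def using pend(1) loop(1) by (intro add_mono sum_mono) auto
      then show ?thesis by (simp add: N_def algebra_simps)
    qed
    have X2: "X \<le> c * e * l * N"
    proof -
      have "X \<le> (\<Sum>i<P. c * e * l) + (\<Sum>i<L. 2 * (c * e) * l)"
        unfolding X_def using pend(2) loop(2) by (intro add_mono sum_mono) auto
      then show ?thesis by (simp add: N_def algebra_simps)
    qed
    have ep: "e \<le> p / 2" "2 / p * e \<le> e" using e e0 p_gt_2 by (auto simp: field_simps)
    obtain k :: int where k: "(\<Sum>i<H. w (Half i) 0) = of_int k * (c * sqrt (1 - 2 / p * e))" "\<bar>k\<bar> \<le> int H"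
      using half_flux_integer[OF s c_def[symmetric] c] ep(1) by (auto simp: e_def)
    define q where "q = sqrt (1 - 2 / p * e)"
    have z: "0 \<le> 1 - 2 / p * e" "1 - 2 / p * e \<le> 1" using ep e e0 p_gt_2 by auto
    have q2: "q\<^sup>2 = 1 - 2 / p * e" unfolding q_def using z by simp
    have q: "0 \<le> q" "q \<le> 1" unfolding q_def using z by auto
    \<comment> \<open>\<open>q\<^sup>2 \<le> q\<close> for \<open>q\<close> between 0 and 1, which
      bounds the square root below without a Taylor expansion.\<close>
    have q3: "1 - 2 / p * e \<le> q"
      using q2 q mult_left_le[of q q] by (simp add: power2_eq_square)
    have XX: "X = c * (N * t - of_int k * q)"
    proof -
      have "X = flux w - (\<Sum>i<H. w (Half i) 0) + c * t * N"
        unfolding X_def flux_def sum.distrib N_def by (simp add: algebra_simps)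
      then show ?thesis using strongD(10)[OF s] k(1) by (simp add: q_def algebra_simps)
    qed
    have Y1: "e * (t / p + \<gamma>) * N \<le> N * t - of_int k * q"
      using X1 c unfolding XX by (metis mult.assoc mult_le_cancel_left_pos)
    have Y2: "N * t - of_int k * q \<le> e * l * N"
      using X2 c unfolding XX by (metis mult.assoc mult_le_cancel_left_pos)
    have kH: "\<bar>of_int k\<bar> \<le> real H" using k(2) by linarith
    have "\<bar>N * t - of_int k\<bar> < \<theta>"
    proof -
      have "0 \<le> e * (t / p + \<gamma>) * N" using e tg N1 by simp
      then have "\<bar>N * t - of_int k * q\<bar> \<le> e * l * N" using Y1 Y2 by linarith
      moreover have "\<bar>of_int k * q - of_int k\<bar> \<le> real H * (2 / p * e)"
      proof -
        have "\<bar>of_int k * q - of_int k\<bar> = \<bar>real_of_int k\<bar> * (1 - q)"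
        proof -
          have "of_int k * q - of_int k = - (of_int k * (1 - q))" by (simp add: algebra_simps)
          then show ?thesis using q by (simp add: abs_mult)
        qed
        also have "\<dots> \<le> real H * (2 / p * e)" using kH q q3 by (intro mult_mono) auto
        finally show ?thesis .
      qed
      ultimately have "\<bar>N * t - of_int k\<bar> \<le> e * l * N + real H * (2 / p * e)" by linarith
      also have "\<dots> = e * (R - 1)" by (simp add: R_def algebra_simps)
      also have "\<dots> < e * R" using e by simp
      also have "\<dots> \<le> e0 * R" using e R by simp
      finally show ?thesis using e0 by simp
    qed
    then have Nt: "N * t = of_int k" by (rule \<theta>(2))
    have "e * (t / p + \<gamma>) * N \<le> t * (1 - q) * N" using Y1 unfolding Nt[symmetric] by (simp add: algebra_simps)
    then have "e * (t / p + \<gamma>) \<le> t * (1 - q)" using N1 by simp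
    \<comment> \<open>The factor \<open>1 + q\<close> turns \<open>1 - q\<close> into
      \<open>1 - q\<^sup>2\<close>, which is linear in \<open>e\<close>.\<close>
    then have "e * (t / p + \<gamma>) * (1 + q) \<le> t * (1 - q) * (1 + q)" using q by (intro mult_right_mono) auto
    also have "\<dots> = t * (1 - q\<^sup>2)" by (simp add: power2_eq_square algebra_simps)
    also have "\<dots> = e * (2 * t / p)" unfolding q2 by (simp add: algebra_simps)
    finally have "e * ((t / p + \<gamma>) * (1 + q)) \<le> e * (2 * t / p)" by (simp add: mult.assoc)
    then have "(t / p + \<gamma>) * (1 + q) \<le> 2 * t / p"
      using e(1) by (simp only: mult_le_cancel_left_pos)
    moreover have "(t / p + \<gamma>) * (2 - 2 / p * e) \<le> (t / p + \<gamma>) * (1 + q)" using q3 tg by (intro mult_left_mono) auto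
    moreover have "2 / p * e * (t / p + \<gamma>) < 2 * \<gamma>"
    proof -
      have "2 / p * e * (t / p + \<gamma>) \<le> e * (t / p + \<gamma>)" using ep(2) tg by (intro mult_right_mono) auto
      also have "\<dots> < e0 * (t / p + \<gamma>)" using e tg by simp
      also have "\<dots> \<le> \<gamma>" by (rule e0)
      finally show ?thesis using g0 by simp
    qed
    ultimately show False by (simp add: algebra_simps)
  qed
  show thesis
  proof
    show "d > 0" by (rule d)
    fix u w assume s: "strong u w" "nontriv u"
    show "\<not> compact_small d u"
    proof
      assume small: "compact_small d u"
      then have small1: "compact_small 1 u" using d1 by (fastforce simp: compact_small_def)
      consider "u (Half 0) 0 = 0" | "u (Half 0) 0 > 0" | "u (Half 0) 0 < 0" by linarith
      then show False
      proof cases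
        case 1
        then show ?thesis using compact_small_zero_imp_trivial[OF s(1) small1] s(2) by simp
      next
        case 2
        then show ?thesis using pos s small by blast
      next
        case 3
        have "compact_small d (\<lambda>e x. - u e x)" using small by (simp add: compact_small_def)
        then show ?thesis using pos[OF strong_minus[OF s(1)]] 3 by simp
      qed
    qed
  qed
qed

end

section \<open>Existence of bound states\<close>

text \<open>Serves as a continuation argument: up to the first hit a solution stays in the range
  where the truncated equation is the true one.\<close>

lemma first_hit:
  fixes h :: "real \<Rightarrow> real"
  assumes h: "continuous_on {0..b} h" and "0 \<le> b" "h 0 < r" "r \<le> h b"
  obtains x where "x \<in> {0..b}" "h x = r" "\<And>y. y \<in> {0..x} \<Longrightarrow> h y \<le> r"
proof -
  have "compact ({0..b} \<inter> h -` {r..})"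
    using continuous_closed_preimage[OF h closed_atLeastAtMost closed_atLeast[of r]]
    by (meson bounded_Int bounded_closed_interval compact_eq_bounded_closed)
  moreover have "{0..b} \<inter> h -` {r..} \<noteq> {}" using assms by auto
  ultimately obtain x where "x \<in> {0..b} \<inter> h -` {r..}" "\<forall>y\<in>{0..b} \<inter> h -` {r..}. x \<le> y"
    using compact_attains_inf[of "{0..b} \<inter> h -` {r..}"] by blast
  then have x: "x \<in> {0..b}" "h x \<ge> r" "\<And>y. y \<in> {0..b} \<Longrightarrow> h y \<ge> r \<Longrightarrow> x \<le> y"
    by simp_all
  have "continuous_on {0..x} h" by (rule continuous_on_subset[OF h]) (use x in auto)
  then obtain z where z: "0 \<le> z" "z \<le> x" "h z = r"
    using IVT'[of h 0 r x] assms x by auto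
  then have "z = x" using x(3)[of z] x(1) by auto
  show thesis
  proof
    fix y assume y: "y \<in> {0..x}"
    show "h y \<le> r"
    proof (rule ccontr)
      assume "\<not> h y \<le> r"
      then show False using x(3)[of y] y x(1) z \<open>z = x\<close> by (cases "y = x") auto
    qed
  qed (use x z \<open>z = x\<close> in auto)
qed

context nls
begin

lemma pot_nonneg: "0 \<le> a \<Longrightarrow> a \<le> amp \<Longrightarrow> pot a \<ge> 0"
proof (cases "a = 0")
  case False
  assume a: "0 \<le> a" "a \<le> amp"
  then have "a powr (p - 2) \<le> p / 2" using p_gt_2 by (simp add: powr_mono2 flip: amp_powr)
  then have "0 \<le> 1 - 2 / p * a powr (p - 2)" using p_gt_2 by (simp add: field_simps)
  moreover have "a > 0" using a False by simp
  ultimately show ?thesis unfolding pot_pos_eq[OF \<open>a > 0\<close>] by (intro mult_nonneg_nonneg) auto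
qed (use p_gt_2 in \<open>simp add: pot_def\<close>)

lemma pot_abs: "pot \<bar>x\<bar> = pot x" by (simp add: pot_def)

lemma tsol_zero: "T \<ge> 0 \<Longrightarrow> tsol T I (\<lambda>x. 0) (\<lambda>x. 0)"
  by (simp add: tsol_def tnl_id)

text \<open>Solutions starting at rest in \<open>[1, amp]\<close> have non-positive energy, hence are trapped inside the
  homoclinic loop of the soliton.\<close>
lemma trapped_solution:
  assumes T: "T > amp" and a: "1 \<le> a" "a \<le> amp"
    and s: "tsol T {0..} v w" and init: "v 0 = a" "w 0 = 0" and x: "x \<ge> 0"
  shows "\<bar>v x\<bar> \<le> amp" "v x > 0"
proof -
  have T0: "T \<ge> 0" using T amp_gt_1 by simp
  have contv: "continuous_on {0..b} v" for b
    using tsol_subset[OF s, of "{0..b}"] by (intro DERIV_continuous_on) (auto simp: tsol_def)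
  have bound: "\<bar>v x\<bar> \<le> amp" if x: "x \<ge> 0" for x
  proof (rule ccontr)
    assume nx: "\<not> \<bar>v x\<bar> \<le> amp"
    \<comment> \<open>Strictly above \<open>amp\<close>, so that \<open>pot r < 0\<close>, but at
      most \<open>T\<close>, so that the energy is conserved up to the first hit.\<close>
    define r where "r = min T \<bar>v x\<bar>"
    have r: "r > amp" "r \<le> T" "r \<le> \<bar>v x\<bar>" using nx T by (auto simp: r_def)
    obtain y where y: "y \<in> {0..x}" "\<bar>v y\<bar> = r" "\<And>z. z \<in> {0..y} \<Longrightarrow> \<bar>v z\<bar> \<le> r"
      using first_hit[of x "\<lambda>x. \<bar>v x\<bar>" r] contv[of x] x r a init by (auto intro!: continuous_on_rabs)
    have "sol {0..y} v w"
      by (rule tsol_imp_sol[OF tsol_subset[OF s]]) (use y(3) r in fastforce)+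
    then have "(w y)\<^sup>2 / 2 - pot (v y) = (w 0)\<^sup>2 / 2 - pot (v 0)"
      by (rule sol_energy) (use y(1) in auto)
    moreover have "pot (v y) < 0"
    proof (rule ccontr)
      assume "\<not> pot (v y) < 0"
      then have "pot r \<ge> 0" using pot_abs[of "v y"] y(2) by simp
      then have "r \<le> amp" using pot_nonneg_imp_le_amp[of r] r amp_gt_1 by simp
      then show False using r by simp
    qed
    moreover have "pot a \<ge> 0" using pot_nonneg[of a] a by simp
    moreover have "(w y)\<^sup>2 / 2 \<ge> 0" by simp
    ultimately show False by (simp add: init)
  qed
  then show "\<bar>v x\<bar> \<le> amp" using x by blast
  have nz: "v x \<noteq> 0" if x: "x \<ge> 0" for x
  proof
    assume vx: "v x = 0"
    have "sol {0..x} v w"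
      by (rule tsol_imp_sol[OF tsol_subset[OF s]]) (use bound T in fastforce)+
    then have "(w x)\<^sup>2 / 2 - pot (v x) = (w 0)\<^sup>2 / 2 - pot (v 0)"
      by (rule sol_energy) (use x in auto)
    then have "(w x)\<^sup>2 / 2 = - pot a" using vx init p_gt_2 by (simp add: pot_def)
    moreover have "pot a \<ge> 0" using pot_nonneg[of a] a by simp
    ultimately have "(w x)\<^sup>2 \<le> 0" by linarith
    then have wx: "w x = 0" by simp
    \<comment> \<open>A zero of \<open>v\<close> has slope zero as well, so running time backwards
      from it gives the zero solution and contradicts \<open>v 0 = a\<close>.\<close>
    have "tsol T {0..x} (\<lambda>y. v (x - y)) (\<lambda>y. - w (x - y))"
      by (rule tsol_reflect[OF s]) auto
    from tsol_unique(1)[OF this tsol_zero[OF T0] T0 order_refl x] vx wx have "v 0 = 0" by simp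
    then show False using init a by simp
  qed
  show "v x > 0"
  proof (rule ccontr)
    assume "\<not> v x > 0"
    then obtain y where "0 \<le> y" "y \<le> x" "v y = 0"
      using IVT2'[of v x 0 0] contv[of x] x init a by auto
    then show False using nz by blast
  qed
qed

text \<open>Matching the slope of one soliton tail against N symmetric edges, by the intermediate value
  theorem in the end value a: a = 1 is the constant solution, a = amp the soliton itself.\<close>
lemma matched_edge_solution:
  fixes N :: real
  assumes N: "N \<ge> 1" and l: "l > 0" and T: "T > amp"
  obtains a v w where "1 \<le> a" "a \<le> amp" "tsol T {0..} v w" "v 0 = a" "w 0 = 0"
    "N * w l + v l * sqrt (1 - 2 / p * v l powr (p - 2)) = 0"
proof -
  have T0: "T \<ge> 0" using T amp_gt_1 by simp
  have "\<exists>v w. tsol T {0..} v w \<and> v 0 = a \<and> w 0 = 0" for a using tsol_exists[OF T0, of a 0] by metis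
  then obtain V W where VW: "\<And>a. tsol T {0..} (V a) (W a)" "\<And>a. V a 0 = a" "\<And>a. W a 0 = 0" by metis
  have trapped: "\<bar>V a l\<bar> \<le> amp" "V a l > 0" if "a \<in> {1..amp}" for a
    using trapped_solution[OF T _ _ VW, of a l] that l by auto
  define Q where "Q = exp ((1 + lipc T) * l)"
  have Q: "Q \<ge> 0" by (simp add: Q_def)
  have dep: "(V a l - V a' l)\<^sup>2 + (W a l - W a' l)\<^sup>2 \<le> Q * (a - a')\<^sup>2" for a a'
    using tsol_dependence[OF VW(1)[of a] VW(1)[of a'] T0, of l] l VW by (simp add: Q_def)
  have lip: "\<bar>V a l - V a' l\<bar> \<le> sqrt Q * \<bar>a - a'\<bar>" "\<bar>W a l - W a' l\<bar> \<le> sqrt Q * \<bar>a - a'\<bar>" for a a'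
  proof -
    have "(V a l - V a' l)\<^sup>2 \<le> (sqrt Q * \<bar>a - a'\<bar>)\<^sup>2" "(W a l - W a' l)\<^sup>2 \<le> (sqrt Q * \<bar>a - a'\<bar>)\<^sup>2"
      using dep[of a a'] Q by (auto simp: power_mult_distrib intro: order_trans[rotated])
    then show "\<bar>V a l - V a' l\<bar> \<le> sqrt Q * \<bar>a - a'\<bar>" "\<bar>W a l - W a' l\<bar> \<le> sqrt Q * \<bar>a - a'\<bar>"
      using Q by (auto intro!: power2_le_imp_le[of "\<bar>_\<bar>"])
  qed
  have contV: "continuous_on {1..amp} (\<lambda>a. V a l)" "continuous_on {1..amp} (\<lambda>a. W a l)"
    by (rule lipschitz_on_continuous_on[of "sqrt Q"], use lip Q in \<open>auto simp: lipschitz_on_def dist_real_def\<close>)+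
  \<comment> \<open>Up to sign, the total outgoing slope of \<open>N\<close> compact edges and one
    decreasing soliton tail that meet at height \<open>V a l\<close>.\<close>
  define F where "F a = N * W a l + V a l * sqrt (1 - 2 / p * V a l powr (p - 2))" for a
  have contF: "continuous_on {1..amp} F"
    unfolding F_def using trapped(2) by (intro continuous_intros contV) force+
  have one: "V 1 l = 1" "W 1 l = 0"
  proof -
    have "tsol T {0..} (\<lambda>x. 1) (\<lambda>x. 0)" using T amp_gt_1 by (simp add: tsol_def tnl_id)
    from tsol_unique[OF VW(1)[of 1] this T0, of l] VW l show "V 1 l = 1" "W 1 l = 0" by auto
  qed
  have F1: "F 1 \<ge> 0" unfolding F_def one using p_gt_2 by simp
  have top: "V amp l = soliton l" "W amp l = dsoliton l"
  proof -
    have "sol {0..} (\<lambda>x. soliton (x + 0)) (\<lambda>x. dsoliton (x + 0))" by (rule soliton_sol)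
    then have "sol {0..} soliton dsoliton" by simp
    then have "tsol T {0..} soliton dsoliton"
    proof (rule sol_imp_tsol)
      show "\<bar>soliton x\<bar> \<le> T" for x using soliton_le_amp[of x] soliton_pos[of x] T by linarith
    qed
    from tsol_unique[OF VW(1)[of amp] this T0, of l] VW l show "V amp l = soliton l" "W amp l = dsoliton l" by auto
  qed
  \<comment> \<open>For the soliton the square root is a tanh, and \<open>F amp\<close> is
    \<open>1 - N\<close> times a nonnegative number; this is where \<open>N \<ge> 1\<close>
    enters.\<close>
  have F2: "F amp \<le> 0"
  proof -
    let ?t = "tanh ((p - 2) / 2 * l)"
    have t: "?t \<ge> 0" using l p_gt_2 by simp
    have "1 - 2 / p * soliton l powr (p - 2) = ?t\<^sup>2"
    proof -
      have eq: "2 / p * (p / 2 * z) = z" for z using p_gt_2 by simp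
      show ?thesis unfolding soliton_powr eq by simp
    qed
    then have "sqrt (1 - 2 / p * soliton l powr (p - 2)) = ?t" using t by (simp only: real_sqrt_abs abs_of_nonneg)
    then have "F amp = (1 - N) * (soliton l * ?t)"
      unfolding F_def top dsoliton_def by (simp only: algebra_simps)
    then show ?thesis using N t soliton_pos[of l] by (simp add: mult_nonpos_nonneg)
  qed
  obtain a where a: "1 \<le> a" "a \<le> amp" "F a = 0"
    using IVT2'[OF F2 F1 _ contF] amp_gt_1 by auto
  show thesis by (rule that[OF a(1,2) VW]) (use a(3) in \<open>simp add: F_def\<close>)
qed

text \<open>Started at the vertex with data \<open>v l\<close> and \<open>- w l\<close>, the
  solution is \<open>v\<close> run backwards on \<open>{0..l}\<close> and then, by uniqueness from
  the point of rest \<open>l\<close>, \<open>v\<close> run forwards. Solving a single initial value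
  problem avoids gluing derivatives at \<open>l\<close>.\<close>

lemma reflected_edge_solution:
  assumes T: "T > amp" and l: "l > 0" and a: "1 \<le> a" "a \<le> amp"
    and s: "tsol T {0..} v w" and init: "v 0 = a" "w 0 = 0"
  obtains z y where "sol {0..2*l} z y" "z 0 = v l" "z (2 * l) = v l" "y 0 = - w l" "y (2 * l) = w l" "y l = 0"
proof -
  have T0: "T \<ge> 0" using T amp_gt_1 by simp
  obtain z y where zy: "tsol T {0..} z y" "z 0 = v l" "y 0 = - w l" using tsol_exists[OF T0] by blast
  have 1: "z x = v (l - x)" "y x = - w (l - x)" if x: "x \<in> {0..l}" for x
  proof -
    have r: "tsol T {0..l} (\<lambda>x. v (l - x)) (\<lambda>x. - w (l - x))" by (rule tsol_reflect[OF s]) auto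
    have sub: "{0..x} \<subseteq> {0..l}" using x by auto
    show "z x = v (l - x)" "y x = - w (l - x)"
      using tsol_unique[OF tsol_subset[OF zy(1), of "{0..l}"] r T0 sub] x zy by auto
  qed
  have 2: "z (l + x) = v x" "y (l + x) = w x" if x: "x \<ge> 0" for x
  proof -
    have r: "tsol T {0..} (\<lambda>x. z (l + x)) (\<lambda>x. y (l + x))" by (rule tsol_shift[OF zy(1)]) (use l in auto)
    show "z (l + x) = v x" "y (l + x) = w x"
      using tsol_unique[OF r s T0, of x] x 1[of l] l init by auto
  qed
  have "\<bar>z x\<bar> \<le> T" if "x \<in> {0..2*l}" for x
  proof (cases "x \<le> l")
    case True
    then show ?thesis using 1[of x] that trapped_solution(1)[OF T a s init, of "l - x"] T by simp
  next
    case False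
    then show ?thesis using 2[of "x - l"] that trapped_solution(1)[OF T a s init, of "x - l"] T by simp
  qed
  then have "sol {0..2*l} z y" by (intro tsol_imp_sol[OF tsol_subset[OF zy(1)]]) auto
  then show thesis using that[of z y] zy 1[of l] 2[of l] l init by simp
qed

end

lemma sum_signs: "(\<Sum>i<m + k. if i < m then - d else d) = (real k - real m) * d" for d :: real
  by (induction k) (simp_all add: algebra_simps sum_negf)

context knot
begin

lemma bound_state_build:
  assumes c: "c > 0" and ys: "\<And>i. i < H \<Longrightarrow> soliton (ys i) = c"
    and zy: "P + L \<ge> 1 \<Longrightarrow> sol {0..2*l} z y \<and> z 0 = c \<and> z (2 * l) = c \<and> y l = 0 \<and> y (2 * l) = - y 0"
    and kirchhoff: "(\<Sum>i<H. dsoliton (ys i)) + (real P + 2 * real L) * y 0 = 0"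
  shows "\<exists>u w. strong u w \<and> nontriv u"
proof -
  define u where "u = (\<lambda>e. case e of Half i \<Rightarrow> (\<lambda>x. soliton (x + ys i)) | _ \<Rightarrow> z)"
  define w where "w = (\<lambda>e. case e of Half i \<Rightarrow> (\<lambda>x. dsoliton (x + ys i)) | _ \<Rightarrow> y)"
  have zy': "sol {0..2*l} z y" "sol {0..l} z y" "z 0 = c" "z (2 * l) = c" "y l = 0" "y (2 * l) = - y 0"
    if "i < P \<or> i < L" for i
  proof -
    have "P + L \<ge> 1" using that by linarith
    then show "sol {0..2*l} z y" "z 0 = c" "z (2 * l) = c" "y l = 0" "y (2 * l) = - y 0" using zy by blast+
    then show "sol {0..l} z y" by (rule_tac sol_subset[of "{0..2*l}"]) (use l_pos in auto)
  qed
  have s: "sol (edom l e) (u e) (w e)" if "e \<in> edges H P L" for e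
    using that soliton_sol zy' by (cases e) (auto simp: u_def w_def)
  have "H1_edge (edom l e) (u e) (w e)" if e: "e \<in> edges H P L" for e
  proof (cases "\<exists>i. e = Half i")
    case True
    then show ?thesis using soliton_H1 by (auto simp: u_def w_def)
  next
    case False
    then obtain b where b: "edom l e = {0..b}" by (cases e) auto
    show ?thesis
    proof (rule sol_H1_edge[OF edge_interval_edom s[OF e]])
      show "set_integrable lborel (edom l e) (\<lambda>t. (u e t)\<^sup>2)" "set_integrable lborel (edom l e) (\<lambda>t. (w e t)\<^sup>2)"
        unfolding b
        by (intro borel_integrable_atLeastAtMost' continuous_intros sol_continuous[OF s[OF e], unfolded b])+
    qed
  qed
  moreover have "u e 0 = c" if "e \<in> edges H P L" for e
    using that ys zy'(3) by (cases e) (auto simp: u_def)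
  moreover have "u (Loop i) (2 * l) = c" if "i < L" for i using zy'(4)[of i] that by (simp add: u_def)
  ultimately have "H1_graph H P L l u w" by (rule H1_graphI)
  moreover have "flux w = 0"
  proof -
    have "flux w = (\<Sum>i<H. dsoliton (ys i)) + (\<Sum>i<P. y 0) + (\<Sum>i<L. 2 * y 0)"
    proof -
      have "(\<Sum>i<L. y 0 - y (2 * l)) = (\<Sum>i<L. 2 * y 0)"
      proof (rule sum.cong)
        fix i assume "i \<in> {..<L}"
        then show "y 0 - y (2 * l) = 2 * y 0" using zy'(6)[of i] by simp
      qed simp
      then show ?thesis unfolding flux_def w_def by simp
    qed
    then show ?thesis using kirchhoff by (simp add: algebra_simps)
  qed
  moreover have "w (Pend i) l = 0" if "i < P" for i using zy'(5)[of i] that by (simp add: w_def)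
  ultimately have "strong u w" using s by (simp add: strong_def)
  moreover have "nontriv u"
    unfolding nontriv_def
  proof (intro bexI[of _ "Half 0"] bexI[of _ 0])
    show "u (Half 0) 0 \<noteq> 0" using ys[of 0] H_pos c by (simp add: u_def)
  qed (use H_pos in auto)
  ultimately show ?thesis by blast
qed

text \<open>Shifts \<open>r\<close> and \<open>- r\<close> of the soliton have equal height and
  opposite slopes, so half-lines cancel in pairs. If \<open>H\<close> is even, the constant 1 fills
  the compact edges; if \<open>H\<close> is odd, the one tail left over is balanced by the matched
  compact edges. Without compact edges every half-line carries half a soliton with its maximum at
  the vertex.\<close>

lemma strong_exists: "\<exists>u w. strong u w \<and> nontriv u"
proof (cases "P + L = 0")
  case True
  show ?thesis
    by (rule bound_state_build[of amp "\<lambda>i. 0" "\<lambda>x. 0" "\<lambda>x. 0"]) (use True amp_gt_1 in auto)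
next
  case PL: False
  show ?thesis
  proof (cases "even H")
    case True
    then obtain m where m: "H = m + m" by (metis evenE mult_2)
    obtain y where y: "soliton y = 1" using soliton_hits[of 1] amp_gt_1 by auto
    have "(\<Sum>i<H. dsoliton (if i < m then - y else y)) = (\<Sum>i<m + m. if i < m then - dsoliton y else dsoliton y)"
      unfolding m by (rule sum.cong) auto
    also have "\<dots> = 0" by (simp add: sum_signs)
    finally show ?thesis
      by (intro bound_state_build[of 1 "\<lambda>i. if i < m then - y else y" "\<lambda>x. 1" "\<lambda>x. 0"])
        (use y in \<open>auto simp: sol_def\<close>)
  next
    case False
    then obtain m where m: "H = m + Suc m" by (metis oddE mult_2 Suc_eq_plus1 add_Suc_right)
    define N where "N = real P + 2 * real L"
    have N: "N \<ge> 1" using PL unfolding N_def by linarith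
    define T where "T = amp + 1"
    have T: "T > amp" by (simp add: T_def)
    obtain a v w where a: "1 \<le> a" "a \<le> amp" and s: "tsol T {0..} v w" and init: "v 0 = a" "w 0 = 0"
      and match: "N * w l + v l * sqrt (1 - 2 / p * v l powr (p - 2)) = 0"
      using matched_edge_solution[OF N l_pos T] by metis
    have c: "v l > 0" "v l \<le> amp" using trapped_solution[OF T a s init, of l] l_pos by auto
    obtain z y where zy: "sol {0..2*l} z y" "z 0 = v l" "z (2 * l) = v l" "y 0 = - w l" "y (2 * l) = w l" "y l = 0"
      using reflected_edge_solution[OF T l_pos a s init] by metis
    obtain r where r: "r \<ge> 0" "soliton r = v l" using soliton_hits[OF c] by auto
    have slope: "dsoliton r = - (v l * sqrt (1 - 2 / p * v l powr (p - 2)))"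
    proof -
      have eq: "2 / p * (p / 2 * z) = z" for z using p_gt_2 by simp
      have "tanh ((p - 2) / 2 * r) \<ge> 0" using r p_gt_2 by simp
      then show ?thesis unfolding r(2)[symmetric] soliton_powr eq dsoliton_def by simp
    qed
    have "(\<Sum>i<H. dsoliton (if i < m then - r else r)) = (\<Sum>i<m + Suc m. if i < m then - dsoliton r else dsoliton r)"
      unfolding m by (rule sum.cong) auto
    also have "\<dots> = dsoliton r" by (subst sum_signs) (simp add: algebra_simps)
    finally have "(\<Sum>i<H. dsoliton (if i < m then - r else r)) + N * y 0 = 0"
      using match slope zy(4) by simp
    then show ?thesis
      by (intro bound_state_build[of "v l" "\<lambda>i. if i < m then - r else r" z y])
        (use r c zy in \<open>auto simp: N_def\<close>)
  qed
qed

end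

section \<open>Minimisation\<close>

lemma finite_family_convergent_subseq:
  fixes X :: "nat \<Rightarrow> 'e \<Rightarrow> 'a::heine_borel"
  assumes "finite A" "\<And>e. e \<in> A \<Longrightarrow> bounded (range (\<lambda>n. X n e))"
  shows "\<exists>r. strict_mono r \<and> (\<forall>e\<in>A. convergent (\<lambda>n. X (r n) e))"
  using assms
proof (induction A)
  case empty
  show ?case by (auto intro: strict_mono_id)
next
  case (insert a A)
  then obtain r where r: "strict_mono r" "\<And>e. e \<in> A \<Longrightarrow> convergent (\<lambda>n. X (r n) e)" by auto
  have "bounded (range (\<lambda>n. X (r n) a))"
    using insert.prems[of a] by (auto intro: bounded_subset)
  then obtain x r' where r': "strict_mono r'" "((\<lambda>n. X (r n) a) \<circ> r') \<longlonglongrightarrow> x"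
    using bounded_imp_convergent_subsequence by blast
  show ?case
  proof (intro exI[of _ "r \<circ> r'"] conjI ballI)
    show "strict_mono (r \<circ> r')" using r(1) r'(1) by (rule strict_mono_o)
    fix e assume "e \<in> insert a A"
    then consider "e = a" | "e \<in> A" by auto
    then show "convergent (\<lambda>n. X ((r \<circ> r') n) e)"
    proof cases
      case 1
      then show ?thesis using r'(2) by (auto simp: convergent_def o_def)
    next
      case 2
      then obtain y where "(\<lambda>n. X (r n) e) \<longlonglongrightarrow> y" using r(2) by (auto simp: convergent_def)
      from LIMSEQ_subseq_LIMSEQ[OF this r'(1)] show ?thesis by (auto simp: convergent_def o_def)
    qed
  qed
qed

text \<open>Constant bounds \<open>B\<close> serve to make the limit integrable; varying bounds give
  lower semicontinuity along a convergent sequence of integrals.\<close>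

lemma fatou_pointwise_limit:
  fixes f :: "nat \<Rightarrow> real \<Rightarrow> real"
  assumes S: "S \<in> sets borel" and f: "\<And>n. set_integrable lborel S (f n)"
    and nn: "\<And>n x. x \<in> S \<Longrightarrow> f n x \<ge> 0"
    and lim: "\<And>x. x \<in> S \<Longrightarrow> (\<lambda>n. f n x) \<longlonglongrightarrow> g x"
    and le: "\<And>n. (LBINT x:S. f n x) \<le> B n" and B: "B \<longlonglongrightarrow> \<beta>"
  shows "set_integrable lborel S g" "(LBINT x:S. g x) \<le> \<beta>"
proof -
  define F where "F n x = indicator S x *\<^sub>R f n x" for n x
  define G where "G x = indicator S x *\<^sub>R g x" for x
  have F: "integrable lborel (F n)" "F n x \<ge> 0" for n x
    using f[of n] nn by (auto simp: set_integrable_def F_def[abs_def] indicator_def)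
  have FG: "(\<lambda>n. F n x) \<longlonglongrightarrow> G x" for x
    using lim by (auto simp: F_def G_def indicator_def)
  have G0: "G x \<ge> 0" for x by (rule LIMSEQ_le_const[OF FG]) (use F in auto)
  have Gm: "G \<in> borel_measurable lborel"
    by (rule borel_measurable_LIMSEQ_real[OF FG]) (rule borel_measurable_integrable[OF F(1)])
  have B0: "B n \<ge> 0" for n
  proof -
    have "0 \<le> integral\<^sup>L lborel (F n)" using F(2) by simp
    also have "\<dots> \<le> B n" using le[of n] by (simp add: F_def[abs_def] set_lebesgue_integral_def)
    finally show ?thesis .
  qed
  have \<beta>0: "\<beta> \<ge> 0" by (rule LIMSEQ_le_const[OF B]) (use B0 in auto)
  have "(\<integral>\<^sup>+x. ennreal (G x) \<partial>lborel) = (\<integral>\<^sup>+x. liminf (\<lambda>n. ennreal (F n x)) \<partial>lborel)"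
  proof (rule nn_integral_cong)
    fix x
    have "(\<lambda>n. ennreal (F n x)) \<longlonglongrightarrow> ennreal (G x)" by (rule tendsto_ennrealI[OF FG])
    then show "ennreal (G x) = liminf (\<lambda>n. ennreal (F n x))"
      by (rule lim_imp_Liminf[OF trivial_limit_sequentially, symmetric])
  qed
  also have "\<dots> \<le> liminf (\<lambda>n. \<integral>\<^sup>+x. ennreal (F n x) \<partial>lborel)"
    by (rule nn_integral_liminf) (use borel_measurable_integrable[OF F(1)] in auto)
  also have "\<dots> \<le> liminf (\<lambda>n. ennreal (B n))"
  proof (intro Liminf_mono always_eventually allI)
    fix n
    have "(\<integral>\<^sup>+x. ennreal (F n x) \<partial>lborel) = ennreal (integral\<^sup>L lborel (F n))"
      by (rule nn_integral_eq_integral) (use F in auto)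
    then show "(\<integral>\<^sup>+x. ennreal (F n x) \<partial>lborel) \<le> ennreal (B n)"
      using le[of n] by (simp add: F_def[abs_def] set_lebesgue_integral_def ennreal_leI)
  qed
  also have "\<dots> = ennreal \<beta>"
    by (rule lim_imp_Liminf[OF trivial_limit_sequentially tendsto_ennrealI[OF B]])
  finally have fin: "(\<integral>\<^sup>+x. ennreal (G x) \<partial>lborel) \<le> ennreal \<beta>" .
  then have "(\<integral>\<^sup>+x. ennreal (norm (G x)) \<partial>lborel) < \<infinity>"
    using G0 by (simp add: le_less_trans[OF _ ennreal_less_top])
  with Gm have Gi: "integrable lborel G" by (rule integrableI_bounded)
  then show "set_integrable lborel S g" by (simp add: set_integrable_def G_def[abs_def])
  have "ennreal (integral\<^sup>L lborel G) \<le> ennreal \<beta>"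
    using fin nn_integral_eq_integral[OF Gi] G0 by simp
  then have "integral\<^sup>L lborel G \<le> \<beta>" using \<beta>0 by simp
  then show "(LBINT x:S. g x) \<le> \<beta>" by (simp add: set_lebesgue_integral_def G_def[abs_def])
qed

text \<open>The minimum of \<open>z\<^sup>2\<close> is at most its average, and away from the
  minimum point \<open>z\<^sup>2\<close> grows by at most the integral of
  \<open>\<bar>2 * (z x * z' x)\<bar>\<close>. The second claim has no derivative in its bound, so
  it can be applied to the slope of a solution.\<close>

lemma square_le_H1_norm:
  fixes z z' :: "real \<Rightarrow> real"
  assumes l: "l > 0" and d: "\<And>x. x \<in> {a..a+l} \<Longrightarrow> (z has_real_derivative z' x) (at x within {a..a+l})"
    and c: "continuous_on {a..a+l} z'" and x: "x \<in> {a..a+l}"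
  shows "(z x)\<^sup>2 \<le> (1 / l + 1) * (LBINT x:{a..a+l}. (z' x)\<^sup>2 + (z x)\<^sup>2)"
    "\<exists>y\<in>{a..a+l}. (z y)\<^sup>2 \<le> 1 / l * (LBINT x:{a..a+l}. (z x)\<^sup>2)"
proof -
  let ?I = "{a..a+l}"
  have cz: "continuous_on ?I z" using d by (rule DERIV_continuous_on)
  have i: "set_integrable lborel ?I (\<lambda>x. (z x)\<^sup>2)" "set_integrable lborel ?I (\<lambda>x. (z' x)\<^sup>2 + (z x)\<^sup>2)"
    by (intro borel_integrable_atLeastAtMost' continuous_intros cz c)+
  have "continuous_on ?I (\<lambda>t. (z t)\<^sup>2)" by (intro continuous_intros cz)
  moreover have "?I \<noteq> {}" using l by simp
  ultimately obtain y where y: "y \<in> ?I" "\<And>t. t \<in> ?I \<Longrightarrow> (z y)\<^sup>2 \<le> (z t)\<^sup>2"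
    using continuous_attains_inf[OF compact_Icc] by blast
  have "l * (z y)\<^sup>2 = (LBINT t:?I. (z y)\<^sup>2)" using l by (simp add: set_integral_const)
  also have "\<dots> \<le> (LBINT t:?I. (z t)\<^sup>2)"
    using y(2) by (intro set_integral_mono i(1) borel_integrable_atLeastAtMost') auto
  finally have zy: "(z y)\<^sup>2 \<le> 1 / l * (LBINT x:?I. (z x)\<^sup>2)" using l by (simp add: field_simps)
  then show "\<exists>y\<in>?I. (z y)\<^sup>2 \<le> 1 / l * (LBINT x:?I. (z x)\<^sup>2)" using y by blast
  define k where "k t = (z' t)\<^sup>2 + (z t)\<^sup>2" for t
  have ck: "continuous_on ?I k" unfolding k_def by (intro continuous_intros cz c)
  define K where "K t = integral {a..t} k" for t
  have dK: "(K has_real_derivative k t) (at t within ?I)" if "t \<in> ?I" for t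
    unfolding K_def[abs_def] has_real_derivative_iff_has_vector_derivative
    by (rule integral_has_vector_derivative[OF ck that])
  have Ka: "K a = 0" by (simp add: K_def)
  have Kl: "K (a + l) = (LBINT x:?I. (z' x)\<^sup>2 + (z x)\<^sup>2)"
    unfolding K_def k_def by (rule set_borel_integral_eq_integral(2)[OF i(2), symmetric])
  have Kmono: "K s \<le> K t" if "a \<le> s" "s \<le> t" "t \<le> a + l" for s t
    by (rule nonneg_derivative_within_imp_mono[OF dK _ that]) (auto simp: k_def)
  have am: "\<bar>2 * (z t * z' t)\<bar> \<le> k t" for t
    using sum_squares_bound[of "\<bar>z t\<bar>" "\<bar>z' t\<bar>"] by (simp add: k_def abs_mult)
  have "(z x)\<^sup>2 \<le> (z y)\<^sup>2 + K (a + l)"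
  proof (cases "y \<le> x")
    case True
    have "(z x)\<^sup>2 - K x \<le> (z y)\<^sup>2 - K y"
    proof (rule nonpos_derivative_within_imp_antimono[where a = a and b = "a + l" and f = "\<lambda>t. (z t)\<^sup>2 - K t"])
      fix t assume t: "t \<in> ?I"
      show "((\<lambda>t. (z t)\<^sup>2 - K t) has_real_derivative 2 * (z t * z' t) - k t) (at t within ?I)"
        using d[OF t] dK[OF t] by (auto intro!: derivative_eq_intros)
      show "2 * (z t * z' t) - k t \<le> 0" using am[of t] by linarith
    qed (use True x y in auto)
    moreover have "K x \<le> K (a + l)" "0 \<le> K y" using Kmono[of x "a + l"] Kmono[of a y] Ka x y by auto
    ultimately show ?thesis by linarith
  next
    case False
    have "(z x)\<^sup>2 + K x \<le> (z y)\<^sup>2 + K y"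
    proof (rule nonneg_derivative_within_imp_mono[where a = a and b = "a + l" and f = "\<lambda>t. (z t)\<^sup>2 + K t"])
      fix t assume t: "t \<in> ?I"
      show "((\<lambda>t. (z t)\<^sup>2 + K t) has_real_derivative 2 * (z t * z' t) + k t) (at t within ?I)"
        using d[OF t] dK[OF t] by (auto intro!: derivative_eq_intros)
      show "0 \<le> 2 * (z t * z' t) + k t" using am[of t] by linarith
    qed (use False x y in auto)
    moreover have "K y \<le> K (a + l)" "0 \<le> K x" using Kmono[of y "a + l"] Kmono[of a x] Ka x y by auto
    ultimately show ?thesis by linarith
  qed
  also have "(z y)\<^sup>2 \<le> 1 / l * K (a + l)"
  proof -
    have "(LBINT x:?I. (z x)\<^sup>2) \<le> K (a + l)" unfolding Kl by (intro set_integral_mono i) simp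
    then show ?thesis using zy l by (meson divide_nonneg_pos mult_left_mono order_trans zero_le_one)
  qed
  finally show "(z x)\<^sup>2 \<le> (1 / l + 1) * (LBINT x:?I. (z' x)\<^sup>2 + (z x)\<^sup>2)"
    unfolding Kl by (simp add: distrib_right)
qed

section \<open>A priori bounds and passage to the limit\<close>

context knot
begin

definition sup_bound :: "real \<Rightarrow> real" where "sup_bound M = sqrt ((1 / l + 1) * M)"

lemma edge_norm_le_mass:
  assumes s: "strong u w" "nontriv u" and e: "e \<in> edges H P L"
  shows "(LBINT x:edom l e. (w e x)\<^sup>2 + (u e x)\<^sup>2) \<le> mass u" "(LBINT x:edom l e. \<bar>u e x\<bar> powr p) \<le> mass u"
proof -
  have nn: "0 \<le> (LBINT x:S. f x)" if "\<And>x. f x \<ge> 0" for f :: "real \<Rightarrow> real" and S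
    unfolding set_lebesgue_integral_def using that by (intro Bochner_Integration.integral_nonneg) (auto simp: indicator_def)
  have m: "mass u = (\<Sum>e\<in>edges H P L. LBINT x:edom l e. (w e x)\<^sup>2 + (u e x)\<^sup>2)"
    using bound_state_nehari(1)[OF strong_imp_bound_state[OF s]] by (simp add: graph_int_def)
  show "(LBINT x:edom l e. (w e x)\<^sup>2 + (u e x)\<^sup>2) \<le> mass u"
    unfolding m by (rule member_le_sum[OF e _ finite_edges]) (auto intro!: nn)
  show "(LBINT x:edom l e. \<bar>u e x\<bar> powr p) \<le> mass u"
    unfolding mass_def graph_int_def by (rule member_le_sum[OF e _ finite_edges]) (auto intro!: nn)
qed

lemma strong_bounds:
  assumes s: "strong u w" "nontriv u" and M: "mass u \<le> M" and e: "e \<in> edges H P L"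
  shows "x \<in> edom l e \<Longrightarrow> \<bar>u e x\<bar> \<le> sup_bound M"
    "(w e 0)\<^sup>2 \<le> 1 / l * M + (sup_bound M)\<^sup>2 + 2 / p * sup_bound M powr p"
proof -
  have g: "H1_graph H P L l u w" and se: "sol (edom l e) (u e) (w e)" using s e by (auto simp: strong_def)
  note h = H1_graphD(1)[OF g e]
  have int: "set_integrable lborel (edom l e) (\<lambda>x. (w e x)\<^sup>2 + (u e x)\<^sup>2)"
    "set_integrable lborel (edom l e) (\<lambda>x. (w e x)\<^sup>2)"
    using H1_edgeD(3,4)[OF h] by (auto intro: set_integral_add)
  have sub_int: "(LBINT x:S. f x) \<le> M"
    if S: "S \<subseteq> edom l e" "S \<in> sets borel" and f: "\<And>x. 0 \<le> f x" "\<And>x. f x \<le> (w e x)\<^sup>2 + (u e x)\<^sup>2" for S f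
  proof -
    have "(LBINT x:S. f x) \<le> (LBINT x:edom l e. (w e x)\<^sup>2 + (u e x)\<^sup>2)"
      unfolding set_lebesgue_integral_def
      by (rule integral_mono') (use S f int(1) in \<open>auto simp: set_integrable_def indicator_def\<close>)
    then show ?thesis using edge_norm_le_mass(1)[OF s e] M by linarith
  qed
  have sup: "\<bar>u e x\<bar> \<le> sup_bound M" if x: "x \<in> edom l e" for x
  proof -
    \<comment> \<open>A window of length \<open>l\<close> containing \<open>x\<close> fits into
      every edge, so one constant serves all edges.\<close>
    obtain a where a: "x \<in> {a..a+l}" "{a..a+l} \<subseteq> edom l e"
    proof (cases e)
      case (Half i)
      then show thesis using that[of x] x l_pos by auto
    next
      case (Pend i)
      then show thesis using that[of 0] x l_pos by auto
    next
      case (Loop i)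
      then show thesis using that[of 0] that[of l] x l_pos by (cases "x \<le> l") auto
    qed
    have s': "sol {a..a+l} (u e) (w e)" using sol_subset[OF se a(2)] .
    have "(u e x)\<^sup>2 \<le> (1 / l + 1) * (LBINT x:{a..a+l}. (w e x)\<^sup>2 + (u e x)\<^sup>2)"
      by (rule square_le_H1_norm(1)[OF l_pos _ sol_continuous(2)[OF s'] a(1)]) (use s' in \<open>auto simp: sol_def\<close>)
    also have "\<dots> \<le> (1 / l + 1) * M"
      using l_pos by (intro mult_left_mono sub_int[OF a(2)]) auto
    finally have "sqrt ((u e x)\<^sup>2) \<le> sup_bound M" unfolding sup_bound_def by (rule real_sqrt_le_mono)
    then show ?thesis by simp
  qed
  then show "x \<in> edom l e \<Longrightarrow> \<bar>u e x\<bar> \<le> sup_bound M" .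
  let ?T = "sup_bound M"
  have sub: "{0..0+l} \<subseteq> edom l e" using l_pos by (cases e) auto
  have s': "sol {0..0+l} (u e) (w e)" using sol_subset[OF se sub] .
  \<comment> \<open>Averaging bounds the slope at some point of \<open>{0..0+l}\<close>, and energy
    conservation carries the bound to the vertex.\<close>
  obtain y where y: "y \<in> {0..0+l}" "(w e y)\<^sup>2 \<le> 1 / l * (LBINT x:{0..0+l}. (w e x)\<^sup>2)"
    using square_le_H1_norm(2)[OF l_pos, of 0 "w e" "\<lambda>x. u e x - nl (u e x)" 0] s' l_pos
      continuous_on_diff[OF sol_continuous(1)[OF s'] continuous_nl[OF sol_continuous(1)[OF s']]]
    by (auto simp: sol_def)
  have "1 / l * (LBINT x:{0..0+l}. (w e x)\<^sup>2) \<le> 1 / l * M"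
    using l_pos by (intro mult_left_mono sub_int[OF sub]) auto
  with y(2) have wy: "(w e y)\<^sup>2 \<le> 1 / l * M" by linarith
  have "(w e 0)\<^sup>2 / 2 - pot (u e 0) = (w e y)\<^sup>2 / 2 - pot (u e y)"
    by (rule sol_energy[OF s']) (use y l_pos in auto)
  moreover have "pot (u e 0) \<le> ?T\<^sup>2 / 2"
  proof -
    have "0 \<in> edom l e" using sub l_pos by (rule_tac subsetD) auto
    then have "(u e 0)\<^sup>2 \<le> ?T\<^sup>2" using power_mono[OF sup[of 0], of 2] by simp
    moreover have "\<bar>u e 0\<bar> powr p / p \<ge> 0" using p_gt_2 by simp
    ultimately show ?thesis unfolding pot_def by linarith
  qed
  moreover have "- pot (u e y) \<le> ?T powr p / p"
  proof -
    have "\<bar>u e y\<bar> powr p / p \<le> ?T powr p / p"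
      using sup[of y] sub y(1) p_gt_2 by (intro divide_right_mono powr_mono2) auto
    moreover have "(u e y)\<^sup>2 / 2 \<ge> 0" by simp
    ultimately show ?thesis unfolding pot_def by linarith
  qed
  ultimately have "(w e 0)\<^sup>2 \<le> 1 / l * M + ?T\<^sup>2 + 2 * (?T powr p / p)" using wy by linarith
  then show "(w e 0)\<^sup>2 \<le> 1 / l * M + ?T\<^sup>2 + 2 / p * ?T powr p" by simp
qed

text \<open>On a star graph the half-lines carry shifts \<open>soliton (x + y\<^sub>i)\<close> with common \<open>\<bar>y\<^sub>i\<bar>\<close>, and the
  Kirchhoff condition balances the tails, so that all bound states have the same mass.\<close>
lemma star_mass:
  assumes PL: "P = 0" "L = 0" and s: "strong u w" "nontriv u"
  shows "mass u = real H / 2 * (LINT x|lborel. soliton x powr p)"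
proof -
  have pos: "mass u = real H / 2 * (LINT x|lborel. soliton x powr p)"
    if s: "strong u w" and c: "u (Half 0) 0 > 0" for u w
  proof -
    define c where "c = u (Half 0) 0"
    have "\<exists>y. soliton y = c \<and> dsoliton y = w (Half i) 0 \<and> (\<forall>x\<ge>0. u (Half i) x = soliton (x + y))" if i: "i < H" for i
    proof -
      have "u (Half i) 0 = c" using strongD(6)[OF s i] by (simp add: c_def)
      then show ?thesis
        using halfline_sol_soliton[OF strongD(1,2)[OF s i]] \<open>u (Half 0) 0 > 0\<close> unfolding c_def by metis
    qed
    then obtain y where y: "\<And>i. i < H \<Longrightarrow> soliton (y i) = c" "\<And>i. i < H \<Longrightarrow> dsoliton (y i) = w (Half i) 0"
      "\<And>i x. i < H \<Longrightarrow> x \<ge> 0 \<Longrightarrow> u (Half i) x = soliton (x + y i)" by metis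
    define \<Phi> where "\<Phi> r = (LBINT x:{0..}. soliton (x + r) powr p)" for r
    define K where "K = (LINT x|lborel. soliton x powr p)"
    have \<Phi>: "\<Phi> r + \<Phi> (- r) = K" for r using soliton_tail_sum[of r] by (simp add: \<Phi>_def K_def)
    have "(LBINT x:{0..}. \<bar>u (Half i) x\<bar> powr p) = \<Phi> (y i)" if "i < H" for i
      unfolding \<Phi>_def using y(3)[OF that] soliton_pos
      by (intro set_lebesgue_integral_cong) (auto simp: less_imp_le)
    then have mass: "mass u = (\<Sum>i<H. \<Phi> (y i))"
      unfolding mass_def graph_int_def sum_edges using PL by simp
    have "(\<Sum>i<H. w (Half i) 0) + (\<Sum>i<P. w (Pend i) 0) + (\<Sum>i<L. w (Loop i) 0 - w (Loop i) (2 * l)) = 0"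
      using strongD(10)[OF s] by (simp only: flux_def)
    then have flux: "(\<Sum>i<H. dsoliton (y i)) = 0" using y(2) PL by simp
    define r where "r = \<bar>y 0\<bar>"
    have inj: "\<bar>s\<bar> = \<bar>t\<bar>" if "soliton s = soliton t" for s t
    proof -
      let ?q = "(p - 2) / 2"
      have sol_abs: "soliton \<bar>x\<bar> = soliton x" "dsoliton \<bar>x\<bar> \<le> 0" for x
      proof -
        show "soliton \<bar>x\<bar> = soliton x" by (cases "x \<ge> 0") auto
        have "tanh (?q * \<bar>x\<bar>) \<ge> 0" using p_gt_2 by simp
        then show "dsoliton \<bar>x\<bar> \<le> 0" using soliton_pos[of "\<bar>x\<bar>"] by (simp add: dsoliton_def)
      qed
      have "(dsoliton \<bar>s\<bar>)\<^sup>2 = (dsoliton \<bar>t\<bar>)\<^sup>2" using that by (simp add: dsoliton_square sol_abs)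
      then have "dsoliton \<bar>s\<bar> = dsoliton \<bar>t\<bar>" using sol_abs(2)[of s] sol_abs(2)[of t] by (auto simp: power2_eq_iff)
      then have "tanh (?q * \<bar>s\<bar>) = tanh (?q * \<bar>t\<bar>)"
        using that soliton_pos[of t] by (simp add: dsoliton_def sol_abs)
      then show ?thesis using p_gt_2 by simp
    qed
    have yr: "y i = r \<or> y i = - r" if "i < H" for i
    proof -
      have "\<bar>y i\<bar> = r" unfolding r_def using y(1)[OF that] y(1)[of 0] H_pos by (intro inj) simp
      then show ?thesis by (auto simp: abs_if split: if_splits)
    qed
    have "(\<Sum>i<H. \<Phi> (y i)) = real H / 2 * K"
    proof (cases "r = 0")
      case True
      then have "(\<Sum>i<H. \<Phi> (y i)) = (\<Sum>i<H. \<Phi> 0)" using yr by (intro sum.cong) auto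
      then show ?thesis using \<Phi>[of 0] by simp
    next
      case False
      then have d: "dsoliton r \<noteq> 0" using soliton_pos[of r] p_gt_2 by (simp add: dsoliton_def)
      \<comment> \<open>\<open>\<Phi> - K / 2\<close> and \<open>dsoliton\<close> are both odd,
        hence proportional on the two points \<open>r\<close> and \<open>- r\<close>. The slopes add
        up to zero, so the values of \<open>\<Phi> - K / 2\<close> do too.\<close>
      have h: "\<Phi> (- r) - K / 2 = - (\<Phi> r - K / 2)" using \<Phi>[of r] by linarith
      have "(\<Phi> r - K / 2) * dsoliton (y i) = (\<Phi> (y i) - K / 2) * dsoliton r" if "i < H" for i
        using yr[OF that] by (elim disjE) (simp_all only: h soliton_minus mult_minus_left mult_minus_right)
      then have "(\<Phi> r - K / 2) * (\<Sum>i<H. dsoliton (y i)) = (\<Sum>i<H. \<Phi> (y i) - K / 2) * dsoliton r"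
        by (simp add: sum_distrib_left sum_distrib_right)
      then have "(\<Sum>i<H. \<Phi> (y i) - K / 2) = 0" using flux d by simp
      then show ?thesis by (simp add: sum_subtractf)
    qed
    then show ?thesis using mass by (simp add: K_def)
  qed
  consider "u (Half 0) 0 = 0" | "u (Half 0) 0 > 0" | "u (Half 0) 0 < 0" by linarith
  then show ?thesis
  proof cases
    case 1
    have "compact_small 1 u" unfolding compact_small_def using PL by simp
    then show ?thesis using compact_small_zero_imp_trivial[OF s(1) _ 1] s(2) by simp
  next
    case 2
    then show ?thesis by (rule pos[OF s(1)])
  next
    case 3
    then show ?thesis using pos[OF strong_minus[OF s(1)]] by (simp add: mass_def)
  qed
qed

text \<open>The limit is the solution of the initial value problem with the limiting data, truncated
  at the common bound \<open>T\<close>. Continuous dependence gives pointwise convergence, the limit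
  inherits the bound and so solves the original equation. Mass may escape along half-lines, hence
  only \<open>mass U \<le> m\<close>; convergence of the separate edge integrals lets Fatou's lemma
  be applied edge by edge. The last conclusion is what remains to be excluded if \<open>U\<close>
  vanishes.\<close>

lemma strong_limit:
  fixes u w :: "nat \<Rightarrow> edge \<Rightarrow> real \<Rightarrow> real"
  assumes s: "\<And>n. strong (u n) (w n)" "\<And>n. nontriv (u n)"
    and M: "\<And>n. mass (u n) \<le> M" and m: "(\<lambda>n. mass (u n)) \<longlonglongrightarrow> m"
    and conv: "\<And>e. e \<in> edges H P L \<Longrightarrow> convergent (\<lambda>n. u n e 0)"
      "\<And>e. e \<in> edges H P L \<Longrightarrow> convergent (\<lambda>n. w n e 0)"
      "\<And>e. e \<in> edges H P L \<Longrightarrow> convergent (\<lambda>n. LBINT x:edom l e. \<bar>u n e x\<bar> powr p)"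
  obtains U W where "strong U W" "mass U \<le> m"
    "\<And>d. d > 0 \<Longrightarrow> \<not> nontriv U \<Longrightarrow> \<exists>n. compact_small d (u n)"
proof -
  define T where "T = sup_bound M"
  have bd: "\<bar>u n e x\<bar> \<le> T" if "e \<in> edges H P L" "x \<in> edom l e" for n e x
    unfolding T_def by (rule strong_bounds(1)[OF s M that])
  have zero_mem: "0 \<in> edom l e" for e using l_pos by (cases e) auto
  have T0: "T \<ge> 0" using bd[of "Half 0" 0 0] H_pos by simp
  define a b where "a e = lim (\<lambda>n. u n e 0)" and "b e = lim (\<lambda>n. w n e 0)" for e
  have ab: "(\<lambda>n. u n e 0) \<longlonglongrightarrow> a e" "(\<lambda>n. w n e 0) \<longlonglongrightarrow> b e" if "e \<in> edges H P L" for e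
    using conv(1,2)[OF that] by (simp_all add: a_def b_def convergent_LIMSEQ_iff)
  have "\<exists>U W. tsol T {0..} U W \<and> U 0 = a e \<and> W 0 = b e" for e using tsol_exists[OF T0, of "a e" "b e"] by metis
  then obtain U W where UW: "\<And>e. tsol T {0..} (U e) (W e)" "\<And>e. U e 0 = a e" "\<And>e. W e 0 = b e" by metis
  have sub: "edom l e \<subseteq> {0..}" for e by (cases e) auto
  have us: "sol (edom l e) (u n e) (w n e)" if "e \<in> edges H P L" for n e
    using s(1)[of n] that by (simp add: strong_def)
  define D where "D n e = (u n e 0 - a e)\<^sup>2 + (w n e 0 - b e)\<^sup>2" for n e
  have D0: "(\<lambda>n. D n e) \<longlonglongrightarrow> 0" if e: "e \<in> edges H P L" for e
  proof -
    have "(\<lambda>n. D n e) \<longlonglongrightarrow> (a e - a e)\<^sup>2 + (b e - b e)\<^sup>2"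
      unfolding D_def by (intro tendsto_intros ab[OF e])
    then show ?thesis by simp
  qed
  have dep: "(u n e x - U e x)\<^sup>2 + (w n e x - W e x)\<^sup>2 \<le> exp ((1 + lipc T) * x) * D n e"
    if e: "e \<in> edges H P L" and x: "x \<in> edom l e" for n e x
  proof -
    have t: "tsol T (edom l e) (u n e) (w n e)"
      by (rule sol_imp_tsol[OF us[OF e] bd[OF e]])
    show ?thesis
      using tsol_dependence[OF t tsol_subset[OF UW(1) sub] T0] edge_interval_down[OF edge_interval_edom x]
      by (simp add: D_def UW)
  qed
  have pw: "(\<lambda>n. u n e x) \<longlonglongrightarrow> U e x" "(\<lambda>n. w n e x) \<longlonglongrightarrow> W e x" if e: "e \<in> edges H P L" and x: "x \<in> edom l e" for e x
  proof -
    define B where "B n = sqrt (exp ((1 + lipc T) * x) * D n e)" for n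
    have "B \<longlonglongrightarrow> sqrt (exp ((1 + lipc T) * x) * 0)"
      unfolding B_def by (intro tendsto_intros D0[OF e])
    then have lim: "B \<longlonglongrightarrow> 0" by simp
    have "(u n e x - U e x)\<^sup>2 \<le> exp ((1 + lipc T) * x) * D n e" "(w n e x - W e x)\<^sup>2 \<le> exp ((1 + lipc T) * x) * D n e" for n
      using dep[OF e x, of n] zero_le_power2[of "w n e x - W e x"] zero_le_power2[of "u n e x - U e x"] by linarith+
    then have nb: "norm (u n e x - U e x) \<le> B n" "norm (w n e x - W e x) \<le> B n" for n
      unfolding B_def real_norm_def by (intro real_le_rsqrt, simp)+
    have "(\<lambda>n. u n e x - U e x) \<longlonglongrightarrow> 0"
      by (rule Lim_null_comparison[OF always_eventually lim]) (use nb in simp)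
    moreover have "(\<lambda>n. w n e x - W e x) \<longlonglongrightarrow> 0"
      by (rule Lim_null_comparison[OF always_eventually lim]) (use nb in simp)
    ultimately show "(\<lambda>n. u n e x) \<longlonglongrightarrow> U e x" "(\<lambda>n. w n e x) \<longlonglongrightarrow> W e x"
      by (simp_all add: LIM_zero_iff)
  qed
  have Ubd: "\<bar>U e x\<bar> \<le> T" if "e \<in> edges H P L" "x \<in> edom l e" for e x
    by (rule LIMSEQ_le_const2[OF tendsto_rabs[OF pw(1)[OF that]]]) (use bd[OF that] in auto)
  have Us: "sol (edom l e) (U e) (W e)" if "e \<in> edges H P L" for e
    by (rule tsol_imp_sol[OF tsol_subset[OF UW(1) sub] Ubd[OF that]])
  have meas: "edom l e \<in> sets borel" for e by (rule edge_interval_borel[OF edge_interval_edom])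
  have int: "set_integrable lborel (edom l e) (\<lambda>x. (U e x)\<^sup>2)" "set_integrable lborel (edom l e) (\<lambda>x. (W e x)\<^sup>2)"
    if e: "e \<in> edges H P L" for e
  proof -
    note h = H1_edgeD(3,4)[OF H1_graphD(1)[OF _ e]]
    have g: "H1_graph H P L l (u n) (w n)" for n using s(1)[of n] by (simp add: strong_def)
    have hu: "set_integrable lborel (edom l e) (\<lambda>x. (u n e x)\<^sup>2)"
      and hw: "set_integrable lborel (edom l e) (\<lambda>x. (w n e x)\<^sup>2)" for n
      using h[OF g[of n]] by auto
    have le: "(LBINT x:edom l e. (w n e x)\<^sup>2 + (u n e x)\<^sup>2) \<le> M" for n
      using edge_norm_le_mass(1)[OF s(1)[of n] s(2)[of n] e] M[of n] by linarith
    have "(LBINT x:edom l e. (u n e x)\<^sup>2) \<le> (LBINT x:edom l e. (w n e x)\<^sup>2 + (u n e x)\<^sup>2)"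
      "(LBINT x:edom l e. (w n e x)\<^sup>2) \<le> (LBINT x:edom l e. (w n e x)\<^sup>2 + (u n e x)\<^sup>2)" for n
      by (intro set_integral_mono set_integral_add hu hw; simp)+
    with le have le2: "(LBINT x:edom l e. (u n e x)\<^sup>2) \<le> M" "(LBINT x:edom l e. (w n e x)\<^sup>2) \<le> M" for n
      by (meson order_trans)+
    show "set_integrable lborel (edom l e) (\<lambda>x. (U e x)\<^sup>2)"
      by (rule fatou_pointwise_limit(1)[OF meas hu _ _ le2(1) tendsto_const])
        (auto intro!: tendsto_power pw[OF e])
    show "set_integrable lborel (edom l e) (\<lambda>x. (W e x)\<^sup>2)"
      by (rule fatou_pointwise_limit(1)[OF meas hw _ _ le2(2) tendsto_const])
        (auto intro!: tendsto_power pw[OF e])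
  qed
  have H0: "Half 0 \<in> edges H P L" using H_pos by simp
  have "H1_graph H P L l U W"
  proof (rule H1_graphI[where c = "U (Half 0) 0"])
    fix e assume e: "e \<in> edges H P L"
    show "H1_edge (edom l e) (U e) (W e)" by (rule sol_H1_edge[OF edge_interval_edom Us[OF e] int[OF e]])
    have "u n e 0 = u n (Half 0) 0" for n
    proof (rule H1_graphD(2)[OF _ e])
      show "H1_graph H P L l (u n) (w n)" using s(1)[of n] by (simp add: strong_def)
    qed
    then show "U e 0 = U (Half 0) 0"
      using LIMSEQ_unique[OF pw(1)[OF e zero_mem]] pw(1)[OF H0 zero_mem] by simp
  next
    fix i assume i: "i < L"
    have "(\<lambda>n. u n (Loop i) (2 * l)) \<longlonglongrightarrow> U (Loop i) (2 * l)" by (rule pw) (use i l_pos in auto)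
    then show "U (Loop i) (2 * l) = U (Half 0) 0"
      using pw(1)[OF H0 zero_mem] strongD(9)[OF s(1) i] LIMSEQ_unique by fastforce
  qed
  moreover have "W (Pend i) l = 0" if i: "i < P" for i
  proof -
    have "(\<lambda>n. w n (Pend i) l) \<longlonglongrightarrow> W (Pend i) l" by (rule pw) (use i l_pos in auto)
    then show ?thesis using strongD(5)[OF s(1) i] by (simp add: LIMSEQ_const_iff)
  qed
  moreover have "flux W = 0"
  proof -
    have "(\<lambda>n. flux (w n)) \<longlonglongrightarrow> flux W"
      unfolding flux_def by (intro tendsto_intros pw) (use l_pos in auto)
    then show ?thesis using strongD(10)[OF s(1)] by (simp add: LIMSEQ_const_iff)
  qed
  ultimately have strong: "strong U W" using Us by (simp add: strong_def)
  have "mass U \<le> m"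
  proof -
    define \<beta> where "\<beta> e = lim (\<lambda>n. LBINT x:edom l e. \<bar>u n e x\<bar> powr p)" for e
    have \<beta>: "(\<lambda>n. LBINT x:edom l e. \<bar>u n e x\<bar> powr p) \<longlonglongrightarrow> \<beta> e" if "e \<in> edges H P L" for e
      using conv(3)[OF that] by (simp add: \<beta>_def convergent_LIMSEQ_iff)
    have "(\<lambda>n. mass (u n)) \<longlonglongrightarrow> (\<Sum>e\<in>edges H P L. \<beta> e)"
      unfolding mass_def graph_int_def by (intro tendsto_sum \<beta>)
    then have mb: "m = (\<Sum>e\<in>edges H P L. \<beta> e)" using m LIMSEQ_unique by blast
    have "(LBINT x:edom l e. \<bar>U e x\<bar> powr p) \<le> \<beta> e" if e: "e \<in> edges H P L" for e
    proof (rule fatou_pointwise_limit(2)[OF meas _ _ _ order_refl \<beta>[OF e]])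
      fix n
      have "H1_edge (edom l e) (u n e) (w n e)" using H1_graphD(1)[OF _ e] s(1)[of n] by (simp add: strong_def)
      from H1_edge_integrable_nl[OF edge_interval_edom this this]
      show "set_integrable lborel (edom l e) (\<lambda>x. \<bar>u n e x\<bar> powr p)" by (simp add: nl_mult)
    next
      fix x assume x: "x \<in> edom l e"
      show "(\<lambda>n. \<bar>u n e x\<bar> powr p) \<longlonglongrightarrow> \<bar>U e x\<bar> powr p"
        by (rule tendsto_powr2[OF tendsto_rabs[OF pw(1)[OF e x]] tendsto_const]) (use p_gt_2 in auto)
    qed simp
    then show ?thesis unfolding mass_def graph_int_def mb by (rule sum_mono)
  qed
  moreover have "\<exists>n. compact_small d (u n)" if d: "d > 0" and triv: "\<not> nontriv U" for d
  proof -
    \<comment> \<open>The factor of continuous dependence at \<open>2 * l\<close>, the largest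
      coordinate on a compact edge; it bounds the factor on all of them.\<close>
    define R where "R = exp ((1 + lipc T) * (2 * l))"
    have "R > 0" by (simp add: R_def)
    have "\<forall>\<^sub>F n in sequentially. D n e < d\<^sup>2 / R" if "e \<in> edges H P L" for e
      by (rule order_tendstoD(2)[OF D0[OF that]]) (use d \<open>R > 0\<close> in simp)
    then have "\<forall>\<^sub>F n in sequentially. \<forall>e\<in>edges H P L. D n e < d\<^sup>2 / R"
      by (simp add: eventually_ball_finite_distrib finite_edges)
    then obtain n where n: "\<And>e. e \<in> edges H P L \<Longrightarrow> D n e < d\<^sup>2 / R"
      unfolding eventually_sequentially by blast
    have "\<bar>u n e x\<bar> < d" if e: "e \<in> edges H P L" and x: "x \<in> edom l e" "x \<le> 2 * l" for e x
    proof -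
      have "U e x = 0" using triv e x by (auto simp: nontriv_def)
      then have "(u n e x)\<^sup>2 + (w n e x - W e x)\<^sup>2 \<le> exp ((1 + lipc T) * x) * D n e"
        using dep[OF e x(1), of n] by simp
      then have "(u n e x)\<^sup>2 \<le> exp ((1 + lipc T) * x) * D n e"
        using zero_le_power2[of "w n e x - W e x"] by linarith
      also have "\<dots> \<le> R * D n e"
        using x(2) lipc_pos[of T] by (intro mult_right_mono) (auto simp: R_def D_def)
      also have "\<dots> < d\<^sup>2" using n[OF e] \<open>R > 0\<close> by (simp add: field_simps)
      finally have "\<bar>u n e x\<bar>\<^sup>2 < d\<^sup>2" by simp
      then show ?thesis using d by (intro power2_less_imp_less[of "\<bar>u n e x\<bar>" d]) auto
    qed
    then have "compact_small d (u n)" unfolding compact_small_def using l_pos by auto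
    then show ?thesis by blast
  qed
  ultimately show thesis using that strong by blast
qed

lemma mass_minimizer: "\<exists>U W. strong U W \<and> nontriv U \<and> (\<forall>u w. strong u w \<longrightarrow> nontriv u \<longrightarrow> mass U \<le> mass u)"
proof (cases "P + L = 0")
  case True
  obtain U W where "strong U W" "nontriv U" using strong_exists by blast
  moreover have "mass U \<le> mass u" if "strong u w" "nontriv u" for u w
    using star_mass[of U W] star_mass[OF _ _ that] True calculation by simp
  ultimately show ?thesis by blast
next
  case False
  then have "P + L \<ge> 1" by linarith
  then obtain d where d: "d > 0" "\<And>u w. strong u w \<Longrightarrow> nontriv u \<Longrightarrow> \<not> compact_small d u"
    by (rule no_small_bound_state) blast
  define S where "S = {mass u | u w. strong u w \<and> nontriv u}"
  have S0: "S \<noteq> {}" using strong_exists by (auto simp: S_def)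
  have nn: "mass u \<ge> 0" for u
    unfolding mass_def graph_int_def set_lebesgue_integral_def
    by (intro sum_nonneg Bochner_Integration.integral_nonneg) (auto simp: indicator_def)
  have Sb: "bdd_below S" by (intro bdd_belowI[of _ 0]) (auto simp: S_def nn)
  define m where "m = Inf S"
  have m_le: "m \<le> mass u" if "strong u w" "nontriv u" for u w
    unfolding m_def using that by (intro cInf_lower Sb) (auto simp: S_def)
  have "\<exists>u w. strong u w \<and> nontriv u \<and> mass u < m + 1 / real (Suc n)" for n
    using cInf_lessD[OF S0, of "m + 1 / real (Suc n)"] unfolding m_def[symmetric] by (auto simp: S_def)
  then obtain u w where uw: "\<And>n. strong (u n) (w n)" "\<And>n. nontriv (u n)"
    "\<And>n. mass (u n) < m + 1 / real (Suc n)" by metis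
  define M where "M = m + 1"
  have M: "mass (u n) \<le> M" for n
    using uw(3)[of n] by (auto simp: M_def intro: order_trans[OF less_imp_le])
  have lim: "(\<lambda>n. mass (u n)) \<longlonglongrightarrow> m"
  proof (rule tendsto_sandwich[OF _ _ tendsto_const])
    show "(\<lambda>n. m + 1 / real (Suc n)) \<longlonglongrightarrow> m" using tendsto_add[OF tendsto_const LIMSEQ_Suc[OF lim_1_over_n], of m] by simp
  qed (use m_le[OF uw(1,2)] uw(3) in \<open>auto intro!: always_eventually intro: less_imp_le\<close>)
  \<comment> \<open>For each edge the data at the vertex and the edge's share of the mass, a bounded
    sequence of triples, so that one subsequence serves every hypothesis of
    \<open>strong_limit\<close>.\<close>
  define X where "X n e = (u n e 0, w n e 0, LBINT x:edom l e. \<bar>u n e x\<bar> powr p)" for n e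
  have "bounded (range (\<lambda>n. X n e))" if e: "e \<in> edges H P L" for e
  proof -
    define T where "T = sup_bound M"
    define B where "B = sqrt (1 / l * M + T\<^sup>2 + 2 / p * T powr p)"
    have 0: "0 \<in> edom l e" using l_pos by (cases e) auto
    have "X n e \<in> {-T..T} \<times> {-B..B} \<times> {0..M}" for n
    proof -
      have "\<bar>u n e 0\<bar> \<le> T" unfolding T_def by (rule strong_bounds(1)[OF uw(1,2) M e 0])
      moreover have "\<bar>w n e 0\<bar> \<le> B"
        unfolding B_def T_def by (rule real_le_rsqrt) (use strong_bounds(2)[OF uw(1,2) M e] in simp)
      moreover have "(LBINT x:edom l e. \<bar>u n e x\<bar> powr p) \<le> M"
        using edge_norm_le_mass(2)[OF uw(1,2) e] M by (rule order_trans)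
      moreover have "0 \<le> (LBINT x:edom l e. \<bar>u n e x\<bar> powr p)"
        unfolding set_lebesgue_integral_def by (intro Bochner_Integration.integral_nonneg) (auto simp: indicator_def)
      ultimately show ?thesis by (auto simp: X_def)
    qed
    then have "range (\<lambda>n. X n e) \<subseteq> {-T..T} \<times> {-B..B} \<times> {0..M}" by blast
    then show ?thesis
      by (rule bounded_subset[rotated]) (intro bounded_Times bounded_closed_interval)
  qed
  then obtain r where r: "strict_mono r" "\<And>e. e \<in> edges H P L \<Longrightarrow> convergent (\<lambda>n. X (r n) e)"
    using finite_family_convergent_subseq[OF finite_edges, of X] by blast
  have conv: "convergent (\<lambda>n. u (r n) e 0)" "convergent (\<lambda>n. w (r n) e 0)"
    "convergent (\<lambda>n. LBINT x:edom l e. \<bar>u (r n) e x\<bar> powr p)" if e: "e \<in> edges H P L" for e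
  proof -
    obtain q where q: "(\<lambda>n. X (r n) e) \<longlonglongrightarrow> q" using r(2)[OF e] by (auto simp: convergent_def)
    show "convergent (\<lambda>n. u (r n) e 0)"
      using convergentI[OF tendsto_fst[OF q]] by (simp add: X_def)
    show "convergent (\<lambda>n. w (r n) e 0)"
      using convergentI[OF tendsto_fst[OF tendsto_snd[OF q]]] by (simp add: X_def)
    show "convergent (\<lambda>n. LBINT x:edom l e. \<bar>u (r n) e x\<bar> powr p)"
      using convergentI[OF tendsto_snd[OF tendsto_snd[OF q]]] by (simp add: X_def)
  qed
  have lim_r: "(\<lambda>n. mass (u (r n))) \<longlonglongrightarrow> m"
    using LIMSEQ_subseq_LIMSEQ[OF lim r(1)] by (simp add: o_def)
  obtain U W where U: "strong U W" "mass U \<le> m" "\<And>d. d > 0 \<Longrightarrow> \<not> nontriv U \<Longrightarrow> \<exists>n. compact_small d (u (r n))"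
    by (rule strong_limit[of "\<lambda>n. u (r n)" "\<lambda>n. w (r n)" M m, OF uw(1,2) M lim_r conv]) blast+
  have "nontriv U" using U(3)[OF d(1)] d(2)[OF uw(1,2)] by blast
  moreover have "mass U \<le> mass v" if "strong v z" "nontriv v" for v z
    using U(2) m_le[OF that] by linarith
  ultimately show ?thesis using U(1) by blast
qed

text \<open>A competitor comes with some weak derivative \<open>dv\<close>, not with the continuous
  one. By Nehari's identity its action depends on \<open>v\<close> alone, so comparing masses of
  classical solutions is enough.\<close>

lemma ground_state_exists: "\<exists>u du. action_ground_state H P L l p u du"
proof -
  obtain U W where U: "strong U W" "nontriv U" "\<And>u w. strong u w \<Longrightarrow> nontriv u \<Longrightarrow> mass U \<le> mass u"
    using mass_minimizer by blast
  have bs: "bound_state H P L l p U W" by (rule strong_imp_bound_state[OF U(1,2)])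
  have "action H P L l p U W \<le> action H P L l p v dv" if v: "bound_state H P L l p v dv" for v dv
  proof -
    obtain w where w: "strong v w" using bound_state_imp_strong[OF v] by blast
    have "nontriv v" using v by (simp add: bound_state_alt)
    then have "mass U \<le> mass v" by (rule U(3)[OF w])
    then show ?thesis
      unfolding bound_state_nehari(2)[OF bs] bound_state_nehari(2)[OF v]
      using p_gt_2 by (intro mult_left_mono) (auto simp: field_simps)
  qed
  then show ?thesis using bs unfolding action_ground_state_def by blast
qed

end

theorem theorem1p6:
  fixes H P L :: nat and l p :: real
  assumes "H \<ge> 1" and "l > 0" and "p > 2"
  shows "\<exists>u du. action_ground_state H P L l p u du"
proof -
  interpret knot p H P L l using assms by unfold_locales auto
  show ?thesis by (rule ground_state_exists)
qed

end
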